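(* Let $m\ge1$ be an integer. Then (i) $\mathcal B_2(m)$ is compact; (ii) $\overline{\mathcal U}\subset\mathcal B_2^{(\infty)}(m)$; (iii) $\mathcal V\setminus\{\mathcal G(m)\}\subset\mathcal B_2^{(2)}(m)$; (iv) $\min\mathcal B_2^{(1)}(m)=\min\mathcal B_2^{(2)}(m)=q_f(m)$, where $q_f(m)$ is the largest real root of $q^3-(k+2)q^2+q-k-1=0$ if $m=2k+1$, and of $q^2-(k+1)q-k=0$ if $m=2k$.
   Context: Let $\Omega_m=\{0,1,\dots,m\}$. For $q\in(1,m+1]$ put $I_q=[0,\frac{m}{q-1}]$; a $q$-expansion of $x\in I_q$ is $(c_i)\in\Omega_m^{\mathbb N}$ with $x=\sum_{i\ge1}c_iq^{-i}$. A sequence is infinite if it has infinitely many nonzero terms; the reflection of $(a_i)$ is $(m-a_i)$; a $q$-expansion is doubly infinite if it and its reflection are both infinite. $\mathcal U_q$ is the set of $x\in I_q$ with a unique $q$-expansion, $\mathcal V_q$ the set of $x\in I_q$ with at most one doubly infinite $q$-expansion. $\mathcal U=\{q\in(1,m+1]:1\in\mathcal U_q\}$, $\overline{\mathcal U}$ its closure, $\mathcal V=\{q\in(1,m+1]:1\in\mathcal V_q\}$. $\mathcal B_2(m)$ is the set of $q\in(1,m+1]$ such that some $x\in I_q$ has exactly two different $q$-expansions. $\mathcal B_2^{(0)}(m)=\mathcal B_2(m)$, $\mathcal B_2^{(i+1)}(m)$ is the set of $q\in(1,m+1]$ that are accumulation points of $\mathcal B_2^{(i)}(m)$, and $\mathcal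 B_2^{(\infty)}(m)=\bigcap_{i\ge0}\mathcal B_2^{(i)}(m)$. $\mathcal G(m)=k+1$ if $m=2k$ ($k\ge1$), and $\mathcal G(m)=\frac{k+1+\sqrt{k^2+6k+5}}{2}$ if $m=2k+1$ ($k\ge0$). *)

theory Defs
  imports "HOL-Analysis.Analysis"
begin

text \<open>Sequences are indexed from \<open>0\<close>, so the digit \<open>c i\<close> has weight \<open>1 / q ^ (i + 1)\<close>.\<close>

definition base_interval :: "nat \<Rightarrow> real set" where
  "base_interval m = {1<..real m + 1}"

definition Iq :: "nat \<Rightarrow> real \<Rightarrow> real set" where
  "Iq m q = {0..real m / (q - 1)}"

definition is_expansion :: "nat \<Rightarrow> real \<Rightarrow> real \<Rightarrow> (nat \<Rightarrow> nat) \<Rightarrow> bool" where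
  "is_expansion m q x c \<longleftrightarrow>
     (\<forall>i. c i \<in> {0..m}) \<and> (\<lambda>i. real (c i) / q ^ Suc i) sums x"

definition infinite_seq :: "(nat \<Rightarrow> nat) \<Rightarrow> bool" where
  "infinite_seq c \<longleftrightarrow> infinite {i. c i \<noteq> 0}"

text \<open>Applied only to sequences with digits at most \<open>m\<close>, so the subtraction does not truncate.\<close>

definition reflection :: "nat \<Rightarrow> (nat \<Rightarrow> nat) \<Rightarrow> nat \<Rightarrow> nat" where
  "reflection m c = (\<lambda>i. m - c i)"

definition doubly_infinite :: "nat \<Rightarrow> (nat \<Rightarrow> nat) \<Rightarrow> bool" where
  "doubly_infinite m c \<longleftrightarrow> infinite_seq c \<and> infinite_seq (reflection m c)"

definition Uq :: "nat \<Rightarrow> real \<Rightarrow> real set" where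
  "Uq m q = {x \<in> Iq m q. \<exists>!c. is_expansion m q x c}"

definition Vq :: "nat \<Rightarrow> real \<Rightarrow> real set" where
  "Vq m q = {x \<in> Iq m q. \<exists>\<^sub>\<le>\<^sub>1c. is_expansion m q x c \<and> doubly_infinite m c}"

definition \<U> :: "nat \<Rightarrow> real set" where
  "\<U> m = {q \<in> base_interval m. 1 \<in> Uq m q}"

definition \<V> :: "nat \<Rightarrow> real set" where
  "\<V> m = {q \<in> base_interval m. 1 \<in> Vq m q}"

definition B2 :: "nat \<Rightarrow> real set" where
  "B2 m = {q \<in> base_interval m. \<exists>x \<in> Iq m q. card {c. is_expansion m q x c} = 2}"

fun B2_derived :: "nat \<Rightarrow> nat \<Rightarrow> real set" where
  "B2_derived m 0 = B2 m"
| "B2_derived m (Suc i) = {q \<in> base_interval m. q islimpt B2_derived m i}"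

definition B2_inf :: "nat \<Rightarrow> real set" where
  "B2_inf m = (\<Inter>i. B2_derived m i)"

text \<open>In the next two definitions \<open>k = m div 2\<close> covers both \<open>m = 2k\<close> and \<open>m = 2k + 1\<close>.\<close>

definition \<G> :: "nat \<Rightarrow> real" where
  "\<G> m = (let k = real (m div 2) in
     if even m then k + 1 else (k + 1 + sqrt (k\<^sup>2 + 6 * k + 5)) / 2)"

text \<open>The set of real roots is finite and nonempty in both cases, so \<^const>\<open>Max\<close> is its largest
  element.\<close>

definition q_f :: "nat \<Rightarrow> real" where
  "q_f m = (let k = real (m div 2) in
     if even m then Max {q. q ^ 2 - (k + 1) * q - k = 0}
     else Max {q. q ^ 3 - (k + 2) * q ^ 2 + q - k - 1 = 0})"

definition is_minimum :: "real set \<Rightarrow> real \<Rightarrow> bool" where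
  "is_minimum S a \<longleftrightarrow> a \<in> S \<and> (\<forall>x \<in> S. a \<le> x)"

end

theory Submission
  imports Defs
begin

text \<open>
  Some number has exactly two expansions in base \<open>q\<close> iff two univoque sequences \<open>c\<close>, \<open>d\<close> (unique
  expansions of their values) satisfy \<open>1 + val q c = val q d\<close>; so elements of \<open>B2 m\<close> are produced by
  the intermediate value theorem and excluded by listing univoque sequences.

  Let \<open>\<alpha>\<close> be an expansion of \<open>1\<close> in base \<open>q\<close> all of whose shifts lie lexicographically between its
  reflection and \<open>\<alpha>\<close>; every \<open>q \<in> \<V> m\<close> has one. If no shift of \<open>\<alpha>\<close> equals the reflection, then
  suitable prefixes \<open>b\<close> of \<open>\<alpha>\<close> give bases in \<open>\<U> m\<close> with expansion \<open>b\<close> followed by the reflection of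
  the cycle \<open>(b\<^sup>-)\<^sup>\<infinity>\<close>, where \<open>b\<^sup>-\<close> is \<open>b\<close> with its last digit decreased; these converge
  to \<open>q\<close> and at most one of them equals it. In particular no point of \<open>\<U> m\<close> is isolated in \<open>\<U> m\<close>. Otherwise \<open>\<alpha>\<close> is antiperiodic,
  say with antiperiod \<open>b\<close>, and unless \<open>q = \<G> m\<close> the sequences \<open>(b\<^sup>-)\<^sup>M \<alpha>\<close> are available in all larger
  bases; using two of them, one for each of \<open>c\<close> and \<open>d\<close>, exhibits \<open>q\<close> as a limit of limits of \<open>B2 m\<close>.

  If elements of \<open>B2 m\<close> converge to \<open>q\<close>, then limits of their pairs \<open>c\<close>, \<open>d\<close> solve the same equation, and
  they fail to be univoque only if one of their shifts, or its reflection, is such an \<open>\<alpha>\<close>. Below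
  \<open>q_f m\<close> the sequences of such a pair have tails of period two, their preperiods are bounded when
  \<open>q\<close> stays away from \<open>q_f m\<close>, and each pair belongs to finitely many bases.
\<close>

section \<open>Values of digit sequences\<close>

text \<open>Two descriptions of uniqueness are kept side by side. \<open>univoque\<close> bounds
  values of tails, so it passes to limits in the weak form \<open>weakly_univoque\<close>. The
  criterion \<open>univoqueI\<close> compares words and sees the base only through
  \<open>val q \<xi> \<le> 1\<close>, so one comparison of words serves a whole interval of bases,
  as the intermediate value theorem requires. At \<open>\<G> m\<close> the construction degenerates.
  For even m the expansion of 1 is its own reflection; for odd m the antiperiod is a single digit b
  with b - 1 = m - b, and repeating b - 1 falls below the reflection of \<alpha>. Closedness at this
  base therefore comes from finiteness below \<open>q_f m\<close>, since
  \<open>\<G> m < q_f m\<close>. A third kind of \<alpha> lies between the univoque and the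
  antiperiodic ones: a periodic \<alpha> strictly above its reflection is not univoque, as it recurs
  with value 1, and its base needs a separate pair (\<open>periodic_in_B2\<close>). The base
  \<open>q_f m\<close> is the threshold of two effects: below it a non-extreme digit forces middle
  digits ever after, and at it 1 has an antiperiodic expansion to which the approximation
  applies.\<close>

definition digits :: "nat \<Rightarrow> (nat \<Rightarrow> nat) \<Rightarrow> bool" where
  "digits m c \<longleftrightarrow> (\<forall>i. c i \<le> m)"

definition val :: "real \<Rightarrow> (nat \<Rightarrow> nat) \<Rightarrow> real" where
  "val q c = (\<Sum>i. real (c i) / q ^ Suc i)"

definition head :: "real \<Rightarrow> nat \<Rightarrow> (nat \<Rightarrow> nat) \<Rightarrow> real" where
  "head q n c = (\<Sum>i<n. real (c i) / q ^ Suc i)"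

definition shift :: "nat \<Rightarrow> (nat \<Rightarrow> nat) \<Rightarrow> nat \<Rightarrow> nat" where
  "shift n c = (\<lambda>i. c (n + i))"

definition glue :: "nat \<Rightarrow> (nat \<Rightarrow> nat) \<Rightarrow> (nat \<Rightarrow> nat) \<Rightarrow> nat \<Rightarrow> nat" where
  "glue n u v = (\<lambda>i. if i < n then u i else v (i - n))"

lemma shift_apply [simp]: "shift n c i = c (n + i)"
  by (simp add: shift_def)

lemma shift_0 [simp]: "shift 0 c = c"
  by (simp add: shift_def)

lemma shift_shift [simp]: "shift a (shift b c) = shift (a + b) c"
  by (auto simp: shift_def ac_simps)

lemma shift_glue [simp]: "shift n (glue n u v) = v"
  by (auto simp: shift_def glue_def)

lemma shift_glue_less: "j \<le> n \<Longrightarrow> shift j (glue n u v) = glue (n - j) (shift j u) v"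
  by (auto simp: shift_def glue_def fun_eq_iff add.commute)

lemma shift_glue_ge: "n \<le> j \<Longrightarrow> shift j (glue n u v) = shift (j - n) v"
  by (auto simp: shift_def glue_def fun_eq_iff)

lemma reflection_apply [simp]: "reflection m c i = m - c i"
  by (simp add: reflection_def)

lemma shift_reflection: "shift n (reflection m c) = reflection m (shift n c)"
  by (auto simp: shift_def reflection_def)

lemma reflection_reflection [simp]: "digits m c \<Longrightarrow> reflection m (reflection m c) = c"
  by (auto simp: reflection_def digits_def fun_eq_iff)

lemma digits_shift [simp]: "digits m c \<Longrightarrow> digits m (shift n c)"
  by (simp add: digits_def)

lemma digits_reflection [simp]: "digits m (reflection m c)"
  by (simp add: digits_def)

lemma digits_glue [simp]: "digits m u \<Longrightarrow> digits m v \<Longrightarrow> digits m (glue n u v)"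
  by (simp add: digits_def glue_def)

lemma digits_zero [simp]: "digits m (\<lambda>_. 0)"
  by (simp add: digits_def)

lemma digitsD: "digits m c \<Longrightarrow> c i \<le> m"
  by (simp add: digits_def)

lemma geometric_sums_Suc:
  assumes "1 < (q::real)"
  shows "(\<lambda>i. a / q ^ Suc i) sums (a / (q - 1))"
proof -
  have "(\<lambda>i. (a / q) * (1 / q) ^ i) sums ((a / q) * (1 / (1 - 1 / q)))"
    using assms by (intro sums_mult geometric_sums) auto
  moreover have "(a / q) * (1 / (1 - 1 / q)) = a / (q - 1)"
    using assms by (simp add: field_simps)
  moreover have "(a / q) * (1 / q) ^ i = a / q ^ Suc i" for i
    by (simp add: power_one_over)
  ultimately show ?thesis by (simp only:)
qed

lemma val_summable:
  assumes "digits m c" "1 < q"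
  shows "summable (\<lambda>i. real (c i) / q ^ Suc i)"
proof (rule summable_comparison_test)
  show "summable (\<lambda>i. real m / q ^ Suc i)"
    using geometric_sums_Suc[OF assms(2)] by (rule sums_summable)
  show "\<exists>N. \<forall>n\<ge>N. norm (real (c n) / q ^ Suc n) \<le> real m / q ^ Suc n"
    using assms by (auto simp: digits_def intro!: divide_right_mono)
qed

lemma is_expansion_iff:
  assumes "1 < q"
  shows "is_expansion m q x c \<longleftrightarrow> digits m c \<and> val q c = x"
  using val_summable[OF _ assms, of m c]
  by (auto simp: is_expansion_def digits_def val_def sums_iff)

lemma val_nonneg: "1 < q \<Longrightarrow> digits m c \<Longrightarrow> 0 \<le> val q c"
  unfolding val_def by (rule suminf_nonneg[OF val_summable]) auto

lemma val_le: "1 < q \<Longrightarrow> digits m c \<Longrightarrow> val q c \<le> real m / (q - 1)"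
  unfolding val_def
  by (subst sums_unique[OF geometric_sums_Suc], assumption,
      rule suminf_le[OF _ val_summable sums_summable[OF geometric_sums_Suc]])
     (auto simp: digits_def intro!: divide_right_mono)

lemma val_const: "1 < q \<Longrightarrow> val q (\<lambda>_. k) = real k / (q - 1)"
  unfolding val_def by (rule sums_unique[symmetric], rule geometric_sums_Suc)

lemma val_reflection:
  assumes "1 < q" "digits m c"
  shows "val q (reflection m c) = real m / (q - 1) - val q c"
proof -
  have "(\<lambda>i. real m / q ^ Suc i - real (c i) / q ^ Suc i) sums (real m / (q - 1) - val q c)"
    using assms val_summable[OF assms(2,1)]
    by (intro sums_diff geometric_sums_Suc) (auto simp: val_def summable_sums)
  moreover have "real m / q ^ Suc i - real (c i) / q ^ Suc i
      = real (reflection m c i) / q ^ Suc i" for i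
    using assms(2) by (simp add: digits_def of_nat_diff diff_divide_distrib)
  ultimately show ?thesis
    by (simp add: val_def sums_iff)
qed

lemma val_split:
  assumes "1 < q" "digits m c"
  shows "val q c = head q n c + val q (shift n c) / q ^ n"
proof -
  have "val q c = (\<Sum>i. real (c (i + n)) / q ^ Suc (i + n)) + head q n c"
    unfolding val_def head_def
    by (rule suminf_split_initial_segment[OF val_summable[OF assms(2,1)]])
  also have "(\<Sum>i. real (c (i + n)) / q ^ Suc (i + n))
      = (\<Sum>i. (real (shift n c i) / q ^ Suc i) / q ^ n)"
    by (simp add: power_add add.commute mult.commute mult.left_commute)
  also have "\<dots> = val q (shift n c) / q ^ n"
    unfolding val_def
    by (rule suminf_divide[OF val_summable[OF digits_shift[OF assms(2)] assms(1)]])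
  finally show ?thesis by simp
qed

lemma head_cong: "(\<And>i. i < n \<Longrightarrow> c i = d i) \<Longrightarrow> head q n c = head q n d"
  by (simp add: head_def)

lemma head_Suc: "head q (Suc n) c = head q n c + real (c n) / q ^ Suc n"
  by (simp add: head_def)

lemma val_step:
  assumes "1 < q" "digits m c"
  shows "val q (shift n c) = (real (c n) + val q (shift (Suc n) c)) / q"
  using val_split[OF assms(1), of m "shift n c" 1] assms
  by (simp add: head_def add_divide_distrib)

lemma val_step_0:
  assumes "1 < q" "digits m c"
  shows "val q c = (real (c 0) + val q (shift 1 c)) / q"
  using val_step[OF assms, of 0] by simp

lemma val_glue:
  assumes "1 < q" "digits m u" "digits m v"
  shows "val q (glue n u v) = head q n u + val q v / q ^ n"
proof -
  have "head q n (glue n u v) = head q n u"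
    by (rule head_cong) (simp add: glue_def)
  then show ?thesis
    using val_split[OF assms(1) digits_glue[OF assms(2,3)], of n n] by simp
qed

lemma head_zero [simp]: "head q n (\<lambda>_. 0) = 0"
  by (simp add: head_def)

lemma val_glue_zero:
  "1 < q \<Longrightarrow> digits m v \<Longrightarrow> val q (glue n (\<lambda>_. 0) v) = val q v / q ^ n"
  by (subst val_glue[of q m]) auto

lemma val_pos:
  assumes "1 < q" "digits m c" "c i \<noteq> 0"
  shows "0 < val q c"
  unfolding val_def by (rule suminf_pos2[OF val_summable[OF assms(2,1)], of i]) (use assms in auto)

lemma val_zero [simp]: "val q (\<lambda>_. 0) = 0"
  by (simp add: val_def)

lemma val_eq_0D:
  assumes "1 < q" "digits m c" "val q c = 0"
  shows "c = (\<lambda>_. 0)"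
  using val_pos[OF assms(1,2)] assms(3) by fastforce

lemma infinite_seq_shift: 
  assumes "infinite_seq c" shows "\<exists>i. shift n c i \<noteq> 0"
proof -
  obtain j where "j \<ge> n" "c j \<noteq> 0"
    using assms unfolding infinite_seq_def infinite_nat_iff_unbounded_le by auto
  then show ?thesis by (intro exI[of _ "j - n"]) auto
qed

lemma infinite_seq_iff:
  assumes "1 < q" "digits m c"
  shows "infinite_seq c \<longleftrightarrow> (\<forall>n. 0 < val q (shift n c))"
proof
  assume "infinite_seq c"
  then show "\<forall>n. 0 < val q (shift n c)"
    using infinite_seq_shift val_pos[OF assms(1) digits_shift[OF assms(2)]] by blast
next
  assume *: "\<forall>n. 0 < val q (shift n c)"
  show "infinite_seq c"
    unfolding infinite_seq_def infinite_nat_iff_unbounded_le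
  proof
    fix n
    have "shift n c \<noteq> (\<lambda>_. 0)" using *[rule_format, of n] by auto
    then obtain i where "c (n + i) \<noteq> 0" by (auto simp: fun_eq_iff)
    then show "\<exists>k\<ge>n. k \<in> {i. c i \<noteq> 0}" by (intro exI[of _ "n + i"]) auto
  qed
qed

lemma val_strict_antimono:
  assumes "1 < p" "p < q" "digits m c" "c \<noteq> (\<lambda>_. 0)"
  shows "val q c < val p c"
proof -
  obtain i where i: "c i \<noteq> 0" using assms(4) by blast
  have "0 < (\<Sum>i. real (c i) / p ^ Suc i - real (c i) / q ^ Suc i)"
  proof (rule suminf_pos2[of _ i])
    show "summable (\<lambda>i. real (c i) / p ^ Suc i - real (c i) / q ^ Suc i)"
      using assms by (intro summable_diff val_summable) auto
    show "0 \<le> real (c n) / p ^ Suc n - real (c n) / q ^ Suc n" for n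
      using assms by (auto intro!: divide_left_mono power_mono mult_mono)
    have "p ^ Suc i < q ^ Suc i" using assms by (intro power_strict_mono) auto
    then show "0 < real (c i) / p ^ Suc i - real (c i) / q ^ Suc i"
      using i assms by (auto intro!: divide_strict_left_mono simp del: power_Suc)
  qed
  also have "\<dots> = val p c - val q c"
    unfolding val_def using assms
    by (intro suminf_diff[symmetric] val_summable) auto
  finally show ?thesis by simp
qed

section \<open>Limits of values and compactness of the space of digit sequences\<close>

lemma tendsto_val:
  fixes Q :: "nat \<Rightarrow> real"
  assumes Q: "Q \<longlonglongrightarrow> q" "1 < q"
    and c: "\<And>i. eventually (\<lambda>n. C n i = c i) sequentially" "\<And>n. digits m (C n)"
  shows "(\<lambda>n. val (Q n) (C n)) \<longlonglongrightarrow> val q c"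
proof -
  \<comment> \<open>A base r strictly between 1 and q is eventually below every \<open>Q n\<close>,
    so m / r^(k+1) is a majorant for Tannery's theorem.\<close>
  obtain r where r: "1 < r" "r < q" using Q(2) dense by blast
  have ev: "eventually (\<lambda>n. r < Q n) sequentially" by (rule order_tendstoD(1)[OF Q(1) r(2)])
  have lim: "(\<lambda>n. real (C n k) / Q n ^ Suc k) \<longlonglongrightarrow> real (c k) / q ^ Suc k" for k
  proof -
    have "(\<lambda>n. real (C n k)) \<longlonglongrightarrow> real (c k)"
      by (rule tendsto_eventually) (use c(1)[of k] in \<open>auto elim: eventually_mono\<close>)
    then show ?thesis using Q by (intro tendsto_intros) auto
  qed
  have "eventually (\<lambda>(k, n). norm (real (C n k) / Q n ^ Suc k) \<le> real m / r ^ Suc k)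
      (at_top \<times>\<^sub>F sequentially)"
    unfolding eventually_prod_filter
  proof (intro exI conjI allI impI)
    show "eventually (\<lambda>k::nat. True) at_top" by simp
    show "eventually (\<lambda>n. r < Q n) sequentially" by (rule ev)
    fix k n assume n: "r < Q n"
    have "real (C n k) / Q n ^ Suc k \<le> real m / r ^ Suc k"
      using c(2)[of n] r n by (intro frac_le power_mono) (auto simp: digits_def)
    then show "case (k, n) of (k, n) \<Rightarrow> norm (real (C n k) / Q n ^ Suc k) \<le> real m / r ^ Suc k"
      using n r by simp
  qed
  from tannerys_theorem[OF lim this sums_summable[OF geometric_sums_Suc[OF r(1)]] sequentially_bot]
  show ?thesis by (simp add: val_def)
qed

lemma continuous_on_val:
  assumes "digits m c" "S \<subseteq> {1<..}"
  shows "continuous_on S (\<lambda>q. val q c)"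
  unfolding continuous_on_sequentially comp_def
proof safe
  fix x :: "nat \<Rightarrow> real" and a
  assume "a \<in> S" "x \<longlonglongrightarrow> a"
  then show "(\<lambda>n. val (x n) c) \<longlonglongrightarrow> val a c"
    using assms by (intro tendsto_val[of _ _ "\<lambda>_. c" c m]) auto
qed

text \<open>Tychonoff's theorem for the finite set {0..m}. Digits are discrete, so coordinatewise
  convergence means that each digit is eventually constant.\<close>

lemma digits_convergent_subseq:
  assumes "\<And>n. digits m (C n)"
  obtains c r where "strict_mono (r :: nat \<Rightarrow> nat)" "digits m c"
    "\<And>i. eventually (\<lambda>n. C (r n) i = c i) sequentially"
proof -
  have "compact (PiE UNIV (\<lambda>_::nat. {..m}))"
    using compactin_PiE[of "\<lambda>_. euclidean" UNIV "\<lambda>_::nat. {..m}"]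
    by (simp add: euclidean_product_topology finite_imp_compact)
  then have "seq_compact (PiE UNIV (\<lambda>_::nat. {..m}))"
    by (rule compact_imp_seq_compact)
  moreover have "\<forall>n. C n \<in> PiE UNIV (\<lambda>_::nat. {..m})"
    using assms by (auto simp: digits_def)
  ultimately obtain c r where c: "c \<in> PiE UNIV (\<lambda>_::nat. {..m})" "strict_mono r"
    "(C \<circ> r) \<longlonglongrightarrow> c"
    by (rule seq_compactE)
  have "eventually (\<lambda>n. C (r n) i = c i) sequentially" for i
  proof -
    have "(\<lambda>n. (C \<circ> r) n i) \<longlonglongrightarrow> c i"
      by (rule continuous_on_tendsto_compose[OF continuous_on_product_coordinates[of i] c(3)]) auto
    then show ?thesis by (simp add: tendsto_discrete)
  qed
  then show ?thesis using that[of r c] c by (auto simp: digits_def)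
qed

section \<open>Univoque sequences\<close>

text \<open>No digit can be changed by one: raising digit n takes 1 away from the tail, lowering it
  takes 1 away from the reflected tail, and both are too small for that. \<open>Uq_iff\<close>
  identifies this with uniqueness of the expansion.\<close>

definition univoque :: "nat \<Rightarrow> real \<Rightarrow> (nat \<Rightarrow> nat) \<Rightarrow> bool" where
  "univoque m q c \<longleftrightarrow> digits m c \<and>
     (\<forall>n. (c n < m \<longrightarrow> val q (shift (Suc n) c) < 1) \<and>
          (0 < c n \<longrightarrow> val q (reflection m (shift (Suc n) c)) < 1))"

text \<open>The closed counterpart of \<open>univoque\<close>, which survives when base and sequence
  converge together (\<open>weakly_univoque_limit\<close>).\<close>

definition weakly_univoque :: "nat \<Rightarrow> real \<Rightarrow> (nat \<Rightarrow> nat) \<Rightarrow> bool" where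
  "weakly_univoque m q c \<longleftrightarrow> digits m c \<and>
     (\<forall>n. (c n < m \<longrightarrow> val q (shift (Suc n) c) \<le> 1) \<and>
          (0 < c n \<longrightarrow> val q (reflection m (shift (Suc n) c)) \<le> 1))"

lemma univoque_digits: "univoque m q c \<Longrightarrow> digits m c"
  by (simp add: univoque_def)

lemma univoque_upper: "univoque m q c \<Longrightarrow> c n < m \<Longrightarrow> val q (shift (Suc n) c) < 1"
  by (simp add: univoque_def)

lemma univoque_lower:
  "univoque m q c \<Longrightarrow> 0 < c n \<Longrightarrow> val q (reflection m (shift (Suc n) c)) < 1"
  by (simp add: univoque_def)

lemma univoque_reflection: "univoque m q c \<Longrightarrow> univoque m q (reflection m c)"
  by (auto simp: univoque_def shift_reflection)

lemma univoque_zero: "univoque m q (\<lambda>_. 0)"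
  by (simp add: univoque_def shift_def)

text \<open>A zero imposes only the upper condition, and what follows a leading zero has the value
  of c divided by a power of q.\<close>

lemma univoque_glue_zero:
  assumes "1 < q" "univoque m q c" "val q c < 1"
  shows "univoque m q (glue n (\<lambda>_. 0) c)"
  unfolding univoque_def
proof (intro conjI allI)
  have dc: "digits m c" by (rule univoque_digits[OF assms(2)])
  then show "digits m (glue n (\<lambda>_. 0) c)" by simp
  fix k
  show "glue n (\<lambda>_. 0) c k < m \<longrightarrow> val q (shift (Suc k) (glue n (\<lambda>_. 0) c)) < 1"
  proof (cases "k < n")
    case True
    have "shift (Suc k) (glue n (\<lambda>_. 0) c) = glue (n - Suc k) (\<lambda>_. 0) c"
      using True by (subst shift_glue_less) (auto simp: shift_def)
    moreover have "val q c / q ^ (n - Suc k) \<le> val q c / 1"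
      using assms val_nonneg[OF assms(1) dc] by (intro divide_left_mono) auto
    ultimately show ?thesis
      using assms(3) val_glue_zero[OF assms(1) dc, of "n - Suc k"] by simp
  next
    case False
    then show ?thesis
      using univoque_upper[OF assms(2), of "k - n"]
      by (auto simp: shift_glue_ge Suc_diff_le, simp add: glue_def)
  qed
  show "0 < glue n (\<lambda>_. 0) c k \<longrightarrow>
      val q (reflection m (shift (Suc k) (glue n (\<lambda>_. 0) c))) < 1"
  proof (cases "k < n")
    case True
    then show ?thesis by (simp add: glue_def)
  next
    case False
    then show ?thesis
      using univoque_lower[OF assms(2), of "k - n"]
      by (auto simp: shift_glue_ge Suc_diff_le, simp add: glue_def)
  qed
qed

lemma first_difference:
  fixes c d :: "nat \<Rightarrow> nat"
  assumes "c \<noteq> d"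
  obtains n where "\<forall>i<n. c i = d i" "c n \<noteq> d n"
proof -
  obtain k where k: "c k \<noteq> d k" using assms by blast
  show ?thesis
  proof (rule that[of "LEAST k. c k \<noteq> d k"])
    show "c (LEAST k. c k \<noteq> d k) \<noteq> d (LEAST k. c k \<noteq> d k)" by (rule LeastI[of "\<lambda>k. c k \<noteq> d k", OF k])
    show "\<forall>i<LEAST k. c k \<noteq> d k. c i = d i" using not_less_Least by blast
  qed
qed

lemma val_split_Suc:
  assumes "1 < q" "digits m c"
  shows "val q c = head q n c + (real (c n) + val q (shift (Suc n) c)) / q ^ Suc n"
  using val_split[OF assms, of "Suc n"] by (simp add: head_Suc add_divide_distrib)

lemma val_replace:
  assumes "1 < q" "digits m c" "digits m e" "a \<le> m"
  shows "val q (glue (Suc n) (c(n := a)) e) = head q n c + (real a + val q e) / q ^ Suc n"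
proof -
  have "digits m (c(n := a))" using assms by (auto simp: digits_def)
  moreover have "head q n (c(n := a)) = head q n c" by (rule head_cong) auto
  ultimately show ?thesis
    using assms by (subst val_glue[of q m]) (auto simp: head_Suc add_divide_distrib)
qed

lemma digits_replace: "digits m c \<Longrightarrow> digits m e \<Longrightarrow> a \<le> m \<Longrightarrow> digits m (glue n (c(k := a)) e)"
  by (auto simp: digits_def glue_def)

text \<open>If c has the smaller digit at the first difference, its tail must make up at least 1; if
  it has the larger one, its reflected tail must. Both are forbidden.\<close>

lemma univoque_unique:
  assumes "1 < q" "univoque m q c" "digits m d" "val q c = val q d"
  shows "c = d"
proof (rule ccontr)
  assume "c \<noteq> d"
  then obtain n where n: "\<forall>i<n. c i = d i" "c n \<noteq> d n" by (rule first_difference)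
  have dc: "digits m c" by (rule univoque_digits[OF assms(2)])
  have "head q n c = head q n d" using n by (intro head_cong) auto
  then have eq: "real (c n) + val q (shift (Suc n) c) = real (d n) + val q (shift (Suc n) d)"
    using val_split_Suc[OF assms(1) dc, of n] val_split_Suc[OF assms(1,3), of n] assms(1,4)
    by simp
  consider "c n < d n" | "d n < c n" using n(2) by linarith
  then show False
  proof cases
    case 1
    then have "c n < m" using digitsD[OF assms(3), of n] by linarith
    then have "val q (shift (Suc n) c) < 1" by (rule univoque_upper[OF assms(2)])
    moreover have "0 \<le> val q (shift (Suc n) d)"
      by (rule val_nonneg[OF assms(1) digits_shift[OF assms(3)]])
    ultimately show False using eq 1 by linarith
  next
    case 2
    then have "val q (reflection m (shift (Suc n) c)) < 1"
      by (intro univoque_lower[OF assms(2)]) auto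
    moreover have "val q (reflection m (shift (Suc n) c)) = m / (q - 1) - val q (shift (Suc n) c)"
      using dc assms by (intro val_reflection) auto
    moreover have "val q (shift (Suc n) d) \<le> m / (q - 1)" using assms by (intro val_le) auto
    ultimately show False using eq 2 by linarith
  qed
qed

text \<open>The quasi-greedy algorithm: each digit is the largest one that leaves a positive remainder.\<close>

lemma quasi_greedy_exists:
  assumes q: "1 < q" "q \<le> real m + 1" and x: "0 < x" "x \<le> real m / (q - 1)"
  obtains c where "digits m c" "val q c = x" "\<And>n. 0 < val q (shift n c)"
    "\<And>n. c n < m \<Longrightarrow> val q (shift (Suc n) c) \<le> 1"
    "\<And>n. x < real m / (q - 1) \<Longrightarrow> q < real m + 1 \<Longrightarrow> val q (shift n c) < real m / (q - 1)"
proof -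
  define K where "K = real m / (q - 1)"
  define dig where "dig y = min m (nat (\<lceil>q * y\<rceil> - 1))" for y
  define r where "r n = rec_nat x (\<lambda>_ y. q * y - real (dig y)) n" for n
  define c where "c n = dig (r n)" for n
  have r0: "r 0 = x" and rS: "r (Suc n) = q * r n - real (c n)" for n
    by (auto simp: r_def c_def)
  have dc: "digits m c" by (simp add: digits_def c_def dig_def)
  have K1: "1 \<le> K" using q by (simp add: K_def field_simps)
  \<comment> \<open>K is the fixed point of y -> q * y - m, so taking the digit m cannot lift a
    remainder above K, nor one below K up to K.\<close>
  have qK: "q * K - real m = K" using q by (simp add: K_def field_simps)
  have step: "0 < q * y - real (dig y) \<and> q * y - real (dig y) \<le> K \<and>
      (dig y < m \<longrightarrow> q * y - real (dig y) \<le> 1) \<and>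
      (y < K \<and> 1 < K \<longrightarrow> q * y - real (dig y) < K)" if y: "0 < y" "y \<le> K" for y
  proof -
    have qy: "0 < q * y" using q y by simp
    show ?thesis
    proof (cases "dig y < m")
      case True
      then have "real (dig y) = of_int \<lceil>q * y\<rceil> - 1"
        using qy by (auto simp: dig_def min_def split: if_splits)
      then show ?thesis using K1 True by linarith
    next
      case False
      then have "dig y = m" by (simp add: dig_def)
      moreover have "real m < q * y"
      proof (cases "m = 0")
        case False
        then have "int m \<le> \<lceil>q * y\<rceil> - 1" using \<open>\<not> dig y < m\<close> by (simp add: dig_def)
        then show ?thesis by linarith
      qed (use qy in simp)
      moreover have "q * y \<le> q * K" using q y by (intro mult_left_mono) auto
      moreover have "y < K \<Longrightarrow> q * y < q * K" using q by simp
      ultimately show ?thesis using qK by auto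
    qed
  qed
  have inv: "0 < r n \<and> r n \<le> K" for n
    by (induction n) (use r0 x step in \<open>auto simp: rS c_def K_def[symmetric]\<close>)
  have "x = head q n c + r n / q ^ n" for n
  proof (induction n)
    case (Suc n)
    have "r n / q ^ n = (real (c n) + r (Suc n)) / q ^ Suc n"
      using q by (simp add: rS)
    then show ?case using Suc by (simp add: head_Suc add_divide_distrib)
  qed (simp add: head_def r0)
  note rem = this
  have "(\<lambda>n. K * (1 / q) ^ n) \<longlonglongrightarrow> 0"
    using q by (intro tendsto_mult_right_zero LIMSEQ_power_zero) auto
  then have "(\<lambda>n. r n / q ^ n) \<longlonglongrightarrow> 0"
    by (rule Lim_null_comparison[rotated])
       (use inv q in \<open>auto simp: power_one_over abs_of_pos intro!: always_eventually divide_right_mono\<close>)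
  then have "(\<lambda>n. x - r n / q ^ n) \<longlonglongrightarrow> x - 0" by (intro tendsto_intros)
  moreover have "x - r n / q ^ n = head q n c" for n using rem[of n] by simp
  ultimately have "(\<lambda>n. head q n c) \<longlonglongrightarrow> x" by simp
  then have vc: "val q c = x"
    unfolding val_def head_def using sums_unique[of "\<lambda>i. real (c i) / q ^ Suc i" x] 
    by (simp add: sums_def)
  have vr: "val q (shift n c) = r n" for n
    using val_split[OF q(1) dc, of n] rem[of n] vc q by simp
  have lt: "r n < K" if "x < K" "1 < K" for n
    by (induction n) (use r0 that step inv in \<open>auto simp: rS c_def\<close>)
  show ?thesis
  proof (rule that[OF dc vc])
    show "0 < val q (shift n c)" for n using vr inv by simp
    show "val q (shift (Suc n) c) \<le> 1" if "c n < m" for n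
      using vr[of "Suc n"] step inv[of n] that by (auto simp: c_def rS)
    show "val q (shift n c) < real m / (q - 1)" if "x < real m / (q - 1)" "q < real m + 1" for n
      using lt[of n] that q vr[of n] by (auto simp: K_def field_simps)
  qed
qed

lemma expansion_exists:
  assumes "1 < q" "q \<le> real m + 1" "0 \<le> x" "x \<le> real m / (q - 1)"
  obtains c where "digits m c" "val q c = x"
proof (cases "x = 0")
  case True
  then show ?thesis using that[of "\<lambda>_. 0"] by simp
next
  case False
  then show ?thesis using quasi_greedy_exists[of q m x] that assms by (metis less_eq_real_def)
qed

text \<open>Digit n is raised by one and the tail, diminished by 1, is expanded afresh.\<close>

lemma not_univoque_upper:
  assumes q: "1 < q" "q \<le> real m + 1" and c: "digits m c" "c n < m" "1 \<le> val q (shift (Suc n) c)"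
  obtains d where "digits m d" "val q d = val q c" "d \<noteq> c"
proof -
  obtain e where e: "digits m e" "val q e = val q (shift (Suc n) c) - 1"
    using expansion_exists[OF q, of "val q (shift (Suc n) c) - 1"] c
      val_le[OF q(1) digits_shift[OF c(1)], of "Suc n"] by auto
  have "val q (glue (Suc n) (c(n := c n + 1)) e) = val q c"
    using val_replace[OF q(1) c(1) e(1), of "c n + 1" n] val_split_Suc[OF q(1) c(1), of n] e c
    by (simp add: algebra_simps)
  moreover have "glue (Suc n) (c(n := c n + 1)) e \<noteq> c"
    by (auto simp: fun_eq_iff glue_def intro!: exI[of _ n])
  ultimately show ?thesis
    using that digits_replace[OF c(1) e(1), of "c n + 1"] c by auto
qed

lemma not_univoque_other:
  assumes q: "1 < q" "q \<le> real m + 1" and c: "digits m c" "\<not> univoque m q c"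
  obtains d where "digits m d" "val q d = val q c" "d \<noteq> c"
proof -
  consider n where "c n < m" "1 \<le> val q (shift (Suc n) c)"
    | n where "0 < c n" "1 \<le> val q (reflection m (shift (Suc n) c))"
    using c unfolding univoque_def by (meson not_le)
  then show ?thesis
  proof cases
    case 1
    then show ?thesis using not_univoque_upper[OF q c(1)] that by blast
  next
    case 2
    then obtain d where d: "digits m d" "val q d = val q (reflection m c)" "d \<noteq> reflection m c"
      using not_univoque_upper[OF q, of "reflection m c" n] digitsD[OF c(1), of n]
      by (auto simp: shift_reflection)
    show ?thesis
    proof (rule that[of "reflection m d"])
      show "val q (reflection m d) = val q c"
        using d(2) val_reflection[OF q(1) d(1)] val_reflection[OF q(1) c(1)] by simp
      show "reflection m d \<noteq> c" using d by force
    qed simp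
  qed
qed

lemma Uq_iff:
  assumes q: "1 < q" "q \<le> real m + 1"
  shows "x \<in> Uq m q \<longleftrightarrow> (\<exists>c. univoque m q c \<and> val q c = x)"
proof
  assume "x \<in> Uq m q"
  then obtain c where c: "digits m c" "val q c = x"
    "\<And>d. digits m d \<Longrightarrow> val q d = x \<Longrightarrow> d = c"
    using q(1) unfolding Uq_def is_expansion_iff[OF q(1)] by auto
  then have "univoque m q c" using not_univoque_other[OF q c(1)] by metis
  with c show "\<exists>c. univoque m q c \<and> val q c = x" by blast
next
  assume "\<exists>c. univoque m q c \<and> val q c = x"
  then obtain c where c: "univoque m q c" "val q c = x" by blast
  note dc = univoque_digits[OF c(1)]
  have "x \<in> Iq m q" using val_nonneg[OF q(1) dc] val_le[OF q(1) dc] c(2) by (simp add: Iq_def)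
  moreover have "\<exists>!c. is_expansion m q x c"
    unfolding is_expansion_iff[OF q(1)] using c dc univoque_unique[OF q(1) c(1)] by metis
  ultimately show "x \<in> Uq m q" by (simp add: Uq_def)
qed

lemma univoque_zero_top_aux:
  assumes q: "1 < q" and c: "univoque m q c" "c n = 0" "c (Suc n) = m" "0 < m"
  shows "real m / (q - 1) < 2"
proof (rule ccontr)
  assume K: "\<not> real m / (q - 1) < 2"
  note dc = univoque_digits[OF c(1)]
  have 1: "val q (shift (Suc n) c) < 1" using univoque_upper[OF c(1), of n] c by simp
  have "real m / (q - 1) - val q (shift (Suc (Suc n)) c) < 1"
    using univoque_lower[OF c(1), of "Suc n"] c(3,4) val_reflection[OF q digits_shift[OF dc]] by simp
  moreover have "q * val q (shift (Suc n) c) = real m + val q (shift (Suc (Suc n)) c)"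
    using val_step[OF q dc, of "Suc n"] q c(3) by simp
  moreover have "q * val q (shift (Suc n) c) < q * 1"
    using 1 q by (intro mult_strict_left_mono) auto
  \<comment> \<open>If m / (q - 1) were at least 2, the tail after the digit m would exceed 1, so q
    times a number below 1 would exceed m + 1.\<close>
  ultimately have "real m + 1 < q" using K by linarith
  with K q show False by (simp add: field_simps)
qed

text \<open>A digit strictly between 0 and m bounds both the next tail and its reflection by 1, and
  these values add up to m / (q - 1). A nonconstant sequence over {0, m} has unequal neighbours
  instead.\<close>

lemma univoque_nonconstant:
  assumes q: "1 < q" and c: "univoque m q c" "c \<noteq> (\<lambda>_. 0)" "c \<noteq> (\<lambda>_. m)"
  shows "real m / (q - 1) < 2"
proof -
  note dc = univoque_digits[OF c(1)]
  show ?thesis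
  proof (cases "\<exists>n. 0 < c n \<and> c n < m")
    case True
    then obtain n where n: "0 < c n" "c n < m" by blast
    show ?thesis
      using univoque_upper[OF c(1) n(2)] univoque_lower[OF c(1) n(1)]
        val_reflection[OF q digits_shift[OF dc, of "Suc n"]] by linarith
  next
    case False
    then have zm: "c n = 0 \<or> c n = m" for n using digitsD[OF dc, of n] by (meson le_neq_implies_less not_gr_zero)
    have m: "0 < m" using zm c(2,3) by (metis gr0I ext)
    obtain n where n: "c n \<noteq> c (Suc n)"
    proof (rule ccontr)
      assume "\<not> thesis"
      then have "\<And>n. c (Suc n) = c n" using that by metis
      then have "c n = c 0" for n by (induction n) auto
      then show False using zm[of 0] c by (metis ext)
    qed
    then consider "c n = 0" "c (Suc n) = m" | "c n = m" "c (Suc n) = 0" using zm by metis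
    then show ?thesis
    proof cases
      case 1
      then show ?thesis using univoque_zero_top_aux[OF q c(1)] m by blast
    next
      case 2
      then show ?thesis
        using univoque_zero_top_aux[OF q univoque_reflection[OF c(1)], of n] m by simp
    qed
  qed
qed

section \<open>Two expansions as an equation between univoque sequences\<close>

lemma glue_one_eq: "g 0 = a \<Longrightarrow> shift 1 g = c \<Longrightarrow> g = glue 1 (\<lambda>_. a) c"
  by (rule ext) (auto simp: glue_def shift_def)

text \<open>Cut two expansions at their first difference. Another expansion of either tail would be
  a third expansion of x, so both tails are univoque; and digits differing by more than one would
  leave room for a third expansion with an intermediate digit.\<close>

lemma B2_iff:
  assumes q: "1 < q" "q \<le> real m + 1"
  shows "q \<in> B2 m \<longleftrightarrow> (\<exists>c d. univoque m q c \<and> univoque m q d \<and> 1 + val q c = val q d)"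
proof
  assume "q \<in> B2 m"
  then obtain x where "card {c. is_expansion m q x c} = 2" by (auto simp: B2_def)
  then obtain e' f' where ef': "{c. is_expansion m q x c} = {e', f'}" "e' \<noteq> f'"
    by (auto simp: card_2_iff)
  from ef'(2) obtain n where n: "\<forall>i<n. e' i = f' i" "e' n \<noteq> f' n" by (rule first_difference)
  obtain e f where ef: "{c. is_expansion m q x c} = {e, f}" "\<forall>i<n. e i = f i" "e n < f n"
  proof (cases "e' n < f' n")
    case True
    then show ?thesis using that[of e' f'] ef' n by blast
  next
    case False
    then show ?thesis using that[of f' e'] ef' n by force
  qed
  have only: "digits m g \<Longrightarrow> val q g = x \<Longrightarrow> g = e \<or> g = f" for g
    using ef(1) is_expansion_iff[OF q(1)] by blast
  have e: "digits m e" "val q e = x" and f: "digits m f" "val q f = x"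
    using ef(1) is_expansion_iff[OF q(1)] by blast+
  define c d where "c = shift (Suc n) f" and "d = shift (Suc n) e"
  have dc: "digits m c" and dd: "digits m d" using e f by (auto simp: c_def d_def)
  have head: "head q n e = head q n f" using ef(2) by (intro head_cong) auto
  have eq: "real (e n) + val q d = real (f n) + val q c"
    using val_split_Suc[OF q(1) e(1), of n] val_split_Suc[OF q(1) f(1), of n] e(2) f(2) head q
    by (simp add: c_def d_def)
  have uniq: "univoque m q (shift (Suc n) g)" if g: "g = e \<or> g = f" for g
  proof (rule ccontr)
    assume "\<not> univoque m q (shift (Suc n) g)"
    moreover have dg: "digits m g" "val q g = x" using g e f by auto
    ultimately obtain h where h: "digits m h" "val q h = val q (shift (Suc n) g)"
      "h \<noteq> shift (Suc n) g"
      using not_univoque_other[OF q, of "shift (Suc n) g"] by auto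
    have "val q (glue (Suc n) g h) = x"
      using val_split[OF q(1) dg(1), of "Suc n"] dg(2) h val_glue[OF q(1) dg(1) h(1)] by simp
    moreover have "digits m (glue (Suc n) g h)" using dg h by simp
    ultimately have *: "glue (Suc n) g h = e \<or> glue (Suc n) g h = f" using only by blast
    have "glue (Suc n) g h n = g n" by (simp add: glue_def)
    with * g ef(3) have "glue (Suc n) g h = g" by (metis less_irrefl)
    then have "shift (Suc n) g = h" using shift_glue[of "Suc n" g h] by simp
    with h(3) show False by simp
  qed
  have "f n = e n + 1"
  proof (rule ccontr)
    assume "f n \<noteq> e n + 1"
    then have big: "e n + 2 \<le> f n" using ef(3) by simp
    have "2 \<le> val q d" using eq big val_nonneg[OF q(1) dc] by linarith
    then obtain h where h: "digits m h" "val q h = val q d - 1"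
      using expansion_exists[OF q, of "val q d - 1"] val_le[OF q(1) dd] by auto
    let ?g = "glue (Suc n) (e(n := e n + 1)) h"
    have le: "e n + 1 \<le> m" using big digitsD[OF f(1), of n] by simp
    have "val q ?g = x"
      using val_replace[OF q(1) e(1) h(1) le, of n] val_split_Suc[OF q(1) e(1), of n] e(2) h(2)
      by (simp add: d_def algebra_simps)
    then have "?g = e \<or> ?g = f" using only digits_replace[OF e(1) h(1) le] by blast
    moreover have "?g n = e n + 1" by (simp add: glue_def)
    ultimately show False using big by auto
  qed
  then have "1 + val q c = val q d" using eq by simp
  moreover have "univoque m q c" "univoque m q d" using uniq by (auto simp: c_def d_def)
  ultimately show "\<exists>c d. univoque m q c \<and> univoque m q d \<and> 1 + val q c = val q d" by blast
next
  assume "\<exists>c d. univoque m q c \<and> univoque m q d \<and> 1 + val q c = val q d"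
  then obtain c d where cd: "univoque m q c" "univoque m q d" "1 + val q c = val q d" by blast
  define K where "K = real m / (q - 1)"
  note dc = univoque_digits[OF cd(1)] and dd = univoque_digits[OF cd(2)]
  have c0: "0 \<le> val q c" and dK: "val q d \<le> K"
    using val_nonneg[OF q(1) dc] val_le[OF q(1) dd] by (auto simp: K_def)
  have m: "1 \<le> m" using q by (cases m) auto
  text \<open>An extra leading digit is impossible above \<open>m\<close> or below \<open>0\<close>, so it suffices to prepend
    either the largest or the smallest pair of consecutive digits.\<close>
  obtain j where j: "j + 1 \<le> m" "val q d + 1 \<le> K \<Longrightarrow> j = 0" "val q c \<ge> 1 \<Longrightarrow> j + 1 = m"
  proof (cases "val q d + 1 \<le> K")
    case True
    \<comment> \<open>This case is contradictory: \<open>val q d \<ge> 1\<close> gives K \<ge> 2,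
      which a nonconstant univoque d excludes. So the digit chosen is always m - 1.\<close>
    have "d \<noteq> (\<lambda>_. 0)" using cd(3) c0 by auto
    moreover have "d \<noteq> (\<lambda>_. m)" using val_const[OF q(1), of m] True by (auto simp: K_def)
    ultimately have "K < 2" using univoque_nonconstant[OF q(1) cd(2)] by (simp add: K_def)
    then show ?thesis using True cd(3) c0 by linarith
  next
    case False
    then show ?thesis using that[of "m - 1"] m by auto
  qed
  define e f where "e = glue 1 (\<lambda>_. j + 1) c" and "f = glue 1 (\<lambda>_. j) d"
  have dig: "digits m (\<lambda>_. j + 1)" "digits m (\<lambda>_. j)" using j by (auto simp: digits_def)
  have de: "digits m e" and df: "digits m f" using dig dc dd by (auto simp: e_def f_def)
  define x where "x = (real j + val q d) / q"
  have ve: "val q e = x" and vf: "val q f = x"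
    using val_step_0[OF q(1) de] val_step_0[OF q(1) df] cd(3) 
    by (auto simp: e_def f_def x_def glue_def shift_def)
  have "{g. is_expansion m q x g} = {e, f}"
  proof (intro equalityI subsetI)
    fix g assume "g \<in> {g. is_expansion m q x g}"
    then have g: "digits m g" "val q g = x" by (auto simp: is_expansion_iff[OF q(1)])
    have gs: "real (g 0) + val q (shift 1 g) = real j + val q d"
      using val_step_0[OF q(1) g(1)] g(2) q by (simp add: x_def)
    have b: "0 \<le> val q (shift 1 g)" "val q (shift 1 g) \<le> K"
      using val_nonneg[OF q(1) digits_shift[OF g(1)]] val_le[OF q(1) digits_shift[OF g(1)]]
      by (auto simp: K_def)
    have g0: "j \<le> g 0"
    proof (rule ccontr)
      assume *: "\<not> j \<le> g 0"
      then have "val q d + 1 \<le> val q (shift 1 g)" using gs by linarith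
      then show False using j(2) b * by linarith
    qed
    have g1: "g 0 \<le> j + 1"
    proof (rule ccontr)
      assume *: "\<not> g 0 \<le> j + 1"
      then have "1 \<le> val q c" using gs cd(3) b by linarith
      then show False using j(3) * digitsD[OF g(1), of 0] by linarith
    qed
    consider "g 0 = j" | "g 0 = j + 1" using g0 g1 by linarith
    then show "g \<in> {e, f}"
    proof cases
      case 1
      then have "d = shift 1 g" using gs by (intro univoque_unique[OF q(1) cd(2)]) (use g in auto)
      then show ?thesis using glue_one_eq[of g, OF 1] by (simp add: f_def)
    next
      case 2
      then have "c = shift 1 g" using gs cd(3) by (intro univoque_unique[OF q(1) cd(1)]) (use g in auto)
      then show ?thesis using glue_one_eq[of g, OF 2] by (simp add: e_def)
    qed
  next
    fix g assume "g \<in> {e, f}"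
    then show "g \<in> {g. is_expansion m q x g}"
      using de df ve vf by (auto simp: is_expansion_iff[OF q(1)])
  qed
  moreover have "e \<noteq> f" by (auto simp: e_def f_def glue_def fun_eq_iff)
  ultimately have "card {g. is_expansion m q x g} = 2" by simp
  moreover have "x \<in> Iq m q"
    using val_nonneg[OF q(1) de] val_le[OF q(1) de] ve by (simp add: Iq_def)
  ultimately show "q \<in> B2 m" using q by (auto simp: B2_def base_interval_def)
qed

section \<open>Doubly infinite expansions of one\<close>

lemma infinite_seq_shift_iff: "infinite_seq (shift n c) \<longleftrightarrow> infinite_seq c"
  unfolding infinite_seq_def infinite_nat_iff_unbounded_le
proof safe
  fix k assume "\<forall>k. \<exists>l\<ge>k. l \<in> {i. shift n c i \<noteq> 0}"
  then obtain l where "l \<ge> k" "shift n c l \<noteq> 0" by blast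
  then show "\<exists>l\<ge>k. l \<in> {i. c i \<noteq> 0}" by (intro exI[of _ "n + l"]) auto
next
  fix k assume "\<forall>k. \<exists>l\<ge>k. l \<in> {i. c i \<noteq> 0}"
  then obtain l where "l \<ge> n + k" "c l \<noteq> 0" by blast
  then show "\<exists>l\<ge>k. l \<in> {i. shift n c i \<noteq> 0}" by (intro exI[of _ "l - n"]) auto
qed

lemma doubly_infinite_shift_iff: "doubly_infinite m (shift n c) \<longleftrightarrow> doubly_infinite m c"
  by (simp add: doubly_infinite_def infinite_seq_shift_iff flip: shift_reflection)

lemma doubly_infinite_glue: "doubly_infinite m (glue n u v) \<longleftrightarrow> doubly_infinite m v"
  using doubly_infinite_shift_iff[of m n "glue n u v"] by simp

lemma doubly_infinite_iff:
  assumes "1 < q" "digits m c"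
  shows "doubly_infinite m c \<longleftrightarrow>
    (\<forall>n. 0 < val q (shift n c) \<and> val q (shift n c) < real m / (q - 1))"
  using assms infinite_seq_iff[of q m c] infinite_seq_iff[of q m "reflection m c"]
    val_reflection[OF assms(1) digits_shift[OF assms(2)]]
  by (auto simp: doubly_infinite_def shift_reflection)

text \<open>The quasi-greedy expansion of 1 satisfies the upper bounds by construction. If a lower
  bound failed, that digit could be lowered and the enlarged tail, still below m / (q - 1), expanded
  quasi-greedily, which would give a second doubly infinite expansion.\<close>

lemma Vq_one_imp_weakly_univoque:
  assumes q: "1 < q" "q < real m + 1" and "1 \<in> Vq m q"
  obtains c where "weakly_univoque m q c" "doubly_infinite m c" "val q c = 1"
proof -
  have K: "1 < real m / (q - 1)" using q by (simp add: field_simps)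
  obtain c where c: "digits m c" "val q c = 1" "\<And>n. 0 < val q (shift n c)"
    "\<And>n. c n < m \<Longrightarrow> val q (shift (Suc n) c) \<le> 1"
    "\<And>n. val q (shift n c) < real m / (q - 1)"
    using quasi_greedy_exists[of q m 1] K q by (smt (verit))
  have di: "doubly_infinite m c" using c by (simp add: doubly_infinite_iff[OF q(1)])
  have "val q (reflection m (shift (Suc n) c)) \<le> 1" if n: "0 < c n" for n
  proof (rule ccontr)
    define y where "y = val q (shift (Suc n) c) + 1"
    assume "\<not> ?thesis"
    then have y: "0 < y" "y < real m / (q - 1)"
      using val_reflection[OF q(1) digits_shift[OF c(1)], of "Suc n"] c(3)[of "Suc n"]
      by (auto simp: y_def)
    then obtain e where e: "digits m e" "val q e = y" "\<And>n. 0 < val q (shift n e)"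
      "\<And>n. val q (shift n e) < real m / (q - 1)"
      using quasi_greedy_exists[of q m y] q by (smt (verit))
    let ?d = "glue (Suc n) (c(n := c n - 1)) e"
    have le: "c n - 1 \<le> m" using digitsD[OF c(1), of n] by simp
    have "doubly_infinite m ?d"
      using e by (simp add: doubly_infinite_glue doubly_infinite_iff[OF q(1)])
    moreover have "val q ?d = 1"
      using val_replace[OF q(1) c(1) e(1) le, of n] val_split_Suc[OF q(1) c(1), of n] n c(2) e(2)
      by (simp add: y_def of_nat_diff)
    moreover have "digits m ?d" using digits_replace[OF c(1) e(1) le] .
    moreover have "?d n \<noteq> c n" using n by (simp add: glue_def)
    moreover have "\<exists>\<^sub>\<le>\<^sub>1c. (digits m c \<and> val q c = 1) \<and> doubly_infinite m c"
      using assms(3) by (simp add: Vq_def is_expansion_iff[OF q(1)])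
    ultimately show False
      using di c(1,2) by (metis (mono_tags, lifting) Uniq_D)
  qed
  then have "weakly_univoque m q c" using c by (simp add: weakly_univoque_def)
  then show ?thesis using that di c by blast
qed

section \<open>Lexicographic order and admissible sequences\<close>

text \<open>The comparison is decided within the first l digits, so it passes to all sequences that
  share these prefixes.\<close>

definition lex_within :: "nat \<Rightarrow> (nat \<Rightarrow> nat) \<Rightarrow> (nat \<Rightarrow> nat) \<Rightarrow> bool" where
  "lex_within l s t \<longleftrightarrow> (\<exists>n<l. (\<forall>i<n. s i = t i) \<and> s n < t n)"

definition lex_less :: "(nat \<Rightarrow> nat) \<Rightarrow> (nat \<Rightarrow> nat) \<Rightarrow> bool" where
  "lex_less s t \<longleftrightarrow> (\<exists>n. (\<forall>i<n. s i = t i) \<and> s n < t n)"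

lemma lex_withinI: "n < l \<Longrightarrow> (\<And>i. i < n \<Longrightarrow> s i = t i) \<Longrightarrow> s n < t n \<Longrightarrow> lex_within l s t"
  by (auto simp: lex_within_def)

lemma lex_lessI: "(\<And>i. i < n \<Longrightarrow> s i = t i) \<Longrightarrow> s n < t n \<Longrightarrow> lex_less s t"
  by (auto simp: lex_less_def)

lemma lex_within_imp_less: "lex_within l s t \<Longrightarrow> lex_less s t"
  by (auto simp: lex_within_def lex_less_def)

lemma lex_less_imp_within: "lex_less s t \<Longrightarrow> \<exists>l. lex_within l s t"
  by (auto simp: lex_within_def lex_less_def)

lemma lex_within_mono: "lex_within l s t \<Longrightarrow> l \<le> l' \<Longrightarrow> lex_within l' s t"
  unfolding lex_within_def by (meson order.strict_trans2)

lemma lex_within_cong: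
  assumes "\<And>i. i < l \<Longrightarrow> s i = s' i" "\<And>i. i < l \<Longrightarrow> t i = t' i"
  shows "lex_within l s t \<longleftrightarrow> lex_within l s' t'"
  unfolding lex_within_def
proof (intro ex_cong1 conj_cong refl)
  fix n assume n: "n < l"
  show "(\<forall>i<n. s i = t i) \<longleftrightarrow> (\<forall>i<n. s' i = t' i)"
    using assms n by (intro all_cong) simp
  show "s n < t n \<longleftrightarrow> s' n < t' n" using assms n by simp
qed

lemma lex_irrefl: "\<not> lex_less s s"
  by (simp add: lex_less_def)

lemma lex_trans:
  assumes "lex_less s t" "lex_less t u" shows "lex_less s u"
proof -
  obtain a b where a: "\<forall>i<a. s i = t i" "s a < t a" and b: "\<forall>i<b. t i = u i" "t b < u b"
    using assms by (auto simp: lex_less_def)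
  show ?thesis
  proof (rule lex_lessI[of "min a b"])
    show "s i = u i" if "i < min a b" for i using a b that by simp
    show "s (min a b) < u (min a b)"
      using a b by (cases a b rule: linorder_cases) (auto simp: min_def)
  qed
qed

lemma lex_asym: "lex_less s t \<Longrightarrow> \<not> lex_less t s"
  using lex_trans lex_irrefl by blast

lemma lex_linear: "s = t \<or> lex_less s t \<or> lex_less t s"
proof (cases "s = t")
  case False
  then obtain n where "\<forall>i<n. s i = t i" "s n \<noteq> t n" by (rule first_difference)
  then show ?thesis using lex_lessI[of n s t] lex_lessI[of n t s] by fastforce
qed simp

lemma not_lex_less_cases:
  assumes "\<not> lex_less t s" shows "lex_within n s t \<or> (\<forall>i<n. s i = t i)"
proof (rule disjCI)
  assume ne: "\<not> (\<forall>i<n. s i = t i)"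
  then have "s \<noteq> t" by blast
  then obtain k where k: "\<forall>i<k. s i = t i" "s k \<noteq> t k" by (rule first_difference)
  have "k < n" using ne k(1) by (meson linorder_not_le order.strict_trans2)
  moreover have "s k < t k" using assms k lex_lessI[of k t s] by fastforce
  ultimately show "lex_within n s t" using k by (auto simp: lex_within_def)
qed

lemma lex_within_reflection:
  assumes "digits m s" "digits m t"
  shows "lex_within l (reflection m s) (reflection m t) \<longleftrightarrow> lex_within l t s"
proof -
  have "m - s i = m - t i \<longleftrightarrow> t i = s i" "m - s i < m - t i \<longleftrightarrow> t i < s i" for i
    using digitsD[OF assms(1), of i] digitsD[OF assms(2), of i] by auto
  then show ?thesis by (simp add: lex_within_def)
qed

lemma lex_reflection:
  assumes "digits m s" "digits m t"
  shows "lex_less (reflection m s) (reflection m t) \<longleftrightarrow> lex_less t s"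
proof -
  have "m - s i = m - t i \<longleftrightarrow> t i = s i" "m - s i < m - t i \<longleftrightarrow> t i < s i" for i
    using digitsD[OF assms(1), of i] digitsD[OF assms(2), of i] by auto
  then show ?thesis by (simp add: lex_less_def)
qed

lemma lex_reflection_left:
  "digits m s \<Longrightarrow> digits m t \<Longrightarrow> lex_less (reflection m s) t \<longleftrightarrow> lex_less (reflection m t) s"
  using lex_reflection[of m s "reflection m t"] by simp

lemma lex_reflection_right:
  "digits m s \<Longrightarrow> digits m t \<Longrightarrow> lex_less s (reflection m t) \<longleftrightarrow> lex_less t (reflection m s)"
  using lex_reflection[of m "reflection m s" t] by simp

lemma lex_less_shift:
  assumes "\<And>i. i < n \<Longrightarrow> s i = t i" "lex_less (shift n s) (shift n t)"
  shows "lex_less s t"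
proof -
  obtain k where k: "\<forall>i<k. shift n s i = shift n t i" "shift n s k < shift n t k"
    using assms(2) by (auto simp: lex_less_def)
  show ?thesis
  proof (rule lex_lessI[of "n + k"])
    show "s i = t i" if "i < n + k" for i
      using k(1)[rule_format, of "i - n"] assms(1)[of i] that by (cases "i < n") auto
  qed (use k in simp)
qed

text \<open>The gap of at least one in digit n pays for a tail of c of value 1; only the excess e
  and the tail of \<xi> remain.\<close>

lemma val_lex_step:
  assumes "1 < q" "digits m c" "digits m \<xi>" "\<forall>i<n. c i = \<xi> i" "c n < \<xi> n"
    and "val q (shift (Suc n) c) \<le> 1 + e"
  shows "val q c \<le> val q \<xi> + (e - val q (shift (Suc n) \<xi>)) / q ^ Suc n"
proof -
  have "head q n c = head q n \<xi>" using assms(4) by (intro head_cong) auto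
  moreover have "(real (c n) + val q (shift (Suc n) c)) / q ^ Suc n \<le> (real (\<xi> n) + e) / q ^ Suc n"
    using assms by (intro divide_right_mono) auto
  ultimately show ?thesis
    unfolding val_split_Suc[OF assms(1,2), of n] val_split_Suc[OF assms(1,3), of n]
    by (simp add: add_divide_distrib diff_divide_distrib)
qed

text \<open>The excess over 1 is reduced for all shifts simultaneously: a bound 1 + K / q^k valid
  for every shift yields 1 + K / q^(k+1) by \<open>val_lex_step\<close>.\<close>

lemma val_le_one:
  assumes q: "1 < q" and d: "digits m c" "digits m \<xi>" and \<xi>: "val q \<xi> \<le> 1"
    and lex: "\<And>n. \<not> lex_less \<xi> (shift n c)"
  shows "val q c \<le> 1"
proof -
  define K where "K = real m / (q - 1)"
  have K0: "0 \<le> K" using q by (simp add: K_def)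
  have *: "val q (shift n c) \<le> 1 + K / q ^ k" for n k
  proof (induction k arbitrary: n)
    case 0
    show ?case using val_le[OF q digits_shift[OF d(1), of n]] by (simp add: K_def del: shift_apply)
  next
    case (Suc k)
    show ?case
    proof (cases "shift n c = \<xi>")
      case True
      have "0 \<le> K / q ^ Suc k" using K0 q by simp
      then show ?thesis using \<xi> True by simp
    next
      case False
      then obtain j where j: "\<forall>i<j. shift n c i = \<xi> i" "shift n c j < \<xi> j"
        using lex[of n] lex_linear[of "shift n c" \<xi>] by (auto simp: lex_less_def)
      have "val q (shift n c) \<le> val q \<xi> + (K / q ^ k - val q (shift (Suc j) \<xi>)) / q ^ Suc j"
        using Suc[of "Suc j + n"] j by (intro val_lex_step[OF q digits_shift[OF d(1)] d(2)]) (simp_all del: shift_apply)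
      also have "\<dots> \<le> val q \<xi> + (K / q ^ k) / q ^ Suc j"
        using q val_nonneg[OF q digits_shift[OF d(2)]] by (intro add_left_mono divide_right_mono) auto
      also have "\<dots> \<le> 1 + (K / q ^ k) / q ^ Suc 0"
        using q K0 \<xi> by (intro add_mono divide_left_mono power_increasing) auto
      finally show ?thesis by (simp add: mult.commute del: shift_apply)
    qed
  qed
  have "(\<lambda>k. 1 + K * (1 / q) ^ k) \<longlonglongrightarrow> 1 + K * 0"
    using q by (intro tendsto_intros LIMSEQ_power_zero) auto
  moreover have "val q c \<le> 1 + K * (1 / q) ^ k" for k
    using *[of 0 k] by (simp add: power_one_over)
  ultimately have "val q c \<le> 1 + K * 0" by (intro LIMSEQ_le_const) auto
  then show ?thesis by simp
qed

lemma val_less_one: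
  assumes q: "1 < q" and d: "digits m c" "digits m \<xi>" and \<xi>: "val q \<xi> \<le> 1"
    and lex: "\<And>n. \<not> lex_less \<xi> (shift n c)"
    and strict: "val q \<xi> < 1 \<or> lex_less c \<xi> \<and> infinite_seq \<xi>"
  shows "val q c < 1"
proof (cases "c = \<xi>")
  case True
  then show ?thesis using strict lex_irrefl by auto
next
  case False
  then obtain j where j: "\<forall>i<j. c i = \<xi> i" "c j < \<xi> j"
    using lex[of 0] lex_linear[of c \<xi>] by (auto simp: lex_less_def)
  have "val q (shift (Suc j) c) \<le> 1"
    using lex by (intro val_le_one[OF q digits_shift[OF d(1)] d(2) \<xi>]) auto
  then have "val q c \<le> val q \<xi> + (0 - val q (shift (Suc j) \<xi>)) / q ^ Suc j"
    by (intro val_lex_step[OF q d j]) auto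
  moreover have "0 \<le> val q (shift (Suc j) \<xi>)" by (rule val_nonneg[OF q digits_shift[OF d(2)]])
  then have "0 \<le> val q (shift (Suc j) \<xi>) / q ^ Suc j" using q by simp
  moreover have "0 < val q (shift (Suc j) \<xi>) / q ^ Suc j" if "infinite_seq \<xi>"
    using that q infinite_seq_iff[OF q d(2)] by simp
  ultimately show ?thesis using strict \<xi> by (auto simp del: power_Suc)
qed

text \<open>This has two uses. Where \<xi> has value exactly 1 the comparisons must be strict; in
  larger bases its value is below 1 and shifts may coincide with \<xi> or its reflection. Only
  shifts by n > 0 are constrained because \<open>univoque\<close> looks at tails behind a
  digit.\<close>

lemma univoqueI:
  assumes q: "1 < q" and d: "digits m c" "digits m \<xi>" and \<xi>: "val q \<xi> \<le> 1"
    and lex: "\<And>n. 0 < n \<Longrightarrow> \<not> lex_less \<xi> (shift n c) \<and> \<not> lex_less (shift n c) (reflection m \<xi>)"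
    and strict: "val q \<xi> < 1 \<or> infinite_seq \<xi> \<and>
      (\<forall>n>0. lex_less (shift n c) \<xi> \<and> lex_less (reflection m \<xi>) (shift n c))"
  shows "univoque m q c"
proof -
  have "val q (shift (Suc n) c) < 1" for n
    using lex strict by (intro val_less_one[OF q digits_shift[OF d(1)] d(2) \<xi>]) auto
  moreover have "val q (reflection m (shift (Suc n) c)) < 1" for n
  proof (rule val_less_one[OF q digits_reflection d(2) \<xi>])
    show "\<not> lex_less \<xi> (shift k (reflection m (shift (Suc n) c)))" for k
      using lex[of "Suc (k + n)"] lex_reflection_right[OF d(2) digits_shift[OF d(1), of "Suc (k + n)"]]
      by (simp add: shift_reflection)
    show "val q \<xi> < 1 \<or> lex_less (reflection m (shift (Suc n) c)) \<xi> \<and> infinite_seq \<xi>"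
      using strict lex_reflection_left[OF d(2) digits_shift[OF d(1), of "Suc n"]] by auto
  qed
  ultimately show ?thesis using d by (simp add: univoque_def)
qed

text \<open>Both inequalities are non-strict and no base occurs. For n > 0, equality in the first
  means that \<alpha> is periodic, equality in the second that it is antiperiodic.\<close>

definition admissible :: "nat \<Rightarrow> (nat \<Rightarrow> nat) \<Rightarrow> bool" where
  "admissible m \<alpha> \<longleftrightarrow> digits m \<alpha> \<and>
     (\<forall>n. \<not> lex_less \<alpha> (shift n \<alpha>) \<and> \<not> lex_less (shift n \<alpha>) (reflection m \<alpha>))"

lemma lex_imp_val_less:
  assumes q: "1 < q" and d: "digits m t" "digits m s"
    and t: "\<And>n. t n < m \<Longrightarrow> val q (shift (Suc n) t) \<le> 1"
    and s: "infinite_seq s" and lex: "lex_less t s"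
  shows "val q t < val q s"
proof -
  obtain j where j: "\<forall>i<j. t i = s i" "t j < s j" using lex by (auto simp: lex_less_def)
  have "val q (shift (Suc j) t) \<le> 1" using j(2) digitsD[OF d(2), of j] by (intro t) auto
  then have "val q t \<le> val q s + (0 - val q (shift (Suc j) s)) / q ^ Suc j"
    by (intro val_lex_step[OF q d j]) auto
  moreover have "0 < val q (shift (Suc j) s) / q ^ Suc j"
    using q s infinite_seq_iff[OF q d(2)] by simp
  ultimately show ?thesis by (simp del: power_Suc)
qed

lemma max_head_not_lex_less:
  assumes "digits m \<alpha>" "\<alpha> 0 = m" shows "\<not> lex_less \<alpha> (shift 1 \<alpha>)"
proof
  assume "lex_less \<alpha> (shift 1 \<alpha>)"
  then obtain n where n: "\<forall>i<n. \<alpha> i = \<alpha> (Suc i)" "\<alpha> n < \<alpha> (Suc n)" by (auto simp: lex_less_def)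
  have "\<alpha> i = m" if "i \<le> n" for i using that n(1) assms(2) by (induction i) auto
  then show False using n(2) digitsD[OF assms(1), of "Suc n"] by auto
qed

text \<open>A digit m puts no upper bound on the value of the tail behind it, so such digits must be
  passed by order alone: \<alpha> starts with m as well, and removing this m does not increase
  \<alpha>.\<close>

lemma not_lex_less_shift_one:
  assumes "digits m \<alpha>" "\<not> lex_less \<alpha> s" "s 0 = m"
  shows "\<not> lex_less \<alpha> (shift 1 s)"
proof
  assume l: "lex_less \<alpha> (shift 1 s)"
  have a0: "\<alpha> 0 = m" using assms lex_lessI[of 0 \<alpha> s] digitsD[OF assms(1), of 0] by fastforce
  then have "\<not> lex_less (shift 1 \<alpha>) (shift 1 s)"
    using assms lex_less_shift[of 1 \<alpha> s] by auto
  then have "lex_less \<alpha> (shift 1 \<alpha>)" using l lex_linear[of "shift 1 \<alpha>" "shift 1 s"] lex_trans by metis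
  then show False using max_head_not_lex_less[OF assms(1) a0] by simp
qed

text \<open>A sequence lexicographically above \<alpha> has value above 1 by
  \<open>lex_imp_val_less\<close>, whose strictness rests on double infiniteness. Tails behind a
  digit below m, and reflected tails behind a positive digit, have value at most 1; the remaining
  digits are passed by \<open>not_lex_less_shift_one\<close>.\<close>

lemma weakly_univoque_imp_admissible:
  assumes q: "1 < q" and w: "weakly_univoque m q \<alpha>" and di: "doubly_infinite m \<alpha>"
    and v: "val q \<alpha> = 1"
  shows "admissible m \<alpha>"
proof -
  have d: "digits m \<alpha>" using w by (simp add: weakly_univoque_def)
  have up: "\<alpha> n < m \<Longrightarrow> val q (shift (Suc n) \<alpha>) \<le> 1"
    and low: "0 < \<alpha> n \<Longrightarrow> val q (reflection m (shift (Suc n) \<alpha>)) \<le> 1" for n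
    using w by (auto simp: weakly_univoque_def)
  have big: "1 < val q s" if "lex_less \<alpha> s" "digits m s" "infinite_seq s" for s
    using lex_imp_val_less[OF q d that(2) up that(3,1)] v by simp
  have inf: "infinite_seq (shift n \<alpha>)" "infinite_seq (reflection m (shift n \<alpha>))" for n
    using di by (auto simp: doubly_infinite_def infinite_seq_shift_iff simp flip: shift_reflection)
  have 1: "\<not> lex_less \<alpha> (shift n \<alpha>)" for n
  proof (induction n)
    case 0
    then show ?case by (simp add: lex_irrefl)
  next
    case (Suc n)
    show ?case
    proof (cases "\<alpha> n < m")
      case True
      then show ?thesis using up[OF True] big[OF _ _ inf(1), of "Suc n"] d by force
    next
      case False
      then have "shift n \<alpha> 0 = m" using digitsD[OF d, of n] by simp
      then show ?thesis using not_lex_less_shift_one[OF d Suc] by (simp del: shift_apply)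
    qed
  qed
  have 2: "\<not> lex_less \<alpha> (reflection m (shift n \<alpha>))" for n
  proof (induction n)
    case 0
    \<comment> \<open>No digit precedes here. If \<alpha> were below its reflection, its first digit
      would be positive and below m, so the two bounds behind it would give m / (q - 1) \<le> 2,
      while the reflection, above \<alpha>, would have value m / (q - 1) - 1 > 1.\<close>
    show ?case
    proof
      assume l: "lex_less \<alpha> (reflection m (shift 0 \<alpha>))"
      then have le: "\<alpha> 0 \<le> m - \<alpha> 0" by (auto simp: lex_less_def) (metis not_gr0 order.refl less_imp_le)
      have "m \<noteq> 0"
      proof
        assume "m = 0"
        then have "\<alpha> = (\<lambda>_. 0)" using d by (auto simp: digits_def)
        then show False using v by simp
      qed
      have "0 < \<alpha> 0"
      proof (rule ccontr)
        assume "\<not> 0 < \<alpha> 0"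
        then have "val q (shift 1 \<alpha>) \<le> 1" using up[of 0] \<open>m \<noteq> 0\<close> by simp
        then show False using val_step_0[OF q d] v \<open>\<not> 0 < \<alpha> 0\<close> q by simp
      qed
      moreover have "\<alpha> 0 < m" using le \<open>m \<noteq> 0\<close> by linarith
      ultimately have "real m / (q - 1) \<le> 2"
        using up[of 0] low[of 0] val_reflection[OF q digits_shift[OF d, of 1]] by simp
      moreover have "1 < val q (reflection m \<alpha>)" using big[of "reflection m \<alpha>"] l inf(2)[of 0] by simp
      ultimately show False using val_reflection[OF q d] v by simp
    qed
  next
    case (Suc n)
    show ?case
    proof (cases "0 < \<alpha> n")
      case True
      then show ?thesis using low[OF True] big[OF _ _ inf(2), of "Suc n"] by force
    next
      case False
      then have "reflection m (shift n \<alpha>) 0 = m" by simp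
      then show ?thesis using not_lex_less_shift_one[OF d Suc]
        by (simp add: shift_reflection del: shift_apply reflection_apply)
    qed
  qed
  then have "\<not> lex_less (shift n \<alpha>) (reflection m \<alpha>)" for n
    using lex_reflection_right[OF d digits_shift[OF d, of n]] by simp
  with 1 d show ?thesis by (simp add: admissible_def)
qed

lemma admissible_digits: "admissible m \<alpha> \<Longrightarrow> digits m \<alpha>"
  by (simp add: admissible_def)

lemma admissible_upper: "admissible m \<alpha> \<Longrightarrow> \<not> lex_less \<alpha> (shift n \<alpha>)"
  by (simp add: admissible_def)

lemma admissible_lower: "admissible m \<alpha> \<Longrightarrow> \<not> lex_less (shift n \<alpha>) (reflection m \<alpha>)"
  by (simp add: admissible_def)

text \<open>For a good prefix length, decreasing the last digit keeps every suffix of the prefix at or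
  above the reflection of \<open>\<alpha>\<close>, and following the prefix by its own reflection stays below \<open>\<alpha>\<close>.\<close>

definition good :: "nat \<Rightarrow> (nat \<Rightarrow> nat) \<Rightarrow> nat \<Rightarrow> bool" where
  "good m \<alpha> l \<longleftrightarrow> 0 < l \<and> (\<forall>i<l. lex_within (l - i) (reflection m \<alpha>) (shift i \<alpha>))"

lemma good_last_pos:
  assumes "good m \<alpha> l" shows "0 < \<alpha> (l - 1)"
proof -
  have "lex_within 1 (reflection m \<alpha>) (shift (l - 1) \<alpha>)"
    using assms by (auto simp: good_def dest: spec[of _ "l - 1"])
  then show ?thesis by (auto simp: lex_within_def)
qed

lemma goodE:
  assumes "good m \<alpha> l" "i < l"
  obtains n where "i + n < l" "\<And>x. x < n \<Longrightarrow> \<alpha> (i + x) = m - \<alpha> x" "m - \<alpha> n < \<alpha> (i + n)"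
proof -
  have "lex_within (l - i) (reflection m \<alpha>) (shift i \<alpha>)" using assms by (simp add: good_def)
  then obtain n where "n < l - i" "\<forall>x<n. m - \<alpha> x = \<alpha> (i + x)" "m - \<alpha> n < \<alpha> (i + n)"
    by (auto simp: lex_within_def)
  then show ?thesis using that[of n] by auto
qed

lemma good_swapE:
  assumes "good m \<alpha> l" "digits m \<alpha>" "i < l"
  obtains n where "i + n < l" "\<And>x. x < n \<Longrightarrow> m - \<alpha> (i + x) = \<alpha> x" "m - \<alpha> (i + n) < \<alpha> n"
proof -
  obtain n where n: "i + n < l" "\<And>x. x < n \<Longrightarrow> \<alpha> (i + x) = m - \<alpha> x" "m - \<alpha> n < \<alpha> (i + n)"
    using goodE[OF assms(1,3)] by blast
  have "m - \<alpha> (i + x) = \<alpha> x" if "x < n" for x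
    using n(2)[OF that] digitsD[OF assms(2), of x] by simp
  moreover have "m - \<alpha> (i + n) < \<alpha> n" using n(3) digitsD[OF assms(2), of n] digitsD[OF assms(2), of "i + n"] by linarith
  ultimately show ?thesis using that n(1) by blast
qed

section \<open>Words built from good prefixes\<close>

lemma decremented_block_shift:
  assumes adm: "admissible m \<alpha>" and g: "good m \<alpha> l"
    and s: "\<And>i. i < l - 1 \<Longrightarrow> s i = \<alpha> i" "s (l - 1) = \<alpha> (l - 1) - 1"
      "\<And>i. i < l - 1 \<Longrightarrow> s (l + i) = \<alpha> i"
    and ne: "\<exists>i<l. s i \<noteq> m - \<alpha> i" and j: "j < l"
  shows "lex_within l (reflection m \<alpha>) (shift j s)" "lex_within l (shift j s) \<alpha>"
proof -
  note d = admissible_digits[OF adm]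
  have last: "0 < \<alpha> (l - 1)" by (rule good_last_pos[OF g])
  have sj: "s (j + i) = \<alpha> (j + i)" if "j + i < l - 1" for i using s(1) that by simp
  show "lex_within l (reflection m \<alpha>) (shift j s)"
  proof -
    \<comment> \<open>Goodness provides a strict place inside the block. Lowering the last digit can
      at worst turn it into a tie; then the comparison runs on into the next block, where goodness
      at l - j decides. For j = 0 the tie would fill the block, which \<open>ne\<close>
      excludes.\<close>
    obtain n where n: "j + n < l" "\<And>x. x < n \<Longrightarrow> \<alpha> (j + x) = m - \<alpha> x" "m - \<alpha> n < \<alpha> (j + n)"
      using goodE[OF g j] by blast
    have eq: "m - \<alpha> i = s (j + i)" if "i < n" for i using n(1) n(2)[OF that] sj[of i] that by simp
    show ?thesis
    proof (cases "m - \<alpha> n < s (j + n)")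
      case True
      then show ?thesis using n(1) eq by (intro lex_withinI[of n]) auto
    next
      case False
      then have jn: "j + n = l - 1" using n sj[of n] by force
      then have eq': "m - \<alpha> n = s (j + n)" using False n(3) s(2) last unfolding jn by linarith
      have eq'': "m - \<alpha> i = s (j + i)" if "i \<le> n" for i
        using that eq[of i] eq' by (cases "i = n") auto
      have j0: "0 < j"
      proof (rule ccontr)
        assume "\<not> 0 < j"
        then have "\<forall>i<l. s i = m - \<alpha> i" using jn eq'' by (metis Suc_pred' add_0 gr_zeroI j less_Suc_eq_le)
        with ne show False by blast
      qed
      obtain k where k: "l - j + k < l" "\<And>x. x < k \<Longrightarrow> m - \<alpha> (l - j + x) = \<alpha> x"
        "m - \<alpha> (l - j + k) < \<alpha> k"
        using good_swapE[OF g d, of "l - j"] j j0 by auto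
      have n1: "l - j = Suc n" using jn j by simp
      show ?thesis
      proof (rule lex_withinI[of "l - j + k"])
        show "l - j + k < l" by (rule k(1))
        show "reflection m \<alpha> i = shift j s i" if "i < l - j + k" for i
        proof (cases "i < l - j")
          case True
          then show ?thesis using eq''[of i] n1 by simp
        next
          case False
          then have "i - (l - j) < k" "i - (l - j) < l - 1" using that k(1) j by auto
          moreover have "l - j + (i - (l - j)) = i" "j + i = l + (i - (l - j))" using False j by auto
          ultimately show ?thesis using k(2)[of "i - (l - j)"] s(3)[of "i - (l - j)"] by simp
        qed
        have "k < l - 1" using k(1) j j0 by linarith
        moreover have "j + (l - j + k) = l + k" using j by simp
        ultimately show "reflection m \<alpha> (l - j + k) < shift j s (l - j + k)"
          using k(3) s(3)[of k] by simp
      qed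
    qed
  qed
  show "lex_within l (shift j s) \<alpha>"
  proof -
    from not_lex_less_cases[OF admissible_upper[OF adm, of j], of "l - j"]
    show ?thesis
    proof
      assume "lex_within (l - j) (shift j \<alpha>) \<alpha>"
      then obtain n where n: "n < l - j" "\<forall>i<n. \<alpha> (j + i) = \<alpha> i" "\<alpha> (j + n) < \<alpha> n"
        by (auto simp: lex_within_def)
      have "s (j + n) \<le> \<alpha> (j + n)"
      proof (cases "j + n < l - 1")
        case False
        then have "j + n = l - 1" using n(1) by simp
        then show ?thesis using s(2) by simp
      qed (use sj in simp)
      then show ?thesis using n sj by (intro lex_withinI[of n]) auto
    next
      \<comment> \<open>When the shift of \<alpha> agrees with \<alpha> up to the end of the block,
        the lowered last digit supplies the strict inequality.\<close>
      assume eq: "\<forall>i<l - j. shift j \<alpha> i = \<alpha> i"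
      have "j + (l - 1 - j) = l - 1" "l - 1 - j < l - j" using j by auto
      then have "\<alpha> (l - 1 - j) = \<alpha> (l - 1)" using eq by (metis shift_apply)
      then show ?thesis using eq sj s(2) last j by (intro lex_withinI[of "l - 1 - j"]) auto
    qed
  qed
qed

text \<open>The lower bound is goodness itself. For the upper bound, if the suffix from j agrees
  with the start of \<alpha>, the comparison continues between the reflected prefix and \<alpha>
  from l - j on, where goodness at l - j decides.\<close>

lemma reflected_block_shift:
  assumes adm: "admissible m \<alpha>" and g: "good m \<alpha> l"
    and s: "\<And>i. i < l \<Longrightarrow> s i = \<alpha> i" "\<And>i. i < l - 1 \<Longrightarrow> s (l + i) = m - \<alpha> i"
    and j: "0 < j" "j < l"
  shows "lex_within l (reflection m \<alpha>) (shift j s)" "lex_within l (shift j s) \<alpha>"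
proof -
  note d = admissible_digits[OF adm]
  have sj: "s (j + i) = \<alpha> (j + i)" if "j + i < l" for i using s(1) that by simp
  obtain n where n: "j + n < l" "\<And>x. x < n \<Longrightarrow> \<alpha> (j + x) = m - \<alpha> x" "m - \<alpha> n < \<alpha> (j + n)"
    using goodE[OF g j(2)] by blast
  then show "lex_within l (reflection m \<alpha>) (shift j s)" using sj by (intro lex_withinI[of n]) auto
  from not_lex_less_cases[OF admissible_upper[OF adm, of j], of "l - j"]
  show "lex_within l (shift j s) \<alpha>"
  proof
    assume "lex_within (l - j) (shift j \<alpha>) \<alpha>"
    then obtain n where "n < l - j" "\<forall>i<n. \<alpha> (j + i) = \<alpha> i" "\<alpha> (j + n) < \<alpha> n"
      by (auto simp: lex_within_def)
    then show ?thesis using sj by (intro lex_withinI[of n]) auto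
  next
    assume eq: "\<forall>i<l - j. shift j \<alpha> i = \<alpha> i"
    obtain k where k: "l - j + k < l" "\<And>x. x < k \<Longrightarrow> m - \<alpha> x = \<alpha> (l - j + x)"
      "m - \<alpha> k < \<alpha> (l - j + k)"
      using goodE[OF g, of "l - j"] j by (metis diff_less order.strict_trans)
    show ?thesis
    proof (rule lex_withinI[of "l - j + k"])
      show "shift j s i = \<alpha> i" if "i < l - j + k" for i
      proof (cases "i < l - j")
        case True
        then show ?thesis using eq sj[of i] by simp
      next
        case False
        then have "i - (l - j) < k" "i - (l - j) < l - 1" using that k(1) j by auto
        moreover have "l - j + (i - (l - j)) = i" "j + i = l + (i - (l - j))" using False j by auto
        ultimately show ?thesis using k(2)[of "i - (l - j)"] s(2)[of "i - (l - j)"] by simp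
      qed
      have "k < l - 1" using k(1) j by linarith
      moreover have "j + (l - j + k) = l + k" using j by simp
      ultimately show "shift j s (l - j + k) < \<alpha> (l - j + k)" using k(3) s(2)[of k] by simp
    qed (use k in simp)
  qed
qed

text \<open>If no shift of \<open>\<alpha>\<close> equals its reflection, take the leftmost shift agreeing with the reflection
  beyond position \<open>L\<close>: the place where it first differs ends a good prefix.\<close>

lemma good_unbounded:
  assumes adm: "admissible m \<alpha>" and lex: "\<And>i. lex_less (reflection m \<alpha>) (shift i \<alpha>)"
  shows "\<exists>l>L. good m \<alpha> l"
proof (cases "good m \<alpha> (Suc L)")
  case True
  then show ?thesis by blast
next
  case False
  define bad where "bad i \<longleftrightarrow> i < Suc L \<and> \<not> lex_within (Suc L - i) (reflection m \<alpha>) (shift i \<alpha>)" for i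
  have "\<exists>i. bad i" using False by (auto simp: good_def bad_def)
  define i where "i = (LEAST i. bad i)"
  have bi: "bad i" unfolding i_def using \<open>\<exists>i. bad i\<close> by (rule LeastI_ex)
  obtain n where n: "\<And>x. x < n \<Longrightarrow> m - \<alpha> x = \<alpha> (i + x)" "m - \<alpha> n < \<alpha> (i + n)"
    using lex[of i] by (auto simp: lex_less_def)
  have big: "Suc L \<le> i + n"
  proof (rule ccontr)
    assume "\<not> Suc L \<le> i + n"
    then have "lex_within (Suc L - i) (reflection m \<alpha>) (shift i \<alpha>)"
      using n by (intro lex_withinI[of n]) auto
    with bi show False by (simp add: bad_def)
  qed
  note d = admissible_digits[OF adm]
  have "good m \<alpha> (Suc (i + n))"
    unfolding good_def
  proof (intro conjI allI impI)
    fix j assume j: "j < Suc (i + n)"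
    consider "j < i" | "j = i" | "i < j" by linarith
    then show "lex_within (Suc (i + n) - j) (reflection m \<alpha>) (shift j \<alpha>)"
    proof cases
      case 1
      then have "\<not> bad j" using not_less_Least i_def by blast
      then have "lex_within (Suc L - j) (reflection m \<alpha>) (shift j \<alpha>)"
        using 1 bi by (auto simp: bad_def)
      then show ?thesis by (rule lex_within_mono) (use big in simp)
    next
      case 2
      then show ?thesis using n by (intro lex_withinI[of n]) auto
    next
      case 3
      \<comment> \<open>Position j lies where \<open>shift i \<alpha>\<close> copies the reflection,
        so the comparison at j is the reflected comparison of \<open>shift \<delta> \<alpha>\<close>
        with \<alpha>. Admissibility settles it, and digit n breaks a tie.\<close>
      define \<delta> where "\<delta> = j - i"
      have j\<delta>: "j = i + \<delta>" and r: "\<delta> \<le> n" using 3 j by (auto simp: \<delta>_def)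
      have eq: "\<alpha> (j + x) = m - \<alpha> (\<delta> + x)" if "\<delta> + x < n" for x
        using n(1)[of "\<delta> + x"] that by (simp add: j\<delta> add.assoc)
      from not_lex_less_cases[OF admissible_upper[OF adm, of \<delta>], of "n - \<delta>"]
      show ?thesis
      proof
        assume "lex_within (n - \<delta>) (shift \<delta> \<alpha>) \<alpha>"
        then obtain y where y: "y < n - \<delta>" "\<forall>i<y. \<alpha> (\<delta> + i) = \<alpha> i" "\<alpha> (\<delta> + y) < \<alpha> y"
          by (auto simp: lex_within_def)
        show ?thesis
        proof (rule lex_withinI[of y])
          show "y < Suc (i + n) - j" using y(1) by (simp add: j\<delta>)
          show "reflection m \<alpha> x = shift j \<alpha> x" if "x < y" for x using y(1,2) that eq[of x] by simp
          show "reflection m \<alpha> y < shift j \<alpha> y"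
            using y(1,3) eq[of y] digitsD[OF d, of y] by simp
        qed
      next
        assume e: "\<forall>i<n - \<delta>. shift \<delta> \<alpha> i = \<alpha> i"
        have "\<alpha> n \<le> \<alpha> (n - \<delta>)"
        proof (rule ccontr)
          assume "\<not> \<alpha> n \<le> \<alpha> (n - \<delta>)"
          then have "lex_less \<alpha> (shift \<delta> \<alpha>)" using e r by (intro lex_lessI[of "n - \<delta>"]) auto
          then show False using admissible_upper[OF adm] by simp
        qed
        then have "m - \<alpha> (n - \<delta>) < \<alpha> (j + (n - \<delta>))" using n(2) r by (simp add: j\<delta>)
        then show ?thesis using e eq r by (intro lex_withinI[of "n - \<delta>"]) (auto simp: j\<delta>)
      qed
    qed
  qed simp
  then show ?thesis using big by (intro exI[of _ "Suc (i + n)"]) simp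
qed

section \<open>Approximation by univoque bases\<close>

definition trunc_cycle :: "nat \<Rightarrow> (nat \<Rightarrow> nat) \<Rightarrow> nat \<Rightarrow> nat" where
  "trunc_cycle l \<alpha> = (\<lambda>i. if i mod l = l - 1 then \<alpha> (l - 1) - 1 else \<alpha> (i mod l))"

lemma digits_trunc_cycle [simp]: "digits m \<alpha> \<Longrightarrow> digits m (trunc_cycle l \<alpha>)"
  by (auto simp: digits_def trunc_cycle_def intro: le_trans[OF diff_le_self])

lemma trunc_cycle_less: "i < l - 1 \<Longrightarrow> trunc_cycle l \<alpha> i = \<alpha> i"
  by (simp add: trunc_cycle_def)

lemma trunc_cycle_last: "0 < l \<Longrightarrow> trunc_cycle l \<alpha> (l - 1) = \<alpha> (l - 1) - 1"
  by (simp add: trunc_cycle_def)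

lemma trunc_cycle_add_mult: "trunc_cycle l \<alpha> (k * l + i) = trunc_cycle l \<alpha> i"
  by (simp add: trunc_cycle_def)

lemma trunc_cycle_add: "trunc_cycle l \<alpha> (l + i) = trunc_cycle l \<alpha> i"
  by (simp add: trunc_cycle_def)

lemma shift_trunc_cycle_mult: "shift (k * l) (trunc_cycle l \<alpha>) = trunc_cycle l \<alpha>"
  by (rule ext) (simp add: trunc_cycle_add_mult)

text \<open>Equality would make twice the last digit of the prefix m + 1 and twice the first one m,
  although no digit of \<alpha> exceeds the first. For l = 1 both positions coincide, and there
  equality can occur.\<close>

lemma trunc_cycle_neq_reflection:
  assumes adm: "admissible m \<alpha>" and g: "good m \<alpha> l" and l: "2 \<le> l"
  shows "\<exists>i<l. trunc_cycle l \<alpha> i \<noteq> m - \<alpha> i"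
proof (rule ccontr)
  assume "\<not> ?thesis"
  then have eq: "trunc_cycle l \<alpha> i = m - \<alpha> i" if "i < l" for i using that by blast
  note d = admissible_digits[OF adm]
  have "\<alpha> 0 = m - \<alpha> 0" using eq[of 0] trunc_cycle_less[of 0 l \<alpha>] l by simp
  moreover have "\<alpha> (l - 1) - 1 = m - \<alpha> (l - 1)"
    using eq[of "l - 1"] trunc_cycle_last[of l \<alpha>] l by simp
  moreover have "\<alpha> (l - 1) \<le> \<alpha> 0"
    using admissible_upper[OF adm, of "l - 1"] lex_lessI[of 0 \<alpha> "shift (l - 1) \<alpha>"] by force
  ultimately show False
    using good_last_pos[OF g] digitsD[OF d, of 0] digitsD[OF d, of "l - 1"] by linarith
qed

lemma trunc_cycle_shift:
  assumes adm: "admissible m \<alpha>" and g: "good m \<alpha> l"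
    and ne: "\<exists>i<l. trunc_cycle l \<alpha> i \<noteq> m - \<alpha> i"
  shows "lex_within l (reflection m \<alpha>) (shift j (trunc_cycle l \<alpha>))"
    "lex_within l (shift j (trunc_cycle l \<alpha>)) \<alpha>"
proof -
  have l: "0 < l" using g by (simp add: good_def)
  have "shift j (trunc_cycle l \<alpha>) = shift (j mod l) (shift (j div l * l) (trunc_cycle l \<alpha>))"
    by (simp add: add.commute del: shift_apply)
  then have eq: "shift j (trunc_cycle l \<alpha>) = shift (j mod l) (trunc_cycle l \<alpha>)"
    by (simp only: shift_trunc_cycle_mult)
  note * = decremented_block_shift[OF adm g, of "trunc_cycle l \<alpha>", OF trunc_cycle_less
      trunc_cycle_last[OF l] _ ne, of "j mod l"]
  show "lex_within l (reflection m \<alpha>) (shift j (trunc_cycle l \<alpha>))"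
    unfolding eq by (rule *(1)) (use l in \<open>auto simp: trunc_cycle_add trunc_cycle_less\<close>)
  show "lex_within l (shift j (trunc_cycle l \<alpha>)) \<alpha>"
    unfolding eq by (rule *(2)) (use l in \<open>auto simp: trunc_cycle_add trunc_cycle_less\<close>)
qed

lemma reflection_trunc_cycle_shift:
  assumes adm: "admissible m \<alpha>" and g: "good m \<alpha> l"
    and ne: "\<exists>i<l. trunc_cycle l \<alpha> i \<noteq> m - \<alpha> i"
  shows "lex_less (reflection m \<alpha>) (shift j (reflection m (trunc_cycle l \<alpha>)))"
    "lex_less (shift j (reflection m (trunc_cycle l \<alpha>))) \<alpha>"
proof -
  note d = admissible_digits[OF adm]
  have dt: "digits m (shift j (trunc_cycle l \<alpha>))" using d by (intro digits_shift digits_trunc_cycle)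
  show "lex_less (reflection m \<alpha>) (shift j (reflection m (trunc_cycle l \<alpha>)))"
    "lex_less (shift j (reflection m (trunc_cycle l \<alpha>))) \<alpha>"
    unfolding shift_reflection
    using trunc_cycle_shift[OF adm g ne, of j, THEN lex_within_imp_less]
      lex_reflection_left[OF dt d] lex_reflection[OF d dt] by blast+
qed

lemma glue_reflection_shift:
  assumes adm: "admissible m \<alpha>" and g: "good m \<alpha> l"
    and t: "\<And>i. i < l - 1 \<Longrightarrow> t i = \<alpha> i" and j: "0 < j" "j < l"
  shows "lex_within l (reflection m \<alpha>) (shift j (glue l \<alpha> (reflection m t)))"
    "lex_within l (shift j (glue l \<alpha> (reflection m t))) \<alpha>"
  by (rule reflected_block_shift[OF adm g _ _ j]; simp add: glue_def t)+

definition cyclic_approx :: "nat \<Rightarrow> (nat \<Rightarrow> nat) \<Rightarrow> nat \<Rightarrow> nat \<Rightarrow> nat" where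
  "cyclic_approx m \<alpha> l = glue l \<alpha> (reflection m (trunc_cycle l \<alpha>))"

lemma digits_cyclic_approx [simp]: "digits m \<alpha> \<Longrightarrow> digits m (cyclic_approx m \<alpha> l)"
  by (simp add: cyclic_approx_def)

lemma cyclic_approx_less: "i < l \<Longrightarrow> cyclic_approx m \<alpha> l i = \<alpha> i"
  by (simp add: cyclic_approx_def glue_def)

lemma cyclic_approx_shift:
  assumes adm: "admissible m \<alpha>" and g: "good m \<alpha> l"
    and ne: "\<exists>i<l. trunc_cycle l \<alpha> i \<noteq> m - \<alpha> i" and j: "0 < j"
  shows "lex_within l (reflection m \<alpha>) (shift j (cyclic_approx m \<alpha> l)) \<and>
    lex_within l (shift j (cyclic_approx m \<alpha> l)) \<alpha>"
proof (cases "j < l")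
  case True
  then show ?thesis
    using glue_reflection_shift[OF adm g, of "trunc_cycle l \<alpha>" j] trunc_cycle_less[of _ l \<alpha>] j
    by (auto simp: cyclic_approx_def simp del: shift_apply)
next
  case False
  define t where "t = shift (j - l) (trunc_cycle l \<alpha>)"
  note d = admissible_digits[OF adm]
  have dt: "digits m t" using d unfolding t_def by (intro digits_shift digits_trunc_cycle)
  have eq: "shift j (cyclic_approx m \<alpha> l) = reflection m t"
    using False by (simp add: cyclic_approx_def shift_glue_ge shift_reflection t_def
        del: shift_apply reflection_apply)
  have "lex_within l (reflection m \<alpha>) t" "lex_within l t \<alpha>"
    using trunc_cycle_shift[OF adm g ne, of "j - l"] by (auto simp: t_def simp del: shift_apply)
  then show ?thesis
    unfolding eq using lex_within_reflection[OF d dt, of l]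
      lex_within_reflection[OF dt digits_reflection[of m \<alpha>], of l]
    by (simp only: reflection_reflection[OF d])
qed

lemma infinite_seqI: "(\<And>n. \<exists>i. shift n c i \<noteq> 0) \<Longrightarrow> infinite_seq c"
proof -
  assume *: "\<And>n. \<exists>i. shift n c i \<noteq> 0"
  show "infinite_seq c"
    unfolding infinite_seq_def infinite_nat_iff_unbounded_le
  proof
    fix n
    obtain i where "shift n c i \<noteq> 0" using *[of n] by blast
    then show "\<exists>k\<ge>n. k \<in> {i. c i \<noteq> 0}" by (intro exI[of _ "n + i"]) auto
  qed
qed

lemma lex_less_nonzero: "lex_less s t \<Longrightarrow> \<exists>i. t i \<noteq> 0"
  by (metis lex_less_def not_less_zero)

lemma infinite_seqI_lex:
  assumes "\<And>i. 0 < i \<Longrightarrow> lex_less (s i) (shift i \<alpha>)"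
  shows "infinite_seq \<alpha>"
  using infinite_seqI[of "shift 1 \<alpha>"] lex_less_nonzero[OF assms] infinite_seq_shift_iff[of 1 \<alpha>]
  by (metis add_gr_0 shift_shift zero_less_one)

lemma cyclic_approx_univoque:
  assumes adm: "admissible m \<alpha>" and g: "good m \<alpha> l"
    and ne: "\<exists>i<l. trunc_cycle l \<alpha> i \<noteq> m - \<alpha> i"
    and p: "1 < p" "val p (cyclic_approx m \<alpha> l) = 1"
  shows "univoque m p (cyclic_approx m \<alpha> l)"
proof (rule univoqueI[OF p(1)])
  let ?\<gamma> = "cyclic_approx m \<alpha> l"
  have dg: "digits m ?\<gamma>" using admissible_digits[OF adm] by simp
  then show "digits m ?\<gamma>" "digits m ?\<gamma>" by auto
  show "val p ?\<gamma> \<le> 1" using p by simp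
  have *: "lex_less (reflection m ?\<gamma>) (shift j ?\<gamma>)" "lex_less (shift j ?\<gamma>) ?\<gamma>" if "0 < j" for j
  proof -
    have "lex_within l (reflection m ?\<gamma>) (shift j ?\<gamma>)"
      using cyclic_approx_shift[OF adm g ne that]
        lex_within_cong[of l "reflection m ?\<gamma>" "reflection m \<alpha>" "shift j ?\<gamma>" "shift j ?\<gamma>"]
      by (simp add: cyclic_approx_less)
    moreover have "lex_within l (shift j ?\<gamma>) ?\<gamma>"
      using cyclic_approx_shift[OF adm g ne that]
        lex_within_cong[of l "shift j ?\<gamma>" "shift j ?\<gamma>" ?\<gamma> \<alpha>]
      by (simp add: cyclic_approx_less)
    ultimately show "lex_less (reflection m ?\<gamma>) (shift j ?\<gamma>)" "lex_less (shift j ?\<gamma>) ?\<gamma>"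
      by (auto dest: lex_within_imp_less)
  qed
  then show "\<not> lex_less ?\<gamma> (shift n ?\<gamma>) \<and> \<not> lex_less (shift n ?\<gamma>) (reflection m ?\<gamma>)"
    if "0 < n" for n
    using lex_asym that by blast
  show "val p ?\<gamma> < 1 \<or> infinite_seq ?\<gamma> \<and>
      (\<forall>n>0. lex_less (shift n ?\<gamma>) ?\<gamma> \<and> lex_less (reflection m ?\<gamma>) (shift n ?\<gamma>))"
    using * infinite_seqI_lex[of "\<lambda>_. reflection m ?\<gamma>" ?\<gamma>] by blast
qed

text \<open>If \<alpha> is b followed by the reflected cycle of length l, goodness of l' at the last
  multiple of l below l' can only be witnessed by the last digit of a block, so l is a divisor of
  l'. The two approximants then disagree by one at the last digit of the block starting at l', since
  only the shorter cycle has lowered that digit.\<close>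

lemma cyclic_approx_eq_once:
  assumes d: "digits m \<alpha>" and g: "good m \<alpha> l" "good m \<alpha> l'" and l: "l < l'"
    and eq: "cyclic_approx m \<alpha> l = \<alpha>" "cyclic_approx m \<alpha> l' = \<alpha>"
  shows False
proof -
  let ?\<theta> = "trunc_cycle l \<alpha>"
  have l0: "0 < l" using g by (simp add: good_def)
  have tail: "\<alpha> (l + i) = m - ?\<theta> i" for i
    using eq(1) by (metis add_diff_cancel_left' cyclic_approx_def glue_def not_add_less1 reflection_apply)
  have tail': "\<alpha> (l' + i) = m - trunc_cycle l' \<alpha> i" for i
    using eq(2) by (metis add_diff_cancel_left' cyclic_approx_def glue_def not_add_less1 reflection_apply)
  have last: "0 < \<alpha> (l - 1)" by (rule good_last_pos[OF g(1)])
  define k where "k = (l' - 1) div l"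
  define i where "i = k * l"
  have "(l' - 1) mod l < l" using l0 by simp
  then have r: "i < l'" "l' \<le> i + l"
    using div_mult_mod_eq[of "l' - 1" l] l unfolding i_def k_def by linarith+
  have "1 \<le> k" using l l0 by (simp add: k_def div_greater_zero_iff Suc_le_eq)
  have tail_i: "\<alpha> (i + x) = m - ?\<theta> x" for x
  proof -
    have "i = l + (k - 1) * l" using \<open>1 \<le> k\<close> unfolding i_def by (cases k) auto
    then have "\<alpha> (i + x) = m - ?\<theta> ((k - 1) * l + x)" using tail[of "(k - 1) * l + x"] by (simp add: add.assoc)
    then show ?thesis by (simp add: trunc_cycle_add_mult)
  qed
  obtain n where n: "i + n < l'" "m - \<alpha> n < \<alpha> (i + n)" using goodE[OF g(2) r(1)] by blast
  have "n < l" using n(1) r by linarith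
  have "n = l - 1"
  proof (rule ccontr)
    assume "n \<noteq> l - 1"
    then have "?\<theta> n = \<alpha> n" using \<open>n < l\<close> by (intro trunc_cycle_less) auto
    then show False using tail_i[of n] n(2) by simp
  qed
  then have l': "l' = Suc k * l" using n(1) r l0 unfolding i_def by simp
  have "l - 1 < l' - 1" using l l0 by simp
  then have "\<alpha> (l' + (l - 1)) = m - \<alpha> (l - 1)" using tail'[of "l - 1"] trunc_cycle_less by metis
  moreover have "\<alpha> (l' + (l - 1)) = m - ?\<theta> (l - 1)"
    using tail[of "k * l + (l - 1)"] l' by (simp add: trunc_cycle_add_mult add.assoc)
  ultimately show False
    using last trunc_cycle_last[OF l0, of \<alpha>] digitsD[OF d, of "l - 1"] by simp
qed

lemma val_perturb:
  assumes "1 < q" "digits m \<alpha>" "val q \<alpha> = 1" "0 < \<delta>" "1 < q - \<delta>"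
  shows "1 < val (q - \<delta>) \<alpha>" "val (q + \<delta>) \<alpha> < 1"
  using val_strict_antimono[of "q - \<delta>" q m \<alpha>] val_strict_antimono[of q "q + \<delta>" m \<alpha>]
    assms by force+

lemma val_one_imp_le: 
  assumes "1 < p" "digits m c" "val p c = 1" shows "p \<le> real m + 1"
  using val_le[OF assms(1,2)] assms by (simp add: field_simps)

lemma U_iff:
  "q \<in> \<U> m \<longleftrightarrow> 1 < q \<and> q \<le> real m + 1 \<and> (\<exists>c. univoque m q c \<and> val q c = 1)"
  using Uq_iff[of q m 1] by (auto simp: \<U>_def base_interval_def)

lemma islimpt_U:
  assumes q: "1 < q" and adm: "admissible m \<alpha>" and v: "val q \<alpha> = 1"
    and lex: "\<And>i. lex_less (reflection m \<alpha>) (shift i \<alpha>)"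
  shows "q islimpt \<U> m"
  unfolding islimpt_approachable
proof (intro allI impI)
  fix e :: real assume e: "0 < e"
  note d = admissible_digits[OF adm]
  define \<delta> where "\<delta> = min (e / 2) ((q - 1) / 2)"
  have \<delta>: "0 < \<delta>" "\<delta> < e" "1 < q - \<delta>" using e q by (auto simp: \<delta>_def min_def field_simps)
  have lim: "(\<lambda>l. val p (cyclic_approx m \<alpha> l)) \<longlonglongrightarrow> val p \<alpha>" if "1 < p" for p
  proof (rule tendsto_val[where m = m])
    show "\<forall>\<^sub>F l in sequentially. cyclic_approx m \<alpha> l i = \<alpha> i" for i
      using eventually_gt_at_top[of i] by eventually_elim (rule cyclic_approx_less)
  qed (use that d in auto)
  have "\<forall>\<^sub>F l in sequentially. 1 < val (q - \<delta>) (cyclic_approx m \<alpha> l)"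
    using \<delta> q val_perturb[OF q d v \<delta>(1,3)] by (intro order_tendstoD(1)[OF lim]) auto
  moreover have "\<forall>\<^sub>F l in sequentially. val (q + \<delta>) (cyclic_approx m \<alpha> l) < 1"
    using \<delta> q val_perturb[OF q d v \<delta>(1,3)] by (intro order_tendstoD(2)[OF lim]) auto
  ultimately have "\<forall>\<^sub>F l in sequentially. 1 < val (q - \<delta>) (cyclic_approx m \<alpha> l) \<and>
      val (q + \<delta>) (cyclic_approx m \<alpha> l) < 1"
    by (rule eventually_conj)
  then obtain L where L: "\<And>l. L \<le> l \<Longrightarrow> 1 < val (q - \<delta>) (cyclic_approx m \<alpha> l) \<and>
      val (q + \<delta>) (cyclic_approx m \<alpha> l) < 1"
    unfolding eventually_sequentially by blast
  \<comment> \<open>Of two good lengths at least one gives an approximant different from \<alpha>,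
    hence a base different from q.\<close>
  obtain l1 where l1: "l1 > L + 2" "good m \<alpha> l1" using good_unbounded[OF adm lex] by blast
  obtain l2 where l2: "l2 > l1" "good m \<alpha> l2" using good_unbounded[OF adm lex] by blast
  obtain l where l: "l > L + 2" "good m \<alpha> l" "cyclic_approx m \<alpha> l \<noteq> \<alpha>"
    using cyclic_approx_eq_once[OF d l1(2) l2(2,1)] l1 l2 by (metis order.strict_trans)
  let ?\<gamma> = "cyclic_approx m \<alpha> l"
  have dg: "digits m ?\<gamma>" using d by simp
  have "\<exists>p\<ge>q - \<delta>. p \<le> q + \<delta> \<and> val p ?\<gamma> = 1"
  proof (rule IVT2')
    show "continuous_on {q - \<delta>..q + \<delta>} (\<lambda>p. val p ?\<gamma>)"
      using \<delta> by (intro continuous_on_val[OF dg]) auto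
  qed (use L[of l] l \<delta> in \<open>auto intro: less_imp_le\<close>)
  then obtain p where p: "q - \<delta> \<le> p" "p \<le> q + \<delta>" "val p ?\<gamma> = 1" by blast
  have p1: "1 < p" using p \<delta> by simp
  have ne: "\<exists>i<l. trunc_cycle l \<alpha> i \<noteq> m - \<alpha> i"
    using l by (intro trunc_cycle_neq_reflection[OF adm l(2)]) auto
  note u = cyclic_approx_univoque[OF adm l(2) ne p1 p(3)]
  have "p \<in> \<U> m" using u p(3) p1 val_one_imp_le[OF p1 dg p(3)] by (auto simp: U_iff)
  moreover have "p \<noteq> q" using univoque_unique[of q m ?\<gamma> \<alpha>] u q d v p(3) l(3) by auto
  moreover have "dist p q < e" using p \<delta> by (simp add: dist_real_def)
  ultimately show "\<exists>x\<in>\<U> m. x \<noteq> q \<and> dist x q < e" by blast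
qed

section \<open>Antiperiodic expansions of one\<close>

text \<open>Writing b for the first n digits, \<alpha> alternates between b and its reflection. The
  assumption \<open>neq\<close> keeps b with lowered last digit apart from the reflection of b; by
  \<open>trunc_cycle_neq_reflection\<close> this is a restriction for n = 1 only.\<close>

locale antiperiodic =
  fixes m n :: nat and \<alpha> :: "nat \<Rightarrow> nat" and q :: real
  assumes q: "1 < q" and m: "1 \<le> m"
    and adm: "admissible m \<alpha>" and val_\<alpha>: "val q \<alpha> = 1"
    and good: "good m \<alpha> n" and anti: "\<And>i. \<alpha> (n + i) = m - \<alpha> i"
    and neq: "\<exists>i<n. trunc_cycle n \<alpha> i \<noteq> m - \<alpha> i"
begin

definition \<theta> :: "nat \<Rightarrow> nat" where "\<theta> = trunc_cycle n \<alpha>"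

definition \<eta> :: "nat \<Rightarrow> nat \<Rightarrow> nat" where "\<eta> M = glue (M * n) \<theta> \<alpha>"

definition cycle_value :: "real \<Rightarrow> real" where "cycle_value p = val p (reflection m \<theta>)"

text \<open>The reflection of \<open>\<eta> M\<close> falls short of its limiting value by
  \<open>gap p / p ^ (M * n)\<close>, which makes the defect explicit in N and M.\<close>

definition gap :: "real \<Rightarrow> real" where "gap p = cycle_value p - val p (reflection m \<alpha>)"

text \<open>This is 1 minus the value of the finite word consisting of b and the reflection of b
  with lowered last digit. In base q that word is a finite expansion of 1.\<close>

definition defect_limit :: "real \<Rightarrow> real" where "defect_limit p = 1 - head p n \<alpha> - head p n (reflection m \<theta>) / p ^ n"

definition upper_seq :: "nat \<Rightarrow> nat \<Rightarrow> nat" where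
  "upper_seq M = glue n \<alpha> (reflection m (\<eta> M))"

text \<open>The 2n zeros align the reflected cycle with that of \<open>upper_seq\<close> behind its
  first two blocks, so that the infinite cycles cancel and \<open>defect_limit\<close>
  remains.\<close>

definition lower_seq :: "nat \<Rightarrow> nat \<Rightarrow> nat" where
  "lower_seq N = glue (2 * n) (\<lambda>_. 0) (reflection m (\<eta> N))"

definition defect :: "nat \<Rightarrow> nat \<Rightarrow> real \<Rightarrow> real" where
  "defect N M p = 1 + val p (lower_seq N) - val p (upper_seq M)"

lemma n_pos: "0 < n" using good by (simp add: good_def)

lemma digits_\<alpha>: "digits m \<alpha>" by (rule admissible_digits[OF adm])

lemma digits_\<theta>: "digits m \<theta>" using digits_\<alpha> by (simp add: \<theta>_def)

lemma digits_\<eta>: "digits m (\<eta> M)" using digits_\<alpha> digits_\<theta> by (simp add: \<eta>_def)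

lemma digits_upper_seq: "digits m (upper_seq M)" using digits_\<alpha> digits_\<eta> by (simp add: upper_seq_def)

lemma digits_lower_seq: "digits m (lower_seq N)" using digits_\<eta> by (simp add: lower_seq_def)

lemma shift_anti: "shift n \<alpha> = reflection m \<alpha>"
  by (rule ext) (simp add: anti)

lemma infinite_\<alpha>: "infinite_seq \<alpha>"
proof (rule infinite_seqI)
  fix i
  have "\<alpha> i \<noteq> 0 \<or> \<alpha> (n + i) \<noteq> 0" using anti[of i] m by linarith
  then show "\<exists>j. shift i \<alpha> j \<noteq> 0"
    by (metis add.commute add_0 shift_apply)
qed

lemma shift_n_\<theta>: "shift n \<theta> = \<theta>"
  using shift_trunc_cycle_mult[of 1 n \<alpha>] by (simp add: \<theta>_def del: shift_apply)

lemma \<theta>_less: "i < n - 1 \<Longrightarrow> \<theta> i = \<alpha> i"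
  by (simp add: \<theta>_def trunc_cycle_less)

lemma \<eta>_less: "i < n - 1 \<Longrightarrow> \<eta> M i = \<alpha> i"
  by (cases M) (auto simp: \<eta>_def glue_def \<theta>_less)

lemma \<eta>_shift:
  "\<not> lex_less \<alpha> (shift j (\<eta> M)) \<and> \<not> lex_less (shift j (\<eta> M)) (reflection m \<alpha>)"
proof (cases "j < M * n")
  case False
  then show ?thesis
    using admissible_upper[OF adm] admissible_lower[OF adm] by (simp add: \<eta>_def shift_glue_ge)
next
  case True
  define k where "k = j div n"
  have k: "k < M" using True n_pos by (simp add: k_def less_mult_imp_div_less)
  define s where "s = shift (k * n) (\<eta> M)"
  have s: "s i = \<theta> i" if "i < n" for i
  proof -
    have "k * n + i < Suc k * n" using that by simp
    also have "\<dots> \<le> M * n" using k by (intro mult_le_mono1) simp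
    finally show ?thesis by (simp add: s_def \<eta>_def glue_def \<theta>_def trunc_cycle_add_mult)
  qed
  \<comment> \<open>The next block is either another lowered copy of b or the start of \<alpha>.
    They differ only in the last digit, which \<open>decremented_block_shift\<close> leaves
    open.\<close>
  have s': "s (n + i) = \<alpha> i" if "i < n - 1" for i
  proof (cases "k * n + (n + i) < M * n")
    case True
    then show ?thesis
      using that trunc_cycle_add_mult[of n \<alpha> "Suc k" i]
      by (simp add: s_def \<eta>_def glue_def \<theta>_def trunc_cycle_less algebra_simps)
  next
    case False
    moreover have "k * n + n \<le> M * n" using mult_le_mono1[of "Suc k" M n] k by simp
    moreover have "M * n < Suc (Suc k) * n" using False that n_pos by simp
    then have "M < Suc (Suc k)" by (simp only: mult_less_cancel2)
    with k have "M = Suc k" by simp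
    ultimately show ?thesis by (simp add: s_def \<eta>_def glue_def)
  qed
  have jn: "j mod n < n" using n_pos by simp
  have eq: "shift j (\<eta> M) = shift (j mod n) s"
    by (simp add: s_def k_def add.commute del: shift_apply)
  have ne: "\<exists>i<n. s i \<noteq> m - \<alpha> i" using neq s by (auto simp: \<theta>_def)
  have s0: "s i = \<alpha> i" if "i < n - 1" for i using s[of i] \<theta>_less that by simp
  have sl: "s (n - 1) = \<alpha> (n - 1) - 1"
    using s[of "n - 1"] n_pos trunc_cycle_last[OF n_pos, of \<alpha>] by (simp add: \<theta>_def)
  have "lex_less (reflection m \<alpha>) (shift j (\<eta> M))" "lex_less (shift j (\<eta> M)) \<alpha>"
    unfolding eq
    using decremented_block_shift[OF adm good s0 sl s' ne jn] by (auto dest: lex_within_imp_less)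
  then show ?thesis using lex_asym by blast
qed

lemma reflection_\<eta>_shift:
  "\<not> lex_less \<alpha> (shift j (reflection m (\<eta> M))) \<and>
   \<not> lex_less (shift j (reflection m (\<eta> M))) (reflection m \<alpha>)"
  using \<eta>_shift[of j M] lex_reflection_right[OF digits_\<alpha> digits_shift[OF digits_\<eta>, of j M]]
    lex_reflection[OF digits_shift[OF digits_\<eta>, of j M] digits_\<alpha>]
  by (simp add: shift_reflection del: shift_apply reflection_apply)

lemma glue_shift_less:
  assumes "\<And>i. i < n - 1 \<Longrightarrow> t i = \<alpha> i" "0 < j" "j < n"
  shows "lex_less (reflection m \<alpha>) (shift j (glue n \<alpha> (reflection m t)))"
    "lex_less (shift j (glue n \<alpha> (reflection m t))) \<alpha>"
  using glue_reflection_shift[OF adm good assms] by (auto dest: lex_within_imp_less)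

lemma val_\<alpha>_less: "q < p \<Longrightarrow> val p \<alpha> < 1"
  using val_strict_antimono[of q p m \<alpha>] q digits_\<alpha> val_\<alpha> by force

lemma univoque_upper_seq: "q < p \<Longrightarrow> univoque m p (upper_seq M)"
proof (rule univoqueI[OF _ digits_upper_seq digits_\<alpha>])
  assume p: "q < p"
  then show "1 < p" using q by simp
  show "val p \<alpha> \<le> 1" "val p \<alpha> < 1 \<or> infinite_seq \<alpha> \<and> (\<forall>n>0. lex_less (shift n (upper_seq M)) \<alpha> \<and>
      lex_less (reflection m \<alpha>) (shift n (upper_seq M)))"
    using val_\<alpha>_less[OF p] by auto
  fix j :: nat assume j: "0 < j"
  show "\<not> lex_less \<alpha> (shift j (upper_seq M)) \<and> \<not> lex_less (shift j (upper_seq M)) (reflection m \<alpha>)"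
  proof (cases "j < n")
    case True
    then show ?thesis
      unfolding upper_seq_def
      using lex_asym[OF glue_shift_less(1)[OF \<eta>_less j True]]
        lex_asym[OF glue_shift_less(2)[OF \<eta>_less j True]] by simp
  next
    case False
    then have "shift j (upper_seq M) = shift (j - n) (reflection m (\<eta> M))"
      by (simp add: upper_seq_def shift_glue_ge del: shift_apply reflection_apply)
    then show ?thesis using reflection_\<eta>_shift by metis
  qed
qed

lemma univoque_lower_seq: "q < p \<Longrightarrow> univoque m p (lower_seq N)"
  unfolding lower_seq_def
proof (rule univoque_glue_zero)
  assume p: "q < p"
  then show p1: "1 < p" using q by simp
  have v: "val p \<alpha> < 1" by (rule val_\<alpha>_less[OF p])
  show "val p (reflection m (\<eta> N)) < 1"
    using reflection_\<eta>_shift v by (intro val_less_one[OF p1 digits_reflection digits_\<alpha>]) auto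
  show "univoque m p (reflection m (\<eta> N))"
    using reflection_\<eta>_shift v by (intro univoqueI[OF p1 digits_reflection digits_\<alpha>]) auto
qed

lemma head_reflection_\<theta>: "head p n (reflection m \<theta>) = head p n (reflection m \<alpha>) + 1 / p ^ n"
proof -
  obtain l where l: "n = Suc l" using n_pos by (cases n) auto
  have "head p l (reflection m \<theta>) = head p l (reflection m \<alpha>)"
    using \<theta>_less l by (intro head_cong) simp
  moreover have "\<theta> l = \<alpha> l - 1" 
    using trunc_cycle_last[OF n_pos, of \<alpha>] l unfolding \<theta>_def by (metis diff_Suc_1)
  moreover have "0 < \<alpha> l" using good_last_pos[OF good] l by simp
  ultimately show ?thesis
    using digitsD[OF digits_\<alpha>, of l] l by (simp add: head_Suc of_nat_diff add_divide_distrib diff_divide_distrib)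
qed

context
  fixes p :: real assumes p: "1 < p"
begin

lemma cycle_value_eq: "cycle_value p = head p n (reflection m \<theta>) + cycle_value p / p ^ n"
  unfolding cycle_value_def using val_split[OF p digits_reflection, of m \<theta> n]
  by (simp add: shift_reflection shift_n_\<theta> del: shift_apply reflection_apply)

lemma val_reflection_\<alpha>: "val p (reflection m \<alpha>) = head p n (reflection m \<alpha>) + val p \<alpha> / p ^ n"
  using val_split[OF p digits_reflection, of m \<alpha> n] digits_\<alpha>
  by (simp add: shift_reflection shift_anti del: shift_apply reflection_apply)

lemma gap_eq: "gap p = (1 + cycle_value p - val p \<alpha>) / p ^ n"
  using cycle_value_eq val_reflection_\<alpha> head_reflection_\<theta>
  by (simp add: gap_def add_divide_distrib diff_divide_distrib)

lemma cycle_value_pos: "0 < cycle_value p"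
proof -
  have "reflection m \<theta> (n - 1) = m - (\<alpha> (n - 1) - 1)"
    using trunc_cycle_last[OF n_pos, of \<alpha>] by (simp add: \<theta>_def)
  then have "reflection m \<theta> (n - 1) \<noteq> 0"
    using good_last_pos[OF good] digitsD[OF digits_\<alpha>, of "n - 1"] by simp
  then show ?thesis unfolding cycle_value_def by (rule val_pos[OF p digits_reflection])
qed

lemma val_reflection_\<eta>: "val p (reflection m (\<eta> M)) = cycle_value p - gap p / p ^ (M * n)"
proof -
  have "reflection m (\<eta> M) = glue (M * n) (reflection m \<theta>) (reflection m \<alpha>)"
    by (auto simp: \<eta>_def glue_def fun_eq_iff)
  then have "val p (reflection m (\<eta> M)) = head p (M * n) (reflection m \<theta>)
      + val p (reflection m \<alpha>) / p ^ (M * n)"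
    using val_glue[OF p digits_reflection digits_reflection] by metis
  moreover have "cycle_value p = head p (M * n) (reflection m \<theta>) + cycle_value p / p ^ (M * n)"
    unfolding cycle_value_def using val_split[OF p digits_reflection, of m \<theta> "M * n"]
      shift_trunc_cycle_mult[of M n \<alpha>]
    by (simp add: shift_reflection \<theta>_def del: shift_apply reflection_apply)
  ultimately show ?thesis by (simp add: gap_def diff_divide_distrib)
qed

lemma defect_limit_eq: "defect_limit p = 1 - head p n \<alpha> - cycle_value p / p ^ n + cycle_value p / p ^ (2 * n)"
proof -
  have "head p n (reflection m \<theta>) / p ^ n = (cycle_value p - cycle_value p / p ^ n) / p ^ n"
    using cycle_value_eq by simp
  also have "\<dots> = cycle_value p / p ^ n - cycle_value p / p ^ (2 * n)"
    by (simp add: diff_divide_distrib mult_2 power_add)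
  finally show ?thesis by (simp add: defect_limit_def)
qed

lemma defect_eq: "defect N M p = defect_limit p - gap p / p ^ (N * n + 2 * n) + gap p / p ^ (M * n + n)"
proof -
  have "val p (lower_seq N) = (cycle_value p - gap p / p ^ (N * n)) / p ^ (2 * n)"
    unfolding lower_seq_def using val_glue_zero[OF p digits_reflection] val_reflection_\<eta> by metis
  moreover have "val p (upper_seq M) = head p n \<alpha> + (cycle_value p - gap p / p ^ (M * n)) / p ^ n"
    unfolding upper_seq_def using val_glue[OF p digits_\<alpha> digits_reflection] val_reflection_\<eta> by metis
  ultimately show ?thesis
    by (simp add: defect_def defect_limit_eq diff_divide_distrib power_add)
qed

lemma gap_pos: "q \<le> p \<Longrightarrow> 0 < gap p"
  using gap_eq cycle_value_pos val_\<alpha>_less[of p] val_\<alpha> p by (cases "p = q") auto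

end

lemma defect_limit_q: "defect_limit q = 0"
proof -
  have "1 = head q n \<alpha> + val q (reflection m \<alpha>) / q ^ n"
    using val_split[OF q digits_\<alpha>, of n] val_\<alpha> shift_anti by simp
  moreover have "val q (reflection m \<alpha>) = head q n (reflection m \<theta>)"
    using val_reflection_\<alpha>[OF q] val_\<alpha> head_reflection_\<theta>[of q] by simp
  ultimately show ?thesis by (simp add: defect_limit_def)
qed

lemma defect_limit_pos:
  assumes p: "q < p" shows "0 < defect_limit p"
proof -
  define \<beta> where "\<beta> = glue n \<alpha> (glue n (reflection m \<theta>) (\<lambda>_. 0))"
  have digits_\<alpha>\<beta>: "digits m \<beta>" using digits_\<alpha> by (simp add: \<beta>_def)
  have v: "val r \<beta> = 1 - defect_limit r" if "1 < r" for r
  proof -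
    have "val r (glue n (reflection m \<theta>) (\<lambda>_. 0)) = head r n (reflection m \<theta>)"
      using val_glue[OF that digits_reflection digits_zero] by simp
    then show ?thesis
      unfolding \<beta>_def defect_limit_def
      using val_glue[OF that digits_\<alpha> digits_glue[OF digits_reflection digits_zero]] by simp
  qed
  have "val p \<beta> < val q \<beta>"
    using v[OF q] defect_limit_q by (intro val_strict_antimono[OF q p digits_\<alpha>\<beta>]) auto
  then show ?thesis using v[of p] v[OF q] defect_limit_q p q by simp
qed

lemma q_less: "q < real m + 1"
proof -
  obtain i where "reflection m \<alpha> i \<noteq> 0"
    using infinite_seq_shift[OF infinite_\<alpha>, of n] shift_anti by metis
  then have "0 < val q (reflection m \<alpha>)" by (rule val_pos[OF q digits_reflection])
  then show ?thesis using val_reflection[OF q digits_\<alpha>] val_\<alpha> q by (simp add: field_simps)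
qed

text \<open>The pair obtained from \<open>lower_seq\<close> and \<open>upper_seq\<close> by letting
  both indices tend to infinity already works in base q: its comparisons with \<alpha> are strict,
  and its equation is \<open>defect_limit q = 0\<close>.\<close>

lemma q_in_B2: "q \<in> B2 m"
proof -
  let ?t = "reflection m \<theta>"
  note tail = reflection_trunc_cycle_shift[OF adm good neq, folded \<theta>_def]
  note tail_asym = tail[THEN lex_asym]
  have ut: "univoque m q ?t"
    using tail tail_asym infinite_\<alpha> val_\<alpha> by (intro univoqueI[OF q digits_reflection digits_\<alpha>]) simp_all
  have "val q ?t < 1"
    using tail[of 0] tail_asym infinite_\<alpha> val_\<alpha>
    by (intro val_less_one[OF q digits_reflection digits_\<alpha>])
       (simp_all del: shift_apply reflection_apply)
  then have lower: "univoque m q (glue (2 * n) (\<lambda>_. 0) ?t)" by (rule univoque_glue_zero[OF q ut])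
  have dg: "digits m (glue n \<alpha> ?t)" using digits_\<alpha> by simp
  have tail': "lex_less (reflection m \<alpha>) (shift j (glue n \<alpha> ?t)) \<and> lex_less (shift j (glue n \<alpha> ?t)) \<alpha>"
    if j: "0 < j" for j
  proof (cases "j < n")
    case True
    then show ?thesis using glue_shift_less[OF \<theta>_less j True] by blast
  next
    case False
    then show ?thesis using tail[of "j - n"] by (simp add: shift_glue_ge del: shift_apply reflection_apply)
  qed
  have upper: "univoque m q (glue n \<alpha> ?t)"
    using tail' tail'[THEN conjunct1, THEN lex_asym] tail'[THEN conjunct2, THEN lex_asym]
      infinite_\<alpha> val_\<alpha> by (intro univoqueI[OF q dg digits_\<alpha>]) simp_all
  have "1 + val q (glue (2 * n) (\<lambda>_. 0) ?t) = val q (glue n \<alpha> ?t)"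
    using defect_limit_eq[OF q] defect_limit_q val_glue[OF q digits_\<alpha> digits_reflection] val_glue_zero[OF q digits_reflection]
    by (simp add: cycle_value_def)
  then show ?thesis using lower upper B2_iff[OF q] q_less by (metis less_imp_le)
qed

lemma defect_antimono_index:
  assumes p: "q \<le> p" and M: "N + 2 \<le> M"
  shows "defect N M p \<le> defect N (N + 2) p"
proof -
  have p1: "1 < p" using p q by simp
  have "(N + 2) * n \<le> M * n" using M by (intro mult_le_mono1)
  then have "gap p / p ^ (M * n + n) \<le> gap p / p ^ ((N + 2) * n + n)"
    using p1 gap_pos[OF p1 p] by (intro divide_left_mono power_increasing) auto
  then show ?thesis using defect_eq[OF p1] by simp
qed

text \<open>Index N + 2 is the smallest M with negative defect at q: for M = N + 1 the two gap terms
  cancel.\<close>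

lemma defect_q_neg: "defect N (N + 2) q < 0"
proof -
  have "q ^ (N * n + 2 * n) < q ^ ((N + 2) * n + n)"
    using q n_pos by (intro power_strict_increasing) (auto simp: algebra_simps)
  then have "gap q / q ^ ((N + 2) * n + n) < gap q / q ^ (N * n + 2 * n)"
    using q gap_pos[OF q] by (intro divide_strict_left_mono) auto
  then show ?thesis using defect_eq[OF q] defect_limit_q by simp
qed

lemma continuous_defect: "S \<subseteq> {1<..} \<Longrightarrow> continuous_on S (defect N M)"
  unfolding defect_def by (intro continuous_intros continuous_on_val[OF digits_lower_seq] continuous_on_val[OF digits_upper_seq])

lemma zero_in_B2:
  assumes "q < p" "p \<le> real m + 1" "defect N M p = 0"
  shows "p \<in> B2 m"
proof -
  have "1 + val p (lower_seq N) = val p (upper_seq M)" using assms(3) by (simp add: defect_def)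
  then show ?thesis
    using univoque_lower_seq[OF assms(1), of N] univoque_upper_seq[OF assms(1), of M]
      B2_iff[of p m] assms q by auto
qed

lemma zero_index_unique:
  assumes "q < p" "defect N M p = 0" "defect N M' p = 0" shows "M = M'"
proof -
  have p: "1 < p" using assms q by simp
  have "gap p / p ^ (M * n + n) = gap p / p ^ (M' * n + n)" using assms defect_eq[OF p, of N M] defect_eq[OF p, of N M'] by linarith
  then have "p ^ (M * n + n) = p ^ (M' * n + n)"
    using gap_pos[OF p] assms(1) p by (simp add: field_simps)
  then have "M * n + n = M' * n + n" by (rule power_inject_exp[THEN iffD1, rotated]) (rule p)
  then show ?thesis using n_pos by simp
qed

text \<open>With N fixed, each M \<ge> N + 2 yields a zero of the defect between q and q + e. The
  zeros for different M are distinct and stay a fixed distance above q, so they accumulate at a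
  point that is not q itself.\<close>

lemma limit_point_near:
  assumes e: "0 < e" "q + e \<le> real m + 1"
  obtains p where "q < p" "p \<le> q + e" "p islimpt B2 m"
proof -
  let ?r = "q + e"
  have r: "1 < ?r" "q \<le> ?r" using q e by auto
  have "0 < defect_limit ?r / gap ?r" using defect_limit_pos[of ?r] gap_pos[OF r] e by simp
  then obtain N where N: "(1 / ?r) ^ N < defect_limit ?r / gap ?r"
    using real_arch_pow_inv[of "defect_limit ?r / gap ?r" "1 / ?r"] r by auto
  have fr: "0 < defect N M ?r" for M
  proof -
    have "N \<le> N * n + 2 * n" using n_pos by (metis One_nat_def Suc_leI le_add1 le_trans mult.right_neutral mult_le_mono2)
    then have "gap ?r / ?r ^ (N * n + 2 * n) \<le> gap ?r / ?r ^ N"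
      using r gap_pos[OF r] by (intro divide_left_mono power_increasing) auto
    also have "\<dots> < defect_limit ?r" using N gap_pos[OF r] r by (simp add: field_simps power_one_over)
    finally have "0 < defect_limit ?r - gap ?r / ?r ^ (N * n + 2 * n)" by simp
    moreover have "0 < gap ?r / ?r ^ (M * n + n)" using gap_pos[OF r] r by simp
    ultimately show ?thesis using defect_eq[OF r(1), of N M] by simp
  qed
  have cont: "continuous_on {q..?r} (defect N M)" for M using q by (intro continuous_defect) auto
  \<comment> \<open>By \<open>defect_antimono_index\<close>, negativity near q for M = N + 2 gives
    negativity there for all larger M, so this distance does not depend on M.\<close>
  obtain \<delta> where \<delta>: "0 < \<delta>" "\<And>p. p \<in> {q..?r} \<Longrightarrow> dist p q < \<delta> \<Longrightarrow> dist (defect N (N + 2) p) (defect N (N + 2) q) < - defect N (N + 2) q"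
    using cont[of "N + 2"] defect_q_neg[of N] r unfolding continuous_on_iff
    by (metis atLeastAtMost_iff neg_0_less_iff_less order.refl)
  have near: "defect N M p < 0" if "N + 2 \<le> M" "p \<in> {q..?r}" "p < q + \<delta>" for M p
  proof -
    have "dist p q < \<delta>" using that by (simp add: dist_real_def)
    then have "defect N (N + 2) p < 0" using \<delta>(2)[OF that(2)] by (simp add: dist_real_def)
    then show ?thesis using defect_antimono_index[of p N M] that by auto
  qed
  have "\<exists>p. p \<in> {q + \<delta>..?r} \<and> defect N M p = 0" if M: "N + 2 \<le> M" for M
  proof -
    have "\<exists>p\<ge>q. p \<le> ?r \<and> defect N M p = 0"
      using near[OF M, of q] \<delta> fr[of M] r cont by (intro IVT') auto
    then obtain p where p: "q \<le> p" "p \<le> ?r" "defect N M p = 0" by blast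
    have "q + \<delta> \<le> p" using near[OF M, of p] p by force
    then show ?thesis using p by auto
  qed
  then have "\<forall>M. \<exists>p. N + 2 \<le> M \<longrightarrow> p \<in> {q + \<delta>..?r} \<and> defect N M p = 0" by blast
  then obtain P where P: "\<And>M. N + 2 \<le> M \<Longrightarrow> P M \<in> {q + \<delta>..?r} \<and> defect N M (P M) = 0"
    by metis
  have "inj_on P {N + 2..}"
  proof (rule inj_onI)
    fix M M' assume "M \<in> {N + 2..}" "M' \<in> {N + 2..}" "P M = P M'"
    then show "M = M'" using P[of M] P[of M'] \<delta>(1) by (intro zero_index_unique[of "P M" N]) auto
  qed
  then have "infinite (P ` {N + 2..})" using finite_imageD infinite_Ici by blast
  moreover have "P ` {N + 2..} \<subseteq> {q + \<delta>..?r}" using P by blast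
  ultimately obtain p where p: "p \<in> {q + \<delta>..?r}" "p islimpt (P ` {N + 2..})"
    using Heine_Borel_imp_Bolzano_Weierstrass[OF compact_Icc] by blast
  have "P ` {N + 2..} \<subseteq> B2 m"
  proof
    fix x assume "x \<in> P ` {N + 2..}"
    then obtain M where "N + 2 \<le> M" "x = P M" by auto
    then show "x \<in> B2 m" using P[of M] \<delta>(1) e by (intro zero_in_B2[of x N M]) auto
  qed
  then have "p islimpt B2 m" using p(2) islimpt_subset by blast
  then show ?thesis using that[of p] p(1) \<delta>(1) by auto
qed

lemma q_islimpt_derived: "q islimpt {p \<in> base_interval m. p islimpt B2 m}"
proof (rule islimpt_approachable[THEN iffD2], intro allI impI)
  fix e :: real assume e: "0 < e"
  define \<delta> where "\<delta> = min (e / 2) (real m + 1 - q)"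
  have \<delta>: "0 < \<delta>" "\<delta> < e" "q + \<delta> \<le> real m + 1" using e q_less by (auto simp: \<delta>_def)
  obtain p where "q < p" "p \<le> q + \<delta>" "p islimpt B2 m" by (rule limit_point_near[OF \<delta>(1,3)])
  then show "\<exists>x\<in>{p \<in> base_interval m. p islimpt B2 m}. x \<noteq> q \<and> dist x q < e"
    using \<delta> q by (intro bexI[of _ p]) (auto simp: dist_real_def base_interval_def)
qed

end

section \<open>Closedness and the inclusions for the sets of univoque bases\<close>

text \<open>Since s is m followed by \<alpha> and not above \<alpha>, the first digit of \<alpha> is
  m and removing it does not decrease \<alpha>; by \<open>max_head_not_lex_less\<close> it does not
  increase \<alpha> either.\<close>

lemma eq_const_max:
  assumes d: "digits m \<alpha>" and s: "\<not> lex_less \<alpha> s" "s 0 = m" "shift 1 s = \<alpha>"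
  shows "\<alpha> = (\<lambda>_. m)"
proof -
  have a0: "\<alpha> 0 = m" using s lex_lessI[of 0 \<alpha> s] digitsD[OF d, of 0] by fastforce
  have "\<not> lex_less (shift 1 \<alpha>) (shift 1 s)"
    using s(1,2) a0 lex_less_shift[of 1 \<alpha> s] by auto
  then have eq: "shift 1 \<alpha> = \<alpha>"
    using max_head_not_lex_less[OF d a0] s(3) lex_linear[of "shift 1 \<alpha>" \<alpha>] by auto
  then have "\<alpha> (Suc i) = \<alpha> i" for i by (metis shift_apply plus_1_eq_Suc)
  then have "\<alpha> i = m" for i by (induction i) (use a0 in auto)
  then show ?thesis by auto
qed

lemma univoque_max: "1 < q \<Longrightarrow> univoque m q (\<lambda>_. m)"
  by (simp add: univoque_def digits_def shift_def reflection_def)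

lemma val_max_eq_one: "1 < q \<Longrightarrow> val q (\<lambda>_. m) = 1 \<longleftrightarrow> q = real m + 1"
  by (auto simp: val_const field_simps)

lemma univoque_one_in_B2:
  assumes "1 < q" "q \<le> real m + 1" "univoque m q c" "val q c = 1"
  shows "q \<in> B2 m"
  using B2_iff[OF assms(1,2)] assms(3,4) univoque_zero[of m q]
  by (intro B2_iff[OF assms(1,2), THEN iffD2] exI[of _ "\<lambda>_. 0"] exI[of _ c]) simp

lemma m_plus_one_in_B2: "1 \<le> m \<Longrightarrow> real m + 1 \<in> B2 m"
  using univoque_one_in_B2[of "real m + 1" m "\<lambda>_. m"] univoque_max val_max_eq_one[of "real m + 1" m]
  by simp

text \<open>The failing comparison is an equality, so take the least antiperiod n. If n were not
  good, some suffix of the block from j would agree with the reflection; then n - j is a period, and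
  j is a smaller antiperiod, or \<alpha> is its own reflection. The latter, and the degenerate n =
  1, occur only at \<open>\<G> m\<close>.\<close>

lemma antiperiodic_exists:
  assumes q: "1 < q" and m: "1 \<le> m" and adm: "admissible m \<alpha>" and v: "val q \<alpha> = 1"
    and nlex: "\<not> lex_less (reflection m \<alpha>) (shift i \<alpha>)" and G: "q \<noteq> \<G> m"
  shows "\<exists>n. antiperiodic m n \<alpha> q"
proof -
  note d = admissible_digits[OF adm]
  have ns: "\<alpha> \<noteq> reflection m \<alpha>"
  proof
    assume eq: "\<alpha> = reflection m \<alpha>"
    then have "m = 2 * \<alpha> 0" using digitsD[OF d, of 0] by (metis add.commute le_add_diff_inverse mult_2 reflection_apply)
    moreover have "1 = real m / (q - 1) - 1" using val_reflection[OF q d] eq v by simp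
    then have "q = real m / 2 + 1" using q by (simp add: field_simps)
    ultimately have "q = \<G> m" by (simp add: \<G>_def Let_def)
    with G show False by simp
  qed
  have i: "shift i \<alpha> = reflection m \<alpha>"
    using nlex admissible_lower[OF adm, of i] lex_linear by blast
  then have "0 < i" using ns by (cases i) auto
  define n where "n = (LEAST i. 0 < i \<and> shift i \<alpha> = reflection m \<alpha>)"
  have n: "0 < n \<and> shift n \<alpha> = reflection m \<alpha>"
    unfolding n_def by (rule LeastI[of _ i]) (use i \<open>0 < i\<close> in simp)
  have least: "shift j \<alpha> \<noteq> reflection m \<alpha>" if "0 < j" "j < n" for j
    using not_less_Least[of j "\<lambda>i. 0 < i \<and> shift i \<alpha> = reflection m \<alpha>"] that by (auto simp: n_def)
  have anti: "\<alpha> (n + j) = m - \<alpha> j" for j using n by (metis shift_apply reflection_apply)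
  have "lex_within (n - j) (reflection m \<alpha>) (shift j \<alpha>)" if j: "j < n" for j
  proof (rule ccontr)
    assume "\<not> ?thesis"
    then have eq: "m - \<alpha> x = \<alpha> (j + x)" if "x < n - j" for x
      using not_lex_less_cases[OF admissible_lower[OF adm, of j], of "n - j"] that by auto
    show False
    proof (cases "j = 0")
      case True
      have "\<alpha> x = m - \<alpha> x" for x
      proof (induction x rule: less_induct)
        case (less x)
        show ?case
        proof (cases "x < n")
          case True
          then show ?thesis using eq[of x] \<open>j = 0\<close> by simp
        next
          case False
          then have "\<alpha> x = m - \<alpha> (x - n)" using anti[of "x - n"] by simp
          moreover have "x - n < x" using False n by simp
          ultimately show ?thesis using less[of "x - n"] by simp
        qed
      qed
      then have "\<alpha> = reflection m \<alpha>" by auto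
      with ns show False ..
    next
      case False
      have "\<not> lex_less (shift (n - j) (shift j \<alpha>)) (shift (n - j) (reflection m \<alpha>))"
        using lex_less_shift[of "n - j" "shift j \<alpha>" "reflection m \<alpha>"] eq admissible_lower[OF adm, of j]
        by (metis reflection_apply shift_apply)
      moreover have "shift (n - j) (shift j \<alpha>) = reflection m \<alpha>" using n j by (simp del: shift_apply)
      ultimately have "\<not> lex_less (shift (n - j) \<alpha>) \<alpha>"
        using lex_reflection[OF d digits_shift[OF d, of "n - j"]] by (metis shift_reflection)
      then have per: "shift (n - j) \<alpha> = \<alpha>"
        using admissible_upper[OF adm, of "n - j"] lex_linear by blast
      have "shift j \<alpha> x = reflection m \<alpha> x" for x
      proof (cases "x < n - j")
        case True
        then show ?thesis using eq[OF True] by simp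
      next
        case False
        define y where "y = x - (n - j)"
        have "j + x = n + y" "x = n - j + y" using False j by (auto simp: y_def)
        moreover have "\<alpha> (n - j + y) = \<alpha> y" using per by (metis shift_apply)
        ultimately show ?thesis using anti[of y] by simp
      qed
      then show False using least[of j] False j by (metis ext gr0I)
    qed
  qed
  then have good: "good m \<alpha> n" using n by (simp add: good_def)
  have "\<exists>i<n. trunc_cycle n \<alpha> i \<noteq> m - \<alpha> i"
  proof (cases "2 \<le> n")
    case True
    then show ?thesis by (rule trunc_cycle_neq_reflection[OF adm good])
  next
    case False
    then have n1: "n = 1" using n by simp
    show ?thesis
    proof (rule ccontr)
      assume "\<not> ?thesis"
      \<comment> \<open>Here \<alpha> alternates k + 1, k, and the equation for its base is q^2 = (k
        + 1) q + (k + 1), solved by \<open>\<G> m\<close>.\<close>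
      then have "\<alpha> 0 - 1 = m - \<alpha> 0" using n1 trunc_cycle_last[of 1 \<alpha>] by simp
      moreover have "0 < \<alpha> 0" using good_last_pos[OF good] n1 by simp
      ultimately have m2: "m = 2 * (\<alpha> 0 - 1) + 1" using digitsD[OF d, of 0] by linarith
      define k where "k = real (m div 2)"
      have k: "real (\<alpha> 0) = k + 1" "real m = 2 * k + 1" "odd m" "0 \<le> k"
      proof -
        define k' where "k' = \<alpha> 0 - 1"
        have "\<alpha> 0 = k' + 1" "m = 2 * k' + 1" using m2 \<open>0 < \<alpha> 0\<close> by (auto simp: k'_def)
        then show "real (\<alpha> 0) = k + 1" "real m = 2 * k + 1" "odd m" "0 \<le> k" by (auto simp: k_def)
      qed
      have "1 = (k + 1 + (real m / (q - 1) - 1)) / q"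
        using val_step_0[OF q d] v n n1 val_reflection[OF q d] k(1) by simp
      then have "q * (q - 1) = k * (q - 1) + (2 * k + 1)" using q k(2) by (simp add: field_simps)
      then have sq: "(2 * q - (k + 1)) ^ 2 = k ^ 2 + 6 * k + 5" and pr: "q * (q - (k + 1)) = k + 1"
        by (simp_all add: power2_eq_square algebra_simps)
      have "0 < q * (q - (k + 1))" using pr k by simp
      then have "k + 1 < q" using q by (simp add: zero_less_mult_iff)
      then have "sqrt (k ^ 2 + 6 * k + 5) = 2 * q - (k + 1)"
        unfolding sq[symmetric] using k by simp
      then have "q = \<G> m" using k(3) by (simp add: \<G>_def Let_def k_def)
      with G show False by simp
    qed
  qed
  then have "antiperiodic m n \<alpha> q"
    by unfold_locales (use q m adm v good anti in auto)
  then show ?thesis by blast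
qed

text \<open>Raising the last digit of the period turns \<alpha> into a finite expansion of 1.
  Appending a tail w to it, and w to n zeros, gives two sequences whose values differ by 1. They are
  univoque if w is univoque, of value below 1 and close enough to the reflection of
  \<alpha>.\<close>

lemma periodic_in_B2:
  assumes q: "1 < q" "q \<le> real m + 1" and adm: "admissible m \<alpha>" and v: "val q \<alpha> = 1"
    and lex: "\<And>i. lex_less (reflection m \<alpha>) (shift i \<alpha>)"
    and per: "0 < i" "shift i \<alpha> = \<alpha>" and nmax: "\<alpha> \<noteq> (\<lambda>_. m)"
  shows "q \<in> B2 m"
proof -
  note d = admissible_digits[OF adm]
  define n where "n = (LEAST i. 0 < i \<and> shift i \<alpha> = \<alpha>)"
  have n: "0 < n \<and> shift n \<alpha> = \<alpha>" unfolding n_def by (rule LeastI[of _ i]) (use per in simp)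
  then have n0: "0 < n" and shift_n: "shift n \<alpha> = \<alpha>" by auto
  have least: "lex_less (shift j \<alpha>) \<alpha>" if "0 < j" "j < n" for j
  proof -
    have "shift j \<alpha> \<noteq> \<alpha>"
      using not_less_Least[of j "\<lambda>i. 0 < i \<and> shift i \<alpha> = \<alpha>"] that by (auto simp: n_def)
    then show ?thesis using admissible_upper[OF adm, of j] lex_linear by blast
  qed
  have last: "\<alpha> (n - 1) < m"
  proof (rule ccontr)
    assume "\<not> \<alpha> (n - 1) < m"
    then have "shift (n - 1) \<alpha> 0 = m" using digitsD[OF d, of "n - 1"] by simp
    moreover have "shift 1 (shift (n - 1) \<alpha>) = \<alpha>" using n by (simp del: shift_apply)
    ultimately have "\<alpha> = (\<lambda>_. m)" by (rule eq_const_max[OF d admissible_upper[OF adm]])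
    with nmax show False ..
  qed
  have "\<forall>j. \<exists>l. lex_within l (reflection m \<alpha>) (shift j \<alpha>)" using lex lex_less_imp_within by blast
  then obtain l where l: "\<And>j. lex_within (l j) (reflection m \<alpha>) (shift j \<alpha>)" by metis
  \<comment> \<open>L digits suffice to see that the reflection of \<alpha> is below each of the
    shifts up to n; w agrees with the reflection that far and inherits the inequality.\<close>
  define L where "L = Max (l ` {..n})"
  have L: "lex_within L (reflection m \<alpha>) (shift j \<alpha>)" if "j \<le> n" for j
    using l[of j] by (rule lex_within_mono) (use that in \<open>simp add: L_def\<close>)
  obtain r where r: "L + 2 < r" "good m \<alpha> r" using good_unbounded[OF adm lex] by blast
  have ne: "\<exists>i<r. trunc_cycle r \<alpha> i \<noteq> m - \<alpha> i"
    using r by (intro trunc_cycle_neq_reflection[OF adm r(2)]) auto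
  define w where "w = reflection m (trunc_cycle r \<alpha>)"
  have dw: "digits m w" by (simp add: w_def)
  have w_less: "lex_less w (shift j \<alpha>)" if "j \<le> n" for j
  proof -
    have "lex_within L w (shift j \<alpha>)"
      using L[OF that] lex_within_cong[of L w "reflection m \<alpha>" "shift j \<alpha>" "shift j \<alpha>"] r
      by (simp add: w_def trunc_cycle_less)
    then show ?thesis by (rule lex_within_imp_less)
  qed
  note w_tail = reflection_trunc_cycle_shift[OF adm r(2) ne, folded w_def]
  have inf: "infinite_seq \<alpha>" by (rule infinite_seqI) (rule lex_less_nonzero[OF lex])
  define c where "c = glue (Suc (n - 1)) (\<alpha>(n - 1 := \<alpha> (n - 1) + 1)) w"
  have dc: "digits m c" unfolding c_def by (rule digits_replace[OF d dw]) (use last in simp)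
  have c_tail: "lex_less (reflection m \<alpha>) (shift j c) \<and> lex_less (shift j c) \<alpha>" if j: "0 < j" for j
  proof (cases "j < n")
    case False
    then have "shift j c = shift (j - n) w" using n0 by (simp add: c_def shift_glue_ge del: shift_apply)
    then show ?thesis using w_tail by metis
  next
    case True
    define e where "e = n - 1 - j"
    have e: "j + e = n - 1" "Suc e = n - j" using True by (auto simp: e_def)
    have c_less: "c (j + i) = \<alpha> (j + i)" if "i < e" for i
    proof -
      have "j + i < n" "j + i \<noteq> n - 1" using that e by linarith+
      then show ?thesis by (simp add: c_def glue_def)
    qed
    have c_e: "c (j + e) = \<alpha> (n - 1) + 1" using e by (simp add: c_def glue_def)
    have "lex_less (shift j \<alpha>) (shift j c)"
      using c_less c_e e by (intro lex_lessI[of e]) auto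
    then have low: "lex_less (reflection m \<alpha>) (shift j c)" by (rule lex_trans[OF lex])
    obtain s where s: "\<forall>i<s. \<alpha> (j + i) = \<alpha> i" "\<alpha> (j + s) < \<alpha> s"
      using least[OF j True] by (auto simp: lex_less_def)
    have "lex_less (shift j c) \<alpha>"
    proof (cases s e rule: linorder_cases)
      case less
      then show ?thesis using s c_less by (intro lex_lessI[of s]) auto
    next
      case equal
      show ?thesis
      proof (cases "\<alpha> (n - 1) + 1 < \<alpha> e")
        case True
        then show ?thesis using s c_less c_e equal by (intro lex_lessI[of e]) auto
      next
        case False
        \<comment> \<open>Raising the digit has used up the first difference, so the comparison is
          left to w against a shift of \<alpha>.\<close>
        then have eq: "c (j + e) = \<alpha> e" using s(2) e(1) c_e equal by simp
        show ?thesis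
        proof (rule lex_less_shift)
          show "shift j c i = \<alpha> i" if "i < Suc e" for i
            using that s(1) c_less[of i] eq equal by (cases "i = e") auto
          have "shift (Suc e) (shift j c) = w"
            using e n0 by (simp add: c_def shift_glue_ge del: shift_apply)
          moreover have "lex_less w (shift (Suc e) \<alpha>)" using e by (intro w_less) auto
          ultimately show "lex_less (shift (Suc e) (shift j c)) (shift (Suc e) \<alpha>)" by simp
        qed
      qed
    next
      case greater
      \<comment> \<open>Agreement beyond the end of the period would, by periodicity, exhibit a
        shift of \<alpha> above \<alpha>.\<close>
      have "lex_less \<alpha> (shift (Suc e) \<alpha>)"
      proof (rule lex_lessI[of "s - Suc e"])
        have per: "\<alpha> (n + x) = \<alpha> x" for x using shift_n by (metis shift_apply)
        have eq: "\<alpha> (j + (Suc e + x)) = \<alpha> x" for x using per[of x] e by (simp add: add.assoc[symmetric])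
        show "\<alpha> x = shift (Suc e) \<alpha> x" if "x < s - Suc e" for x
          using s(1)[rule_format, of "Suc e + x"] eq[of x] that by simp
        show "\<alpha> (s - Suc e) < shift (Suc e) \<alpha> (s - Suc e)"
          using s(2) eq[of "s - Suc e"] greater by simp
      qed
      then show ?thesis using admissible_upper[OF adm] by blast
    qed
    with low show ?thesis ..
  qed
  have uc: "univoque m q c"
    using c_tail c_tail[THEN conjunct1, THEN lex_asym] c_tail[THEN conjunct2, THEN lex_asym] inf v
    by (intro univoqueI[OF q(1) dc d]) simp_all
  have uw: "univoque m q w"
    using w_tail w_tail[THEN lex_asym] inf v by (intro univoqueI[OF q(1) dw d]) simp_all
  have "val q w < 1"
    using w_tail(2)[of 0] w_tail(2)[THEN lex_asym] inf v
    by (intro val_less_one[OF q(1) dw d]) (simp_all del: shift_apply)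
  then have u0: "univoque m q (glue n (\<lambda>_. 0) w)" by (rule univoque_glue_zero[OF q(1) uw])
  have le: "\<alpha> (n - 1) + 1 \<le> m" using last by simp
  have "val q c = head q (n - 1) \<alpha> + (real (\<alpha> (n - 1) + 1) + val q w) / q ^ Suc (n - 1)"
    unfolding c_def by (rule val_replace[OF q(1) d dw le])
  moreover have "val q \<alpha> = head q (n - 1) \<alpha> + (real (\<alpha> (n - 1)) + 1) / q ^ Suc (n - 1)"
    using val_split_Suc[OF q(1) d, of "n - 1"] shift_n v n0 by simp
  ultimately have "val q c = 1 + val q w / q ^ n"
    using v n0 by (simp add: add_divide_distrib)
  then have "1 + val q (glue n (\<lambda>_. 0) w) = val q c" using val_glue_zero[OF q(1) dw] by simp
  with u0 uc show ?thesis using B2_iff[OF q] by blast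
qed

lemma admissible_strict_in_B2:
  assumes q: "1 < q" "q \<le> real m + 1" and adm: "admissible m \<alpha>" and v: "val q \<alpha> = 1"
    and lex: "\<And>i. lex_less (reflection m \<alpha>) (shift i \<alpha>)"
  shows "q \<in> B2 m"
proof (cases "\<exists>i>0. shift i \<alpha> = \<alpha>")
  case True
  then show ?thesis
    using periodic_in_B2[OF q adm v lex] univoque_one_in_B2[OF q univoque_max[OF q(1)]] v by metis
next
  case False
  have up: "lex_less (shift i \<alpha>) \<alpha>" if "0 < i" for i
    using False that admissible_upper[OF adm, of i] lex_linear by blast
  have "infinite_seq \<alpha>" by (rule infinite_seqI) (rule lex_less_nonzero[OF lex])
  then have "univoque m q \<alpha>"
    using v lex up lex[THEN lex_asym] up[THEN lex_asym]
    by (intro univoqueI[OF q(1) admissible_digits[OF adm] admissible_digits[OF adm]])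
       (simp_all del: shift_apply reflection_apply)
  then show ?thesis using univoque_one_in_B2[OF q] v by blast
qed

section \<open>Weakly univoque expansions of one and the inclusions for \<open>\<U> m\<close> and
  \<open>\<V> m\<close>\<close>

lemma weakly_univoque_shift: "weakly_univoque m q c \<Longrightarrow> weakly_univoque m q (shift n c)"
  by (auto simp: weakly_univoque_def add.commute)

lemma weakly_univoque_reflection: "weakly_univoque m q c \<Longrightarrow> weakly_univoque m q (reflection m c)"
  by (auto simp: weakly_univoque_def shift_reflection)

lemma univoque_imp_weakly: "univoque m q c \<Longrightarrow> weakly_univoque m q c"
  by (auto simp: weakly_univoque_def univoque_def intro: less_imp_le)

text \<open>Behind a last nonzero digit the reflected tail would be constantly m, of value m / (q -
  1) > 1.\<close>

lemma weakly_univoque_infinite: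
  assumes q: "1 < q" "q < real m + 1" and w: "weakly_univoque m q c" and c: "c \<noteq> (\<lambda>_. 0)"
  shows "infinite_seq c"
proof (rule ccontr)
  have d: "digits m c" using w by (simp add: weakly_univoque_def)
  assume "\<not> infinite_seq c"
  then obtain k where "\<not> 0 < val q (shift k c)" using infinite_seq_iff[OF q(1) d] by blast
  then have "val q (shift k c) = 0" using val_nonneg[OF q(1) digits_shift[OF d, of k]] by simp
  then have ex: "shift k c = (\<lambda>_. 0)" by (rule val_eq_0D[OF q(1) digits_shift[OF d]])
  define l where "l = (LEAST k. shift k c = (\<lambda>_. 0))"
  have l: "shift l c = (\<lambda>_. 0)" unfolding l_def by (rule LeastI[of "\<lambda>k. shift k c = (\<lambda>_. 0)", OF ex])
  then obtain j where j: "l = Suc j" using c by (cases l) auto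
  have "shift j c \<noteq> (\<lambda>_. 0)" 
    using not_less_Least[of j "\<lambda>k. shift k c = (\<lambda>_. 0)"] j by (simp add: l_def)
  have "c j \<noteq> 0"
  proof
    assume "c j = 0"
    then have "shift j c i = 0" for i
    proof (cases i)
      case (Suc i')
      then show ?thesis using fun_cong[OF l, of i'] j by simp
    qed simp
    with \<open>shift j c \<noteq> (\<lambda>_. 0)\<close> show False by blast
  qed
  then have "val q (reflection m (shift l c)) \<le> 1" using w j by (simp add: weakly_univoque_def)
  then show False using val_reflection[OF q(1) digits_zero, of m] l q by (simp add: field_simps)
qed

lemma weakly_univoque_one_admissible:
  assumes q: "1 < q" "q < real m + 1" and w: "weakly_univoque m q c" and v: "val q c = 1"
  shows "admissible m c"
proof (rule weakly_univoque_imp_admissible[OF q(1) w _ v])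
  have d: "digits m c" using w by (simp add: weakly_univoque_def)
  have "1 < real m / (q - 1)" using q by (simp add: field_simps)
  then have "val q (reflection m c) \<noteq> 0" using val_reflection[OF q(1) d] v by linarith
  then have "reflection m c \<noteq> (\<lambda>_. 0)" by (metis val_zero)
  moreover have "c \<noteq> (\<lambda>_. 0)" using v by auto
  ultimately show "doubly_infinite m c"
    using weakly_univoque_infinite[OF q] w weakly_univoque_reflection by (auto simp: doubly_infinite_def)
qed

lemma admissible_max: "1 \<le> m \<Longrightarrow> admissible m (\<lambda>_. m)"
  by (auto simp: admissible_def digits_def lex_less_def)

lemma U_imp_islimpt:
  assumes m: "1 \<le> m" and qU: "q \<in> \<U> m"
  shows "q islimpt \<U> m"
proof -
  obtain \<alpha> where q: "1 < q" "q \<le> real m + 1" and u: "univoque m q \<alpha>" and v: "val q \<alpha> = 1"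
    using qU by (auto simp: U_iff)
  note d = univoque_digits[OF u]
  show ?thesis
  proof (cases "\<alpha> = (\<lambda>_. m)")
    case True
    have "lex_less (reflection m \<alpha>) (shift i \<alpha>)" for i
      using True m by (intro lex_lessI[of 0]) auto
    then show ?thesis using islimpt_U[OF q(1) _ v] admissible_max[OF m] True by simp
  next
    case False
    have q': "q < real m + 1"
    proof (rule ccontr)
      assume "\<not> q < real m + 1"
      then have "\<alpha> = (\<lambda>_. m)"
        using v q val_max_eq_one[OF q(1), of m] by (intro univoque_unique[OF q(1) u]) (auto simp: digits_def)
      with False show False ..
    qed
    have adm: "admissible m \<alpha>"
      by (rule weakly_univoque_one_admissible[OF q(1) q' univoque_imp_weakly[OF u] v])
    \<comment> \<open>A shift equal to the reflection is ruled out in three ways: i = 0 forces m /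
      (q - 1) = 2 against strictness; behind a zero it forces \<alpha> to be constantly m; behind a
      positive digit the reflected tail would be \<alpha>, of value 1.\<close>
    have "lex_less (reflection m \<alpha>) (shift i \<alpha>)" for i
    proof (rule ccontr)
      assume "\<not> lex_less (reflection m \<alpha>) (shift i \<alpha>)"
      then have eq: "shift i \<alpha> = reflection m \<alpha>"
        using admissible_lower[OF adm, of i] lex_linear by blast
      show False
      proof (cases i)
        case 0
        then have "\<alpha> 0 = m - \<alpha> 0" using fun_cong[OF eq, of 0] by simp
        then have "0 < \<alpha> 0" "\<alpha> 0 < m" using m digitsD[OF d, of 0] by linarith+
        then have "real m / (q - 1) < 2"
          using univoque_upper[OF u, of 0] univoque_lower[OF u, of 0]
            val_reflection[OF q(1) digits_shift[OF d, of 1]] by simp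
        moreover have "1 = real m / (q - 1) - 1" using val_reflection[OF q(1) d] eq 0 v by simp
        ultimately show False by simp
      next
        case (Suc j)
        show False
        proof (cases "\<alpha> j = 0")
          case True
          have "\<not> lex_less \<alpha> (reflection m (shift j \<alpha>))"
            using admissible_lower[OF adm, of j] lex_reflection_right[OF d digits_shift[OF d, of j]] by simp
          moreover have "reflection m (shift j \<alpha>) 0 = m" using True by simp
          moreover have "shift 1 (reflection m (shift j \<alpha>)) = \<alpha>"
            using eq Suc d by (simp add: shift_reflection del: shift_apply reflection_apply)
          ultimately have "\<alpha> = (\<lambda>_. m)" by (rule eq_const_max[OF d])
          with False show False ..
        next
          case False
          then have "val q (reflection m (shift i \<alpha>)) < 1" using univoque_lower[OF u, of j] Suc by simp
          then show False using eq d v by simp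
        qed
      qed
    qed
    then show ?thesis using islimpt_U[OF q(1) adm v] by blast
  qed
qed

lemma U_subset_B2_derived:
  assumes "1 \<le> m" shows "\<U> m \<subseteq> B2_derived m i"
proof (induction i)
  case 0
  show ?case using univoque_one_in_B2 by (auto simp: U_iff)
next
  case (Suc i)
  then show ?case
    using U_imp_islimpt[OF assms] islimpt_subset[OF _ Suc] by (auto simp: U_iff base_interval_def)
qed

lemma B2_derived_2:
  "B2_derived m 2 = {q \<in> base_interval m. q islimpt {q \<in> base_interval m. q islimpt B2 m}}"
  by (simp add: numeral_2_eq_2)

lemma admissible_in_B2:
  assumes q: "1 < q" "q \<le> real m + 1" and m: "1 \<le> m" and adm: "admissible m \<alpha>" and v: "val q \<alpha> = 1"
    and G: "q \<noteq> \<G> m"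
  shows "q \<in> B2 m" "q \<in> B2_derived m 2"
proof -
  have "q \<in> B2 m \<and> q \<in> B2_derived m 2"
  proof (cases "\<forall>i. lex_less (reflection m \<alpha>) (shift i \<alpha>)")
    case True
    have "q islimpt B2_derived m 1"
      using islimpt_U[OF q(1) adm v] True islimpt_subset[OF _ U_subset_B2_derived[OF m]] by blast
    then show ?thesis
      using admissible_strict_in_B2[OF q adm v] True q by (auto simp: B2_derived_2 base_interval_def)
  next
    case False
    then obtain n where "antiperiodic m n \<alpha> q" using antiperiodic_exists[OF q(1) m adm v _ G] by blast
    then show ?thesis
      using antiperiodic.q_in_B2 antiperiodic.q_islimpt_derived q
      by (auto simp: B2_derived_2 base_interval_def)
  qed
  then show "q \<in> B2 m" "q \<in> B2_derived m 2" by auto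
qed

lemma V_subset_B2_derived:
  assumes "1 \<le> m" shows "\<V> m - {\<G> m} \<subseteq> B2_derived m 2"
proof
  fix q assume "q \<in> \<V> m - {\<G> m}"
  then have q: "1 < q" "q \<le> real m + 1" "1 \<in> Vq m q" "q \<noteq> \<G> m"
    by (auto simp: \<V>_def base_interval_def)
  show "q \<in> B2_derived m 2"
  proof (cases "q = real m + 1")
    case True
    then have "val q (\<lambda>_. m) = 1" using val_max_eq_one[OF q(1)] by simp
    then show ?thesis by (rule admissible_in_B2(2)[OF q(1,2) assms admissible_max[OF assms] _ q(4)])
  next
    case False
    then have q': "q < real m + 1" using q by simp
    obtain c where c: "weakly_univoque m q c" "doubly_infinite m c" "val q c = 1"
      by (rule Vq_one_imp_weakly_univoque[OF q(1) q' q(3)])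
    then show ?thesis
      using admissible_in_B2(2)[OF q(1,2) assms weakly_univoque_imp_admissible[OF q(1) c] c(3) q(4)]
      by blast
  qed
qed

section \<open>Closedness of \<open>B2 m\<close> away from \<open>\<G> m\<close>\<close>

lemma B2_bound:
  assumes "q \<in> B2 m" shows "1 < q" "q \<le> real m + 1" "real m / (q - 1) < 2"
proof -
  show q: "1 < q" "q \<le> real m + 1" using assms by (auto simp: B2_def base_interval_def)
  then obtain c d where cd: "univoque m q c" "univoque m q d" "1 + val q c = val q d"
    using B2_iff assms by blast
  show "real m / (q - 1) < 2"
  proof (rule ccontr)
    assume n: "\<not> ?thesis"
    \<comment> \<open>Constant sequences only have the values 0 and m / (q - 1), whose difference is
      not 1 here.\<close>
    then have "c = (\<lambda>_. 0) \<or> c = (\<lambda>_. m)" "d = (\<lambda>_. 0) \<or> d = (\<lambda>_. m)"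
      using univoque_nonconstant[OF q(1)] cd by blast+
    then show False using cd(3) val_const[OF q(1), of m] n by auto
  qed
qed

lemma weakly_univoque_limit:
  fixes Q :: "nat \<Rightarrow> real"
  assumes Q: "Q \<longlonglongrightarrow> q" "1 < q" and c: "\<And>i. eventually (\<lambda>n. C n i = c i) sequentially" "digits m c"
    and u: "\<And>n. univoque m (Q n) (C n)"
  shows "weakly_univoque m q c"
  unfolding weakly_univoque_def
proof (intro conjI allI impI)
  fix i
  note dC = univoque_digits[OF u]
  have ev: "eventually (\<lambda>n. shift (Suc i) (C n) j = shift (Suc i) c j) sequentially" for j
    using c(1) by simp
  have ev': "eventually (\<lambda>n. reflection m (shift (Suc i) (C n)) j = reflection m (shift (Suc i) c) j) sequentially" for j
    using ev[of j] by eventually_elim simp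
  show "val q (shift (Suc i) c) \<le> 1" if "c i < m"
  proof (rule tendsto_upperbound)
    show "(\<lambda>n. val (Q n) (shift (Suc i) (C n))) \<longlonglongrightarrow> val q (shift (Suc i) c)"
      by (rule tendsto_val[OF Q ev digits_shift[OF dC]])
    show "\<forall>\<^sub>F n in sequentially. val (Q n) (shift (Suc i) (C n)) \<le> 1"
      using c(1)[of i] by eventually_elim (use that univoque_upper[OF u] in \<open>auto intro: less_imp_le\<close>)
  qed simp
  show "val q (reflection m (shift (Suc i) c)) \<le> 1" if "0 < c i"
  proof (rule tendsto_upperbound)
    show "(\<lambda>n. val (Q n) (reflection m (shift (Suc i) (C n)))) \<longlonglongrightarrow> val q (reflection m (shift (Suc i) c))"
      by (rule tendsto_val[OF Q ev' digits_reflection])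
    show "\<forall>\<^sub>F n in sequentially. val (Q n) (reflection m (shift (Suc i) (C n))) \<le> 1"
      using c(1)[of i] by eventually_elim (use that univoque_lower[OF u] in \<open>auto intro: less_imp_le\<close>)
  qed simp
qed (rule c(2))

lemma weakly_univoque_not_univoque:
  assumes q: "1 < q" "q < real m + 1" and w: "weakly_univoque m q c" "\<not> univoque m q c"
  shows "\<exists>\<alpha>. admissible m \<alpha> \<and> val q \<alpha> = 1"
proof -
  obtain n where "val q (shift (Suc n) c) = 1 \<or> val q (reflection m (shift (Suc n) c)) = 1"
    using w unfolding weakly_univoque_def univoque_def by (meson antisym not_le)
  then show ?thesis
    using weakly_univoque_one_admissible[OF q] weakly_univoque_shift[OF w(1)]
      weakly_univoque_reflection by blast
qed

lemma B2_sequence_limit: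
  fixes Q :: "nat \<Rightarrow> real"
  assumes m: "1 \<le> m" and Q: "\<And>n. Q n \<in> B2 m" "Q \<longlonglongrightarrow> q" and G: "q \<noteq> \<G> m"
  shows "q \<in> B2 m"
proof -
  note QB = B2_bound[OF Q(1)]
  \<comment> \<open>This keeps the limit away from 1, where \<open>base_interval m\<close> is
    open.\<close>
  have "1 + real m / 2 \<le> Q n" for n using QB(3)[of n] QB(1)[of n] by (simp add: field_simps)
  then have "1 + real m / 2 \<le> q" by (intro LIMSEQ_le_const[OF Q(2)]) auto
  then have q1: "1 < q" using m by simp
  have q2: "q \<le> real m + 1" using QB(2) by (intro LIMSEQ_le_const2[OF Q(2)]) auto
  have "\<exists>c d. univoque m (Q n) c \<and> univoque m (Q n) d \<and> 1 + val (Q n) c = val (Q n) d" for n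
    using B2_iff[OF QB(1,2)] Q(1) by blast
  then obtain C D where CD: "\<And>n. univoque m (Q n) (C n)" "\<And>n. univoque m (Q n) (D n)"
    "\<And>n. 1 + val (Q n) (C n) = val (Q n) (D n)" by metis
  obtain c r where c: "strict_mono r" "digits m c" "\<And>i. eventually (\<lambda>n. C (r n) i = c i) sequentially"
    by (rule digits_convergent_subseq[of m C, OF univoque_digits[OF CD(1)]]) (rule that)
  obtain d s where d: "strict_mono s" "digits m d" "\<And>i. eventually (\<lambda>n. D (r (s n)) i = d i) sequentially"
    by (rule digits_convergent_subseq[of m "\<lambda>n. D (r n)", OF univoque_digits[OF CD(2)]]) (rule that)
  have c': "eventually (\<lambda>n. C (r (s n)) i = c i) sequentially" for i
    using eventually_compose_filterlim[OF c(3)[of i] filterlim_subseq[OF d(1)]] .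
  have Q': "(\<lambda>n. Q (r (s n))) \<longlonglongrightarrow> q"
    using LIMSEQ_subseq_LIMSEQ[OF Q(2) strict_mono_o[OF c(1) d(1)]] by (simp add: comp_def)
  have w: "weakly_univoque m q c" "weakly_univoque m q d"
    by (rule weakly_univoque_limit[OF Q' q1 c' c(2) CD(1)],
        rule weakly_univoque_limit[OF Q' q1 d(3) d(2) CD(2)])
  have "(\<lambda>n. 1 + val (Q (r (s n))) (C (r (s n)))) \<longlonglongrightarrow> 1 + val q c"
    by (intro tendsto_intros tendsto_val[OF Q' q1 c' univoque_digits[OF CD(1)]])
  moreover have "(\<lambda>n. 1 + val (Q (r (s n))) (C (r (s n)))) \<longlonglongrightarrow> val q d"
    unfolding CD(3) by (rule tendsto_val[OF Q' q1 d(3) univoque_digits[OF CD(2)]])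
  ultimately have eq: "1 + val q c = val q d" by (rule LIMSEQ_unique)
  show ?thesis
  proof (cases "univoque m q c \<and> univoque m q d")
    case True
    then show ?thesis using eq B2_iff[OF q1 q2] by blast
  next
    case False
    show ?thesis
    proof (cases "q = real m + 1")
      case True
      then show ?thesis using m_plus_one_in_B2[OF m] by simp
    next
      case neq: False
      then obtain \<alpha> where "admissible m \<alpha>" "val q \<alpha> = 1"
        using weakly_univoque_not_univoque[OF q1 _ w(1)] weakly_univoque_not_univoque[OF q1 _ w(2)]
          False q2 by fastforce
      then show ?thesis by (rule admissible_in_B2(1)[OF q1 q2 m _ _ G])
    qed
  qed
qed

section \<open>Finiteness below the smallest accumulation point\<close>

definition periodic_tail :: "nat \<Rightarrow> (nat \<Rightarrow> nat) \<Rightarrow> bool" where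
  "periodic_tail L c \<longleftrightarrow> (\<forall>i\<ge>L. c (i + 2) = c i)"

lemma periodic_tail_mono: "periodic_tail L c \<Longrightarrow> L \<le> L' \<Longrightarrow> periodic_tail L' c"
  by (simp add: periodic_tail_def)

lemma finite_periodic_tail: "finite {c. digits m c \<and> periodic_tail L c}"
proof (rule finite_imageD)
  show "finite ((\<lambda>c. map c [0..<L + 2]) ` {c. digits m c \<and> periodic_tail L c})"
    by (rule finite_subset[OF _ finite_lists_length_eq[of "{..m}" "L + 2"]])
       (auto simp: digits_def)
  show "inj_on (\<lambda>c. map c [0..<L + 2]) {c. digits m c \<and> periodic_tail L c}"
  proof (rule inj_onI)
    fix c d
    assume cd: "c \<in> {c. digits m c \<and> periodic_tail L c}" "d \<in> {c. digits m c \<and> periodic_tail L c}"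
      "map c [0..<L + 2] = map d [0..<L + 2]"
    have small: "c i = d i" if "i < L + 2" for i
      using arg_cong[OF cd(3), of "\<lambda>xs. xs ! i"] that by (simp del: upt_Suc add_2_eq_Suc')
    have "c i = d i" for i
    proof (induction i rule: less_induct)
      case (less i)
      show ?case
      proof (cases "i < L + 2")
        case False
        define j where "j = i - 2"
        have "i = j + 2" "L \<le> j" using False by (auto simp: j_def)
        then show ?thesis using cd less[of j] by (auto simp: periodic_tail_def)
      qed (rule small)
    qed
    then show "c = d" by blast
  qed
qed

lemma val_periodic:
  assumes q: "1 < q" and d: "digits m c" and p: "periodic_tail L c"
  shows "(1 - (1 / q)\<^sup>2) * val q c = (1 - (1 / q)\<^sup>2) * (\<Sum>i<L. real (c i) * (1 / q) ^ Suc i)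
    + (1 / q) ^ L * (real (c L) * (1 / q) + real (c (L + 1)) * (1 / q)\<^sup>2)"
proof -
  define z where "z = 1 / q"
  define y where "y = val q (shift L c)"
  have "shift 2 (shift L c) = shift L c"
    using p by (auto simp: periodic_tail_def fun_eq_iff add.commute)
  then have "y = head q 2 (shift L c) + y * z\<^sup>2"
    using val_split[OF q digits_shift[OF d, of L], of 2] by (simp add: y_def z_def power_divide)
  moreover have "head q 2 (shift L c) = real (c L) * z + real (c (L + 1)) * z\<^sup>2"
    by (simp add: head_def numeral_2_eq_2 z_def)
  ultimately have y: "(1 - z\<^sup>2) * y = real (c L) * z + real (c (L + 1)) * z\<^sup>2"
    by (simp add: algebra_simps)
  have "val q c = head q L c + y * z ^ L"
    using val_split[OF q d, of L] by (simp add: y_def z_def power_divide)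
  moreover have "head q L c = (\<Sum>i<L. real (c i) * z ^ Suc i)"
    by (simp add: head_def z_def power_divide)
  ultimately have "(1 - z\<^sup>2) * val q c = (1 - z\<^sup>2) * (\<Sum>i<L. real (c i) * z ^ Suc i) + z ^ L * ((1 - z\<^sup>2) * y)"
    by (simp only: algebra_simps)
  then show ?thesis unfolding y unfolding z_def .
qed

text \<open>Multiplied by \<open>1 - z\<^sup>2\<close>, the equation becomes polynomial in \<open>z = 1 / q\<close>, with constant term \<open>1\<close>.\<close>

lemma finite_solutions:
  assumes "digits m c" "digits m d" "periodic_tail L c" "periodic_tail L d"
  shows "finite {q. 1 < q \<and> 1 + val q c = val q d}"
proof -
  define p :: "real poly" where "p = [:1, 0, -1:] * (1 + (\<Sum>i<L. monom (real (c i) - real (d i)) (Suc i)))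
    + monom 1 L * [:0, real (c L) - real (d L), real (c (L + 1)) - real (d (L + 1)):]"
  have "poly p 0 = 1" by (simp add: p_def poly_monom poly_sum power_0_left)
  then have "p \<noteq> 0" by auto
  then have fin: "finite {z. poly p z = 0}" by (rule poly_roots_finite)
  have "poly p (1 / q) = 0" if q: "1 < q" "1 + val q c = val q d" for q
  proof -
    define z where "z = 1 / q"
    have "poly p z = (1 - z\<^sup>2) * (1 + (\<Sum>i<L. (real (c i) - real (d i)) * z ^ Suc i))
        + z ^ L * ((real (c L) - real (d L)) * z + (real (c (L + 1)) - real (d (L + 1))) * z\<^sup>2)"
      by (simp add: p_def poly_monom poly_sum power2_eq_square algebra_simps)
    also have "\<dots> = (1 - z\<^sup>2) * (1 + val q c - val q d)"
      using val_periodic[OF q(1) assms(1,3), folded z_def] val_periodic[OF q(1) assms(2,4), folded z_def]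
      by (simp only: algebra_simps sum_subtractf)
    finally show ?thesis using q by (simp add: z_def)
  qed
  then have "{q. 1 < q \<and> 1 + val q c = val q d} \<subseteq> (\<lambda>z. 1 / z) ` {z. poly p z = 0}"
    by (force intro!: image_eqI[where x = "1 / _"])
  then show ?thesis using fin finite_subset by blast
qed

text \<open>One L must serve all bases at once. The constant 3 / 2 is a lower bound for bases with m
  / (q - 1) < 2 and m \<ge> 1, and 2 bounds the value of any tail.\<close>

lemma leading_zeros_bounded:
  assumes "(0::real) < \<delta>"
  obtains L where "\<And>q c l. 3 / 2 \<le> q \<Longrightarrow> real m / (q - 1) < 2 \<Longrightarrow> digits m c \<Longrightarrow> \<delta> \<le> val q c \<Longrightarrow>
    (\<And>i. i < l \<Longrightarrow> c i = 0) \<Longrightarrow> l \<le> L"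
proof -
  obtain L where L: "2 / \<delta> < (3 / 2 :: real) ^ L" using real_arch_pow[of "3 / 2"] by auto
  show ?thesis
  proof (rule that[of L], rule ccontr)
    fix q :: real and c l
    assume q: "3 / 2 \<le> q" "real m / (q - 1) < 2" and d: "digits m c" and v: "\<delta> \<le> val q c"
      and z: "\<And>i. i < l \<Longrightarrow> c i = 0" and "\<not> l \<le> L"
    then have l: "L \<le> l" by simp
    have q1: "1 < q" using q by simp
    have "head q l c = 0" using z by (simp add: head_def)
    then have "val q c = val q (shift l c) / q ^ l" using val_split[OF q1 d, of l] by simp
    also have "\<dots> \<le> 2 / q ^ l"
      using val_le[OF q1 digits_shift[OF d, of l]] q by (intro divide_right_mono) auto
    also have "\<dots> \<le> 2 / (3 / 2) ^ L"
    proof (rule divide_left_mono)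
      have "(3 / 2) ^ L \<le> (3 / 2 :: real) ^ l" using l by (intro power_increasing) auto
      also have "\<dots> \<le> q ^ l" using q by (intro power_mono) auto
      finally show "(3 / 2) ^ L \<le> q ^ l" .
    qed (use q1 in auto)
    also have "\<dots> < \<delta>" using L assms by (simp add: field_simps)
    finally show False using v by simp
  qed
qed

text \<open>Behind a positive digit the reflected tail is below 1, so the tail itself exceeds m / (q
  - 1) - 1.\<close>

lemma univoque_val_gt:
  assumes q: "1 < q" and u: "univoque m q c" and c: "0 < c n" "j \<le> c n"
  shows "(real j + (real m / (q - 1) - 1)) / q < val q (shift n c)"
proof -
  note d = univoque_digits[OF u]
  have "real m / (q - 1) - val q (shift (Suc n) c) < 1"
    using univoque_lower[OF u c(1)] val_reflection[OF q digits_shift[OF d]] by simp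
  then have "real j + (real m / (q - 1) - 1) < real (c n) + val q (shift (Suc n) c)" using c by simp
  then show ?thesis unfolding val_step[OF q d, of n] using q by (intro divide_strict_right_mono) auto
qed

text \<open>Reflection exchanges the two members of a pair, so each statement about c yields one
  about d.\<close>

lemma pair_reflection:
  assumes "1 < q" "univoque m q c" "univoque m q d" "1 + val q c = val q d"
  shows "1 + val q (reflection m d) = val q (reflection m c)"
  using assms(4) val_reflection[OF assms(1) univoque_digits[OF assms(2)]]
    val_reflection[OF assms(1) univoque_digits[OF assms(3)]] by linarith

text \<open>The equation leaves c a value of at most m / (q - 1) - 1, too little for a univoque c
  with a larger first digit.\<close>

lemma pair_head_le:
  assumes q: "1 < q" "real m / (q - 1) < 2" and u: "univoque m q c" "univoque m q d"
    and eq: "1 + val q c = val q d"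
  shows "c 0 \<le> m div 2"
proof (rule ccontr)
  define K where "K = real m / (q - 1)"
  have K: "K * (q - 1) = m" using q by (simp add: K_def)
  assume "\<not> c 0 \<le> m div 2"
  then have "(real (m div 2 + 1) + (K - 1)) / q < val q c"
    using univoque_val_gt[OF q(1) u(1), of 0 "m div 2 + 1"] by (simp add: K_def)
  also have "\<dots> \<le> K - 1" using eq val_le[OF q(1) univoque_digits[OF u(2)]] by (simp add: K_def)
  finally have "real (m div 2) + K < K * q - q" using q by (simp add: field_simps)
  then have "q < real m - real (m div 2)" using K by (simp add: algebra_simps)
  moreover have "real m < 2 * (q - 1)" using q by (simp add: field_simps)
  moreover have "real m - real (m div 2) \<le> real m / 2 + 1"
  proof -
    have "m \<le> 2 * (m div 2) + 1" by linarith
    then have "real m \<le> real (2 * (m div 2) + 1)" by (rule of_nat_mono)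
    then have "real m \<le> 2 * real (m div 2) + 1" by (simp only: of_nat_add of_nat_mult of_nat_numeral of_nat_1)
    then show ?thesis by linarith
  qed
  ultimately show False by simp
qed

section \<open>The polynomial of \<open>q_f m\<close> and the digits it forces\<close>

definition q_f_poly :: "nat \<Rightarrow> real \<Rightarrow> real" where
  "q_f_poly m q = (let k = real (m div 2) in
     if even m then q ^ 2 - (k + 1) * q - k else q ^ 3 - (k + 2) * q ^ 2 + q - k - 1)"

lemma q_f_poly_props:
  assumes m: "1 \<le> m"
  shows "1 < q_f m" "q_f_poly m (q_f m) = 0"
    "\<And>q. 1 < q \<Longrightarrow> q < q_f m \<Longrightarrow> q_f_poly m q < 0"
    "\<And>q. q_f m < q \<Longrightarrow> 0 < q_f_poly m q"
proof -
  define k where "k = real (m div 2)"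
  have k0: "0 \<le> k" by (simp add: k_def)
  have "continuous_on {1..k + 2} (q_f_poly m)"
    unfolding q_f_poly_def Let_def by (cases "even m"; simp only: if_True if_False; intro continuous_intros)
  moreover have neg: "q_f_poly m 1 < 0"
    using m by (auto simp: q_f_poly_def Let_def elim!: evenE)
  moreover have "0 < q_f_poly m (k + 2)"
    using k0 by (auto simp: q_f_poly_def Let_def k_def[symmetric] power2_eq_square power3_eq_cube algebra_simps)
  ultimately obtain r where r: "1 \<le> r" "q_f_poly m r = 0"
    using IVT'[of "q_f_poly m" 1 0 "k + 2"] k0 by auto
  have r1: "1 < r" using r neg by (cases "r = 1") auto
  have sign: "(q < r \<longrightarrow> q_f_poly m q < 0) \<and> (r < q \<longrightarrow> 0 < q_f_poly m q)" if q: "1 < q" for q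
  proof (cases "even m")
    case True
    then have P: "q_f_poly m x = x ^ 2 - (k + 1) * x - k" for x by (simp add: q_f_poly_def Let_def k_def)
    have "r * (r - (k + 1)) = k" using r P by (simp add: power2_eq_square algebra_simps)
    then have "k + 1 \<le> r" using k0 r1 by (smt (verit) mult_pos_neg)
    moreover have "q_f_poly m q = (q - r) * (q + r - (k + 1))"
      using r P[of r] by (simp add: P power2_eq_square algebra_simps)
    ultimately show ?thesis using q by (auto simp: mult_neg_pos)
  next
    case False
    \<comment> \<open>The cubic divided by x^2 is strictly increasing for x > 1, which leaves a
      single sign change.\<close>
    define g where "g x = x - (k + 2) + 1 / x - (k + 1) / x ^ 2" for x :: real
    have P: "q_f_poly m x = x ^ 2 * g x" if "1 < x" for x
      using False that by (simp add: q_f_poly_def Let_def k_def[symmetric] g_def field_simps power2_eq_square power3_eq_cube)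
    have mono: "g x < g y" if "1 < x" "x < y" for x y
    proof -
      have xy: "1 * 1 < x * y" using that by (intro mult_strict_mono) auto
      have "1 / x - 1 / y = (y - x) / (x * y)" using that by (simp add: field_simps)
      also have "\<dots> < y - x"
      proof -
        have "(y - x) * 1 < (y - x) * (x * y)" using that xy by (intro mult_strict_left_mono) auto
        then show ?thesis using xy by (subst pos_divide_less_eq) auto
      qed
      finally have "x + 1 / x < y + 1 / y" by simp
      moreover have "(k + 1) / y ^ 2 \<le> (k + 1) / x ^ 2"
        using that k0 by (intro divide_left_mono power_mono) auto
      ultimately show ?thesis by (simp add: g_def)
    qed
    have "g r = 0" using r P[OF r1] r1 by simp
    then show ?thesis using P[OF q] mono[of q r] mono[of r q] q r1
      by (auto simp: mult_pos_neg)
  qed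
  have "q_f m = r"
  proof (cases "even m")
    case True
    have "{q. q ^ 2 - (k + 1) * q - k = 0} = {q. poly [:-k, -(k + 1), 1:] q = 0}"
      by (auto simp: power2_eq_square algebra_simps)
    then have "finite {q. q ^ 2 - (k + 1) * q - k = 0}" by (simp only:) (rule poly_roots_finite, simp)
    moreover have "q_f_poly m q = q ^ 2 - (k + 1) * q - k" for q
      using True by (simp add: q_f_poly_def Let_def k_def)
    then have "{q. q ^ 2 - (k + 1) * q - k = 0} = {q. q_f_poly m q = 0}" by simp
    moreover have "q \<le> r" if "q_f_poly m q = 0" for q
      using sign[of q] r1 that by (cases "1 < q") auto
    ultimately have "Max {q. q ^ 2 - (k + 1) * q - k = 0} = r"
      using r by (intro Max_eqI) auto
    then show ?thesis using True by (simp add: q_f_def Let_def k_def)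
  next
    case False
    have "{q. q ^ 3 - (k + 2) * q ^ 2 + q - k - 1 = 0} = {q. poly [:-k - 1, 1, -(k + 2), 1:] q = 0}"
      by (auto simp: power2_eq_square power3_eq_cube algebra_simps)
    then have "finite {q. q ^ 3 - (k + 2) * q ^ 2 + q - k - 1 = 0}" by (simp only:) (rule poly_roots_finite, simp)
    moreover have "q_f_poly m q = q ^ 3 - (k + 2) * q ^ 2 + q - k - 1" for q
      using False by (simp add: q_f_poly_def Let_def k_def)
    then have "{q. q ^ 3 - (k + 2) * q ^ 2 + q - k - 1 = 0} = {q. q_f_poly m q = 0}" by simp
    moreover have "q \<le> r" if "q_f_poly m q = 0" for q
      using sign[of q] r1 that by (cases "1 < q") auto
    ultimately have "Max {q. q ^ 3 - (k + 2) * q ^ 2 + q - k - 1 = 0} = r"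
      using r by (intro Max_eqI) auto
    then show ?thesis using False by (simp add: q_f_def Let_def k_def)
  qed
  then show "1 < q_f m" "q_f_poly m (q_f m) = 0"
    "\<And>q. 1 < q \<Longrightarrow> q < q_f m \<Longrightarrow> q_f_poly m q < 0"
    "\<And>q. q_f m < q \<Longrightarrow> 0 < q_f_poly m q" using r r1 sign by auto
qed

text \<open>A larger digit would give a tail above (k + m / (q - 1)) / q, with k = m / 2, and this
  exceeds 1 exactly when the quadratic is negative.\<close>

lemma univoque_next_le_even:
  assumes q: "1 < q" "q_f_poly m q < 0" and m: "even m" and u: "univoque m q c" and c: "c n < m"
  shows "c (Suc n) \<le> m div 2"
proof (rule ccontr)
  define k where "k = real (m div 2)"
  have mk: "real m = 2 * k" using m by (auto simp: k_def)
  assume "\<not> c (Suc n) \<le> m div 2"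
  then have "(real (m div 2 + 1) + (real m / (q - 1) - 1)) / q < val q (shift (Suc n) c)"
    by (intro univoque_val_gt[OF q(1) u]) auto
  also have "\<dots> < 1" by (rule univoque_upper[OF u c])
  finally have "k + real m / (q - 1) < q" using q by (simp add: k_def)
  then have "k * (q - 1) + 2 * k < q * (q - 1)" using q mk by (simp add: field_simps)
  then show False using q(2) m by (simp add: q_f_poly_def Let_def k_def[symmetric] power2_eq_square algebra_simps)
qed

text \<open>The second inequality is negativity of the cubic divided by q (q - 1); the first is a
  weaker consequence. They exclude tails starting with a digit above k + 1, and tails starting with
  k + 1 and a digit above k, respectively.\<close>

lemma q_f_poly_odd:
  assumes q: "1 < q" "q_f_poly m q < 0" and m: "odd m"
  defines "k \<equiv> real (m div 2)" and "K \<equiv> real m / (q - 1)"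
  shows "q < k + 1 + K" "q < k + 1 + (k + K) / q"
proof -
  have mk: "real m = 2 * k + 1" using m by (auto simp: k_def elim!: oddE)
  have k0: "0 \<le> k" by (simp add: k_def)
  have K: "K * (q - 1) = 2 * k + 1" using q mk by (simp add: K_def)
  have P: "q * (q * (q - (k + 2))) < k + 1 - q"
    using q m by (simp add: q_f_poly_def Let_def k_def[symmetric] power2_eq_square power3_eq_cube algebra_simps)
  have "q * (q - (k + 2)) < k"
  proof (rule ccontr)
    assume "\<not> q * (q - (k + 2)) < k"
    then have "q * k \<le> q * (q * (q - (k + 2)))" using q by (intro mult_left_mono) auto
    moreover have "1 * k \<le> q * k" using q k0 by (intro mult_right_mono) auto
    ultimately show False using P q by linarith
  qed
  then have "q * (q - 1) < (k + 1 + K) * (q - 1)" using K by (simp add: algebra_simps)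
  then show "q < k + 1 + K" using q by simp
  have "(q * (q - 1)) * q < (k + 1) * (q - 1) * q + k * (q - 1) + K * (q - 1)"
    using P unfolding K by (simp add: algebra_simps)
  then have "(q * q) * (q - 1) < ((k + 1) * q + (k + K)) * (q - 1)" by (simp add: algebra_simps)
  then have "q * q < (k + 1) * q + (k + K)" using q by simp
  then show "q < k + 1 + (k + K) / q" using q by (simp add: field_simps)
qed

lemma univoque_next_le_odd:
  assumes q: "1 < q" "q_f_poly m q < 0" and m: "odd m" and u: "univoque m q c" and c: "c n < m"
  shows "c (Suc n) \<le> Suc (m div 2)"
    "c (Suc n) = Suc (m div 2) \<Longrightarrow> c (Suc (Suc n)) \<le> m div 2"
proof -
  define k where "k = real (m div 2)"
  define K where "K = real m / (q - 1)"
  note P = q_f_poly_odd[OF q m, folded k_def K_def]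
  note less = univoque_upper[OF u c]
  show "c (Suc n) \<le> Suc (m div 2)"
  proof (rule ccontr)
    assume "\<not> ?thesis"
    then have "(real (m div 2 + 2) + (K - 1)) / q < val q (shift (Suc n) c)"
      unfolding K_def by (intro univoque_val_gt[OF q(1) u]) auto
    with less have "(real (m div 2 + 2) + (K - 1)) / q < 1" by simp
    then show False using P(1) q by (simp add: k_def)
  qed
  assume s: "c (Suc n) = Suc (m div 2)"
  show "c (Suc (Suc n)) \<le> m div 2"
  proof (rule ccontr)
    assume "\<not> ?thesis"
    then have "(real (m div 2 + 1) + (K - 1)) / q < val q (shift (Suc (Suc n)) c)"
      unfolding K_def by (intro univoque_val_gt[OF q(1) u]) auto
    then have "(k + K) / q < val q (shift (Suc (Suc n)) c)" by (simp add: k_def)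
    moreover have "val q (shift (Suc n) c) = (k + 1 + val q (shift (Suc (Suc n)) c)) / q"
      using val_step[OF q(1) univoque_digits[OF u], of "Suc n"] s by (simp add: k_def)
    with less have "k + 1 + val q (shift (Suc (Suc n)) c) < q" using q by simp
    ultimately show False using P(2) by linarith
  qed
qed

lemma univoque_next_ge_odd:
  assumes q: "1 < q" "q_f_poly m q < 0" and m: "odd m" and u: "univoque m q c" and c: "0 < c n"
  shows "m div 2 \<le> c (Suc n)" "c (Suc n) = m div 2 \<Longrightarrow> Suc (m div 2) \<le> c (Suc (Suc n))"
proof -
  have m2: "m = 2 * (m div 2) + 1" using m by simp
  have d: "c i \<le> m" for i by (rule digitsD[OF univoque_digits[OF u]])
  have "reflection m c n < m" using c d[of n] by simp
  note * = univoque_next_le_odd[OF q m univoque_reflection[OF u] this]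
  show 1: "m div 2 \<le> c (Suc n)" using *(1) m2 d[of "Suc n"] by simp
  assume "c (Suc n) = m div 2"
  then have "reflection m c (Suc n) = Suc (m div 2)" using m2 by simp
  from *(2)[OF this] show "Suc (m div 2) \<le> c (Suc (Suc n))" using m2 d[of "Suc (Suc n)"] by simp
qed

text \<open>The predecessor is recorded because it decides which bound the next digits obey. From
  position n + 1 on, the two middle digits must then alternate.\<close>

definition alternating_from :: "nat \<Rightarrow> (nat \<Rightarrow> nat) \<Rightarrow> nat \<Rightarrow> bool" where
  "alternating_from m c n \<longleftrightarrow>
     c n < m \<and> c (Suc n) = Suc (m div 2) \<or> 0 < c n \<and> c (Suc n) = m div 2"

lemma alternating_from_Suc:
  assumes q: "1 < q" "q_f_poly m q < 0" and m: "odd m" and u: "univoque m q c"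
    and a: "alternating_from m c n"
  shows "alternating_from m c (Suc n)" "c (Suc (Suc n)) = m - c (Suc n)"
proof -
  have m2: "m = 2 * (m div 2) + 1" using m by simp
  have *: "alternating_from m c (Suc n) \<and> c (Suc (Suc n)) = m - c (Suc n)"
    using a unfolding alternating_from_def
  proof (elim disjE conjE)
    assume c: "c n < m" "c (Suc n) = Suc (m div 2)"
    then have "c (Suc (Suc n)) = m div 2"
      using univoque_next_le_odd(2)[OF q m u c] univoque_next_ge_odd(1)[OF q m u, of "Suc n"] by simp
    then show "(c (Suc n) < m \<and> c (Suc (Suc n)) = Suc (m div 2) \<or>
        0 < c (Suc n) \<and> c (Suc (Suc n)) = m div 2) \<and> c (Suc (Suc n)) = m - c (Suc n)"
      using c m2 by simp
  next
    assume c: "0 < c n" "c (Suc n) = m div 2"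
    have "m div 2 < m" using m2 by linarith
    then have "c (Suc (Suc n)) = Suc (m div 2)"
      using univoque_next_ge_odd(2)[OF q m u c] univoque_next_le_odd(1)[OF q m u, of "Suc n"] c by simp
    then show "(c (Suc n) < m \<and> c (Suc (Suc n)) = Suc (m div 2) \<or>
        0 < c (Suc n) \<and> c (Suc (Suc n)) = m div 2) \<and> c (Suc (Suc n)) = m - c (Suc n)"
      using c m2 \<open>m div 2 < m\<close> by simp
  qed
  then show "alternating_from m c (Suc n)" "c (Suc (Suc n)) = m - c (Suc n)" by auto
qed

lemma alternating_from_periodic:
  assumes q: "1 < q" "q_f_poly m q < 0" and m: "odd m" and u: "univoque m q c"
    and a: "alternating_from m c n"
  shows "periodic_tail (Suc n) c"
proof -
  have alt: "alternating_from m c (n + i)" for i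
    by (induction i) (use a alternating_from_Suc(1)[OF q m u] in auto)
  have "c (Suc n + i + 2) = c (Suc n + i)" for i
    using alternating_from_Suc(2)[OF q m u alt[of i]] alternating_from_Suc(2)[OF q m u alt[of "Suc i"]]
      digitsD[OF univoque_digits[OF u], of "Suc n + i"] by simp
  then show ?thesis unfolding periodic_tail_def by (metis le_Suc_ex)
qed

text \<open>Behind the first nonzero digit, the bounds for c and for its reflection squeeze the
  digits: for even m only m / 2 is left, for odd m only the alternation of the two middle
  digits.\<close>

lemma univoque_tail_structure:
  assumes q: "1 < q" "q_f_poly m q < 0" and m: "1 \<le> m" and u: "univoque m q c"
    and c0: "c 0 \<le> m div 2" and nz: "c \<noteq> (\<lambda>_. 0)"
  obtains l where "\<And>i. i < l \<Longrightarrow> c i = 0" "periodic_tail (Suc l) c"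
proof -
  define l where "l = (LEAST i. c i \<noteq> 0)"
  obtain i where "c i \<noteq> 0" using nz by blast
  then have cl: "c l \<noteq> 0" unfolding l_def by (rule LeastI)
  have z: "c i = 0" if "i < l" for i using not_less_Least[of i "\<lambda>i. c i \<noteq> 0"] that by (simp add: l_def)
  have "periodic_tail (Suc l) c"
  proof (cases "even m")
    case True
    then have m2: "m = 2 * (m div 2)" by simp
    have le: "c n \<le> m div 2" for n
    proof (induction n)
      case (Suc n)
      then have "c n < m" using m2 m by linarith
      then show ?case by (rule univoque_next_le_even[OF q True u])
    qed (rule c0)
    have "c (Suc l + i) = m div 2" for i
    proof -
      have ge: "m div 2 \<le> c (Suc n)" if "0 < c n" for n
      proof -
        have "reflection m c n < m" using that digitsD[OF univoque_digits[OF u], of n] by simp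
        from univoque_next_le_even[OF q True univoque_reflection[OF u] this]
        show ?thesis using m2 digitsD[OF univoque_digits[OF u], of "Suc n"] by simp
      qed
      have "0 < m div 2" using m2 m by linarith
      then have "0 < c (l + i)" for i
        by (induction i) (use cl ge in \<open>auto intro: less_le_trans\<close>)
      then show ?thesis using ge[of "l + i"] le[of "Suc l + i"] by simp
    qed
    note const = this
    show ?thesis unfolding periodic_tail_def
    proof (intro allI impI)
      fix i assume "Suc l \<le> i"
      then show "c (i + 2) = c i" using const[of "i - Suc l"] const[of "i + 2 - Suc l"] by simp
    qed
  next
    case False
    then have m2: "m = 2 * (m div 2) + 1" by simp
    show ?thesis
    proof (cases "c l < m")
      case True
      then have "alternating_from m c l"
        using univoque_next_le_odd(1)[OF q False u True] univoque_next_ge_odd(1)[OF q False u, of l] cl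
        by (auto simp: alternating_from_def)
      then show ?thesis by (rule alternating_from_periodic[OF q False u])
    next
      \<comment> \<open>The digit m follows a zero, so m \<le> m div 2 + 1 and hence m = 1; the
        alternation starts one place earlier.\<close>
      case max: False
      then have clm: "c l = m" using digitsD[OF univoque_digits[OF u], of l] by simp
      then obtain j where j: "l = Suc j" using c0 m2 by (cases l) auto
      have "c j < m" using z[of j] j m by simp
      then have "m \<le> Suc (m div 2)"
        using univoque_next_le_odd(1)[OF q False u, of j] clm j by simp
      then have "m = Suc (m div 2)" using m2 by linarith
      then have "alternating_from m c j" using \<open>c j < m\<close> clm j by (simp add: alternating_from_def)
      then show ?thesis
        using periodic_tail_mono[OF alternating_from_periodic[OF q False u], of j "Suc l"] j by simp
    qed
  qed
  then show ?thesis using that z by blast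
qed

text \<open>The bound for \<open>val q d\<close> given by the first digit of \<open>d\<close> if \<open>m\<close> is even and by the first two if
  \<open>m\<close> is odd; \<open>q_f m\<close> is the base in which it equals \<open>1\<close>.\<close>

definition pair_bound :: "nat \<Rightarrow> real \<Rightarrow> real" where
  "pair_bound m q = (let k = real (m div 2); K = real m / (q - 1) in
     if even m then (k + K) / q else (k + 1 + (k + K) / q) / q)"

lemma pair_bound_gt_one:
  assumes q: "1 < q" "q_f_poly m q < 0" shows "1 < pair_bound m q"
proof (cases "even m")
  case True
  define k where "k = real (m div 2)"
  have mk: "real m = 2 * k" using True by (auto simp: k_def)
  have "q * (q - 1) < k * (q - 1) + 2 * k"
    using q(2) True by (simp add: q_f_poly_def Let_def k_def[symmetric] power2_eq_square algebra_simps)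
  then have "q < k + real m / (q - 1)" using q mk by (simp add: field_simps)
  then show ?thesis using q True by (simp add: pair_bound_def Let_def k_def)
next
  case False
  then show ?thesis using q_f_poly_odd(2)[OF q False] q by (simp add: pair_bound_def Let_def)
qed

lemma pair_bound_antimono:
  assumes "1 < p" "p \<le> q" shows "pair_bound m q \<le> pair_bound m p"
proof -
  have "real m / (q - 1) \<le> real m / (p - 1)" using assms by (intro divide_left_mono) auto
  then show ?thesis using assms
    by (auto simp: pair_bound_def Let_def intro!: frac_le add_mono)
qed

lemma shift_two_fixed:
  assumes "periodic_tail 1 d" "d 2 = d 0" shows "shift 2 d = d"
proof
  fix i show "shift 2 d i = d i"
    using assms by (cases i) (auto simp: periodic_tail_def numeral_2_eq_2)
qed

text \<open>The smallest start that \<open>d0\<close> permits would make d constant or alternating;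
  d would then recur behind a digit below m with value at least 1, which \<open>univoque\<close>
  forbids. The next larger start gives the bound.\<close>

lemma univoque_pair_bound:
  assumes q: "1 < q" "q_f_poly m q < 0" and m: "1 \<le> m" and u: "univoque m q d"
    and d0: "m - d 0 \<le> m div 2" and v: "1 \<le> val q d"
  shows "pair_bound m q \<le> val q d"
proof (cases "even m")
  case True
  then have m2: "m = 2 * (m div 2)" by simp
  have k: "0 < m div 2" using m2 m by linarith
  have "d 0 \<noteq> m div 2"
  proof
    assume eq: "d 0 = m div 2"
    have "d n = m div 2" for n
    proof (induction n)
      case (Suc n)
      have "reflection m d n < m" "d n < m" using Suc k m2 by auto
      then have "m - d (Suc n) \<le> m div 2" "d (Suc n) \<le> m div 2"
        using univoque_next_le_even[OF q True u, of n]
          univoque_next_le_even[OF q True univoque_reflection[OF u], of n] by auto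
      then show ?case using m2 by linarith
    qed (rule eq)
    then have "shift 1 d = d" "d 0 < m" using k m2 by (auto simp: fun_eq_iff)
    then show False using univoque_upper[OF u, of 0] v by simp
  qed
  then have "Suc (m div 2) \<le> d 0" using d0 m2 by linarith
  then have "(real (Suc (m div 2)) + (real m / (q - 1) - 1)) / q < val q (shift 0 d)"
    by (intro univoque_val_gt[OF q(1) u]) auto
  then show ?thesis using True by (simp add: pair_bound_def Let_def)
next
  case False
  then have m2: "m = 2 * (m div 2) + 1" by simp
  define k where "k = real (m div 2)"
  define K where "K = real m / (q - 1)"
  have mk: "real m = 2 * k + 1" using False by (auto simp: k_def elim!: oddE)
  have pb: "pair_bound m q = (k + 1 + (k + K) / q) / q"
    using False by (simp add: pair_bound_def Let_def k_def K_def)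
  have ge: "Suc (m div 2) \<le> d 0" using d0 m2 by linarith
  note d = univoque_digits[OF u]
  show ?thesis
  proof (cases "d 0 = Suc (m div 2)")
    case True
    have "d 1 \<noteq> m div 2"
    proof
      assume d1: "d 1 = m div 2"
      have alt: "alternating_from m d 0" using True d1 by (simp add: alternating_from_def)
      have "d 2 = d 0"
        using alternating_from_Suc(2)[OF q False u alt] True d1 m2 by (simp add: numeral_2_eq_2)
      then have "shift 2 d = d"
        using alternating_from_periodic[OF q False u alt] by (intro shift_two_fixed) auto
      moreover have "d 1 < m" using d1 m2 by linarith
      ultimately show False using univoque_upper[OF u, of 1] v by (simp add: numeral_2_eq_2)
    qed
    then have "Suc (m div 2) \<le> d 1" using univoque_next_ge_odd(1)[OF q False u, of 0] True by simp
    then have "(real (Suc (m div 2)) + (real m / (q - 1) - 1)) / q < val q (shift 1 d)"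
      by (intro univoque_val_gt[OF q(1) u]) auto
    then have "(k + K) / q < val q (shift 1 d)" by (simp add: k_def K_def)
    then show ?thesis
      using val_step_0[OF q(1) d] True q by (simp add: pb k_def divide_right_mono)
  next
    case neq: False
    then have "Suc (Suc (m div 2)) \<le> d 0" using ge by simp
    then have "(real (Suc (Suc (m div 2))) + (real m / (q - 1) - 1)) / q < val q (shift 0 d)"
      by (intro univoque_val_gt[OF q(1) u]) auto
    then have "(k + 1 + K) / q < val q d" by (simp add: k_def K_def ac_simps)
    moreover have "K * (q - 1) = 2 * k + 1" using q mk by (simp add: K_def)
    then have "(k + K) / q \<le> K" using q by (simp add: field_simps k_def)
    then have "(k + 1 + (k + K) / q) / q \<le> (k + 1 + K) / q" using q by (intro divide_right_mono) auto
    ultimately show ?thesis unfolding pb by linarith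
  qed
qed

text \<open>Since \<open>pair_bound\<close> is decreasing in the base, \<open>val q c\<close> is at
  least \<open>pair_bound m b - 1 > 0\<close> for every q \<le> b. This bounds the leading zeros of
  c, hence its preperiod; reflection does the same for d.\<close>

lemma finite_B2_below:
  assumes m: "1 \<le> m" and b: "b < q_f m"
  shows "finite {q \<in> B2 m. q \<le> b}"
proof (cases "1 < b")
  case False
  then have "{q \<in> B2 m. q \<le> b} = {}" using B2_bound(1) by fastforce
  then show ?thesis by (simp only: finite.emptyI)
next
  case b1: True
  have neg: "q_f_poly m q < 0" if "1 < q" "q \<le> b" for q using q_f_poly_props(3)[OF m that(1)] that b by simp
  have "0 < pair_bound m b - 1" using pair_bound_gt_one[OF b1 neg[OF b1]] by simp
  then obtain L where L: "\<And>q c l. 3 / 2 \<le> q \<Longrightarrow> real m / (q - 1) < 2 \<Longrightarrow> digits m c \<Longrightarrow>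
      pair_bound m b - 1 \<le> val q c \<Longrightarrow> (\<And>i. i < l \<Longrightarrow> c i = 0) \<Longrightarrow> l \<le> L"
    using leading_zeros_bounded[of "pair_bound m b - 1" m] by metis
  have main: "periodic_tail (Suc L) c"
    if q: "q \<in> B2 m" "q \<le> b" and u: "univoque m q c" "univoque m q d" and eq: "1 + val q c = val q d"
    for q c d
  proof -
    note qb = B2_bound[OF q(1)]
    have "real m < 2 * (q - 1)" using qb by (simp add: field_simps)
    moreover have "1 \<le> real m" using m by simp
    ultimately have "1 < 2 * (q - 1)" by simp
    then have q32: "3 / 2 \<le> q" by simp
    have P: "q_f_poly m q < 0" by (rule neg[OF qb(1) q(2)])
    have c0: "c 0 \<le> m div 2" by (rule pair_head_le[OF qb(1,3) u eq])
    have d0: "m - d 0 \<le> m div 2"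
      using pair_head_le[OF qb(1,3) univoque_reflection[OF u(2)] univoque_reflection[OF u(1)]
          pair_reflection[OF qb(1) u eq]] by simp
    have "1 \<le> val q d" using eq val_nonneg[OF qb(1) univoque_digits[OF u(1)]] by simp
    then have "pair_bound m q \<le> val q d" by (rule univoque_pair_bound[OF qb(1) P m u(2) d0])
    then have vc: "pair_bound m b - 1 \<le> val q c"
      using pair_bound_antimono[OF qb(1) q(2), of m] eq by simp
    have "c \<noteq> (\<lambda>_. 0)" using vc \<open>0 < pair_bound m b - 1\<close> by auto
    then obtain l where l: "\<And>i. i < l \<Longrightarrow> c i = 0" "periodic_tail (Suc l) c"
      using univoque_tail_structure[OF qb(1) P m u(1) c0] by blast
    have "l \<le> L" by (rule L[OF q32 qb(3) univoque_digits[OF u(1)] vc l(1)])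
    then show ?thesis using l(2) periodic_tail_mono by blast
  qed
  define S where "S = {c. digits m c \<and> periodic_tail (Suc L) c}"
  have "{q \<in> B2 m. q \<le> b} \<subseteq> (\<Union>c\<in>S. \<Union>d\<in>S. {q. 1 < q \<and> 1 + val q c = val q d})"
  proof
    fix q assume "q \<in> {q \<in> B2 m. q \<le> b}"
    then have q: "q \<in> B2 m" "q \<le> b" by auto
    note qb = B2_bound[OF q(1)]
    obtain c d where u: "univoque m q c" "univoque m q d" and eq: "1 + val q c = val q d"
      using B2_iff[OF qb(1,2)] q(1) by blast
    have "periodic_tail (Suc L) (reflection m d)"
      by (rule main[OF q univoque_reflection[OF u(2)] univoque_reflection[OF u(1)]
            pair_reflection[OF qb(1) u eq]])
    then have "periodic_tail (Suc L) d"
      using digitsD[OF univoque_digits[OF u(2)]] unfolding periodic_tail_def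
      by (metis diff_diff_cancel reflection_apply)
    then have "c \<in> S" "d \<in> S" using main[OF q u eq] univoque_digits u by (auto simp: S_def)
    then show "q \<in> (\<Union>c\<in>S. \<Union>d\<in>S. {q. 1 < q \<and> 1 + val q c = val q d})" using qb(1) eq by blast
  qed
  moreover have "finite (\<Union>c\<in>S. \<Union>d\<in>S. {q. 1 < q \<and> 1 + val q c = val q d})"
    using finite_periodic_tail[of m "Suc L"] finite_solutions[of m _ _ "Suc L"]
    by (auto simp: S_def)
  ultimately show ?thesis by (rule finite_subset)
qed

section \<open>The position of \<open>q_f m\<close> and the expansion of one in it\<close>

lemma G_less_q_f:
  assumes m: "1 \<le> m" shows "\<G> m < q_f m"
proof -
  define k where "k = real (m div 2)"
  have k0: "0 \<le> k" by (simp add: k_def)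
  have "q_f_poly m (\<G> m) < 0 \<and> 1 < \<G> m"
  proof (cases "even m")
    case True
    then have "0 < m div 2" using m by (auto elim!: evenE)
    then have "0 < k" by (simp add: k_def)
    then show ?thesis
      using True by (simp add: q_f_poly_def \<G>_def Let_def k_def[symmetric] power2_eq_square algebra_simps)
  next
    case False
    define s where "s = sqrt (k ^ 2 + 6 * k + 5)"
    have s2: "s * s = k ^ 2 + 6 * k + 5" using k0 by (simp add: s_def)
    define g where "g = (k + 1 + s) / 2"
    have gg: "g * g = (k + 1) * g + (k + 1)" using s2 by (simp add: g_def power2_eq_square field_simps)
    have "k + 2 < s" using k0 by (auto simp: s_def power2_eq_square algebra_simps intro!: real_less_rsqrt)
    then have g1: "1 < g" using k0 by (simp add: g_def)
    have "k ^ 2 + 6 * k + 5 < (3 * k + 3) ^ 2"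
      using k0 by (simp add: power2_eq_square algebra_simps add_pos_nonneg)
    then have "s < 3 * k + 3" using k0 unfolding s_def by (intro real_less_lsqrt) auto
    then have "g < 2 * (k + 1)" using k0 by (simp add: g_def)
    have "g * (g * g) = g * ((k + 1) * g + (k + 1))" by (simp only: gg)
    then have "g ^ 3 = (k + 1) * (g * g) + (k + 1) * g" by (simp add: power3_eq_cube algebra_simps)
    \<comment> \<open>Reducing the cubic by the quadratic equation for g leaves g - 2 (k + 1), which
      is negative.\<close>
    then have "g ^ 3 - (k + 2) * g ^ 2 + g - k - 1 = g - 2 * (k + 1)"
      using gg by (simp add: power2_eq_square algebra_simps)
    then show ?thesis using False g1 \<open>g < 2 * (k + 1)\<close>
      by (simp add: q_f_poly_def \<G>_def Let_def k_def[symmetric] s_def[symmetric] g_def[symmetric])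
  qed
  then show ?thesis
    using q_f_poly_props(2,4)[OF m] by (metis less_asym less_irrefl linorder_neqE_linordered_idom)
qed

text \<open>These equations say that \<open>pair_bound m (q_f m) = 1\<close>.\<close>

lemma q_f_val_eq:
  assumes m: "1 \<le> m"
  defines "q \<equiv> q_f m" and "k \<equiv> real (m div 2)" and "K \<equiv> real m / (q_f m - 1)"
  shows "even m \<Longrightarrow> k + K = q" "odd m \<Longrightarrow> k + 1 + (k + K) / q = q"
proof -
  have q1: "1 < q" and P: "q_f_poly m q = 0" using q_f_poly_props[OF m] by (auto simp: q_def)
  have K: "K * (q - 1) = m" using q1 by (simp add: K_def q_def)
  show "k + K = q" if "even m"
  proof -
    have "real m = 2 * k" using that by (auto simp: k_def)
    then have "(k + K) * (q - 1) = q * (q - 1)"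
      using P K that by (simp add: q_f_poly_def Let_def k_def[symmetric] power2_eq_square algebra_simps)
    then show ?thesis using q1 by simp
  qed
  show "k + 1 + (k + K) / q = q" if "odd m"
  proof -
    have mk: "real m = 2 * k + 1" using that by (auto simp: k_def elim!: oddE)
    have P': "q * (q * q) - (k + 2) * (q * q) + q - k - 1 = 0"
      using P that by (simp add: q_f_poly_def Let_def k_def[symmetric] power2_eq_square power3_eq_cube)
    have "((k + 1) * q + (k + K)) * (q - 1) = (k + 1) * q * (q - 1) + k * (q - 1) + (2 * k + 1)"
      using K mk by (simp add: algebra_simps)
    also have "\<dots> = (q * q) * (q - 1)" using P' by (simp add: algebra_simps)
    finally have "(k + 1) * q + (k + K) = q * q" using q1 by simp
    then show ?thesis using q1 by (simp add: field_simps)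
  qed
qed

text \<open>The antiperiod is k + 1 for m = 2k, and (k + 1)(k + 1) for m = 2k + 1. For odd m this
  doubles the antiperiod k + 1 belonging to \<open>\<G> m\<close>: the word k + 1 is followed by its
  reflection k, raised by one.\<close>

lemma antiperiodic_q_f:
  assumes m: "1 \<le> m" shows "\<exists>n \<alpha>. antiperiodic m n \<alpha> (q_f m)"
proof -
  define q where "q = q_f m"
  define k where "k = m div 2"
  define K where "K = real m / (q - 1)"
  have q1: "1 < q" using q_f_poly_props[OF m] by (simp add: q_def)
  show ?thesis
  proof (cases "even m")
    case True
    then have m2: "m = 2 * k" and k: "0 < k" using m by (auto simp: k_def elim!: evenE)
    define \<alpha> where "\<alpha> i = (if even i then k + 1 else k - 1)" for i :: nat
    have d: "digits m \<alpha>" using m2 k by (auto simp: digits_def \<alpha>_def)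
    have r: "m - \<alpha> i = \<alpha> (Suc i)" for i using m2 k by (auto simp: \<alpha>_def)
    then have anti: "\<alpha> (1 + i) = m - \<alpha> i" for i by simp
    have shift: "shift j \<alpha> = (if even j then \<alpha> else reflection m \<alpha>)" for j
      using m2 k by (auto simp: fun_eq_iff \<alpha>_def)
    have lex: "lex_less (reflection m \<alpha>) \<alpha>"
      using k by (intro lex_lessI[of 0]) (auto simp: r, simp add: \<alpha>_def)
    have adm: "admissible m \<alpha>"
      unfolding admissible_def using d lex lex_asym[OF lex] lex_irrefl shift
      by (auto simp del: shift_apply reflection_apply)
    have "val q \<alpha> = (real (k + 1) + (K - val q \<alpha>)) / q"
      using val_step_0[OF q1 d] shift[of 1] val_reflection[OF q1 d] by (simp add: \<alpha>_def K_def)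
    then have "val q \<alpha> * (q + 1) = q + 1"
      using q_f_val_eq(1)[OF m True] q1 by (simp add: k_def q_def K_def field_simps)
    then have v: "val q \<alpha> = 1" using q1 by simp
    have good: "good m \<alpha> 1"
      using k unfolding good_def by (auto simp: lex_within_def r, simp add: \<alpha>_def)
    have neq: "\<exists>i<1. trunc_cycle 1 \<alpha> i \<noteq> m - \<alpha> i"
      using m2 k by (auto simp: trunc_cycle_def \<alpha>_def)
    have "antiperiodic m 1 \<alpha> q"
      by (rule antiperiodic.intro[OF q1 m adm v good anti neq])
    then show ?thesis unfolding q_def by blast
  next
    case False
    then have m2: "m = 2 * k + 1" by (simp add: k_def)
    define \<alpha> where "\<alpha> i = (if i mod 4 < 2 then k + 1 else k)" for i :: nat
    have d: "digits m \<alpha>" using m2 by (auto simp: digits_def \<alpha>_def)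
    have r: "m - \<alpha> i = \<alpha> (2 + i)" for i
    proof -
      have "(2 + i) mod 4 < 2 \<longleftrightarrow> \<not> i mod 4 < 2" by presburger
      then show ?thesis using m2 by (simp add: \<alpha>_def)
    qed
    have anti: "\<alpha> (2 + i) = m - \<alpha> i" for i using r by simp
    have per: "shift j \<alpha> = shift (j mod 4) \<alpha>" for j
    proof
      fix i
      have "(j + i) mod 4 = (j mod 4 + i) mod 4" by presburger
      then show "shift j \<alpha> i = shift (j mod 4) \<alpha> i" by (simp add: \<alpha>_def)
    qed
    have refl: "reflection m \<alpha> = shift 2 \<alpha>" by (auto simp: r)
    have a: "\<alpha> 0 = k + 1" "\<alpha> 1 = k + 1" "\<alpha> 2 = k" "\<alpha> 3 = k" "\<alpha> 4 = k + 1" "\<alpha> 5 = k + 1"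
      by (simp_all add: \<alpha>_def)
    have "\<not> lex_less \<alpha> (shift j \<alpha>) \<and> \<not> lex_less (shift j \<alpha>) (shift 2 \<alpha>)"
      if j: "j < 4" for j
    proof -
      have l1: "lex_less (shift 1 \<alpha>) \<alpha>" using a by (intro lex_lessI[of 1]) (auto simp: numeral_2_eq_2)
      have l2: "lex_less (shift 2 \<alpha>) \<alpha>" using a by (intro lex_lessI[of 0]) auto
      have l3: "lex_less (shift 3 \<alpha>) \<alpha>" using a by (intro lex_lessI[of 0]) auto
      have r1: "lex_less (shift 2 \<alpha>) (shift 1 \<alpha>)" using a by (intro lex_lessI[of 0]) auto
      have r3: "lex_less (shift 2 \<alpha>) (shift 3 \<alpha>)" using a by (intro lex_lessI[of 1]) auto
      consider "j = 0" | "j = 1" | "j = 2" | "j = 3" using j by linarith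
      then show ?thesis
        by cases (use l1 l2 l3 r1 r3 in \<open>simp_all add: lex_irrefl lex_asym del: shift_apply\<close>)
    qed
    then have adm: "admissible m \<alpha>"
      unfolding admissible_def refl using d per by (metis mod_less_divisor zero_less_numeral)
    have "val q \<alpha> = head q 2 \<alpha> + (K - val q \<alpha>) / q ^ 2"
      using val_split[OF q1 d, of 2] refl val_reflection[OF q1 d] by (simp add: K_def)
    moreover have "head q 2 \<alpha> = (real (k + 1)) / q + (real (k + 1)) / q ^ 2"
      using a by (simp add: head_def numeral_2_eq_2)
    ultimately have "val q \<alpha> = (real k + 1) / q + (real k + 1) / q ^ 2 + (K - val q \<alpha>) / q ^ 2"
      by (simp add: add.commute)
    also have "\<dots> = ((real k + 1) * q + (real k + 1) + (K - val q \<alpha>)) / (q * q)"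
      using q1 by (simp add: add_divide_distrib power2_eq_square)
    finally have "val q \<alpha> * (q * q) = (real k + 1) * q + (real k + 1) + (K - val q \<alpha>)"
      using q1 by (metis less_trans mult_eq_0_iff nonzero_eq_divide_eq not_less_iff_gr_or_eq zero_less_one)
    then have "val q \<alpha> * (q * q + 1) = (real k + 1) * q + (real k + K) + 1"
      by (simp add: algebra_simps)
    moreover have "(real k + 1) * q + (real k + K) = q * q"
      using q_f_val_eq(2)[OF m False] q1 by (simp add: k_def q_def K_def field_simps)
    ultimately have "val q \<alpha> * (q * q + 1) = 1 * (q * q + 1)" by simp
    moreover have "q * q + 1 \<noteq> 0" using q1 by (smt (verit) mult_pos_pos)
    ultimately have v: "val q \<alpha> = 1" by (metis mult_cancel_right)
    have good: "good m \<alpha> 2"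
      unfolding good_def
    proof (intro conjI allI impI)
      fix i :: nat assume "i < 2"
      then have "i = 0 \<or> i = 1" by linarith
      then show "lex_within (2 - i) (reflection m \<alpha>) (shift i \<alpha>)"
        using a m2 by (intro lex_withinI[of 0]) auto
    qed simp
    have neq: "\<exists>i<2. trunc_cycle 2 \<alpha> i \<noteq> m - \<alpha> i"
      by (rule trunc_cycle_neq_reflection[OF adm good]) simp
    have "antiperiodic m 2 \<alpha> q"
      by (rule antiperiodic.intro[OF q1 m adm v good anti neq])
    then show ?thesis unfolding q_def by blast
  qed
qed

section \<open>Minima of the derived sets, compactness and the closure of
  \<open>\<U> m\<close>\<close>

lemma q_f_in_B2_derived:
  assumes "1 \<le> m" shows "q_f m \<in> B2_derived m 2"
proof -
  obtain n \<alpha> where a: "antiperiodic m n \<alpha> (q_f m)" using antiperiodic_q_f[OF assms] by blast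
  then show ?thesis
    using antiperiodic.q_islimpt_derived[OF a] antiperiodic.q_less[OF a] antiperiodic.q[OF a]
    by (simp add: B2_derived_2 base_interval_def)
qed

lemma B2_derived_2_subset: "B2_derived m 2 \<subseteq> B2_derived m 1"
proof
  fix q assume "q \<in> B2_derived m 2"
  then have q: "q \<in> base_interval m" "q islimpt {q. q islimpt B2 m}"
    using islimpt_subset[of q "{q \<in> base_interval m. q islimpt B2 m}" "{q. q islimpt B2 m}"]
    by (auto simp: B2_derived_2)
  then have "q islimpt B2 m" using closed_limpts[of "B2 m"] by (auto simp: closed_limpt)
  then show "q \<in> B2_derived m 1" using q by simp
qed

lemma q_f_le_B2_derived:
  assumes "1 \<le> m" "q \<in> B2_derived m 1" shows "q_f m \<le> q"
proof (rule ccontr)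
  assume "\<not> q_f m \<le> q"
  then obtain b where b: "q < b" "b < q_f m" using dense by (metis not_le)
  have "q islimpt B2 m" using assms(2) by simp
  moreover have "B2 m = {p \<in> B2 m. p \<le> b} \<union> {p \<in> B2 m. b < p}" by auto
  ultimately have "q islimpt {p \<in> B2 m. p \<le> b} \<or> q islimpt {p \<in> B2 m. b < p}"
    using islimpt_Un[of q "{p \<in> B2 m. p \<le> b}" "{p \<in> B2 m. b < p}"] by simp
  moreover have "\<not> q islimpt {p \<in> B2 m. p \<le> b}"
    by (rule islimpt_finite[OF finite_B2_below[OF assms(1) b(2)]])
  moreover have "\<not> q islimpt {p \<in> B2 m. b < p}"
  proof
    assume "q islimpt {p \<in> B2 m. b < p}"
    then obtain p where "b < p" "dist p q < b - q"
      using b by (auto simp: islimpt_approachable dest!: spec[of _ "b - q"])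
    then show False by (simp add: dist_real_def)
  qed
  ultimately show False by blast
qed

lemma compact_B2:
  assumes m: "1 \<le> m" shows "compact (B2 m)"
  unfolding compact_eq_bounded_closed
proof
  have "B2 m \<subseteq> {1..real m + 1}" using B2_bound by force
  then show "bounded (B2 m)" using bounded_subset bounded_closed_interval by blast
  show "closed (B2 m)"
    unfolding closed_sequential_limits
  proof (intro allI impI, elim conjE)
    fix Q :: "nat \<Rightarrow> real" and q assume Q: "\<forall>n. Q n \<in> B2 m" "Q \<longlonglongrightarrow> q"
    show "q \<in> B2 m"
    proof (cases "q = \<G> m")
      case False
      then show ?thesis using B2_sequence_limit[OF m _ Q(2)] Q(1) by blast
    next
      case True
      \<comment> \<open>Below b only finitely many elements of \<open>B2 m\<close> exist, and the
        sequence eventually stays among them.\<close>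
      obtain b where b: "q < b" "b < q_f m" using dense[OF G_less_q_f[OF m]] True by blast
      have "closed {p \<in> B2 m. p \<le> b}" by (rule finite_imp_closed[OF finite_B2_below[OF m b(2)]])
      moreover have "\<forall>\<^sub>F n in sequentially. Q n \<in> {p \<in> B2 m. p \<le> b}"
        using order_tendstoD(2)[OF Q(2) b(1)] by eventually_elim (use Q(1) in auto)
      ultimately have "q \<in> {p \<in> B2 m. p \<le> b}"
        using Q(2) by (intro Lim_in_closed_set) auto
      then show ?thesis by simp
    qed
  qed
qed

lemma closure_U_subset_B2_inf:
  assumes m: "1 \<le> m" shows "closure (\<U> m) \<subseteq> B2_inf m"
proof -
  have B2: "closure (\<U> m) \<subseteq> B2 m"
    using closure_minimal[OF _ compact_imp_closed[OF compact_B2[OF m]]] U_subset_B2_derived[OF m, of 0]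
    by simp
  have "closure (\<U> m) \<subseteq> B2_derived m i" for i
  proof
    fix q assume q: "q \<in> closure (\<U> m)"
    then have "q islimpt \<U> m" using U_imp_islimpt[OF m] by (auto simp: closure_def)
    \<comment> \<open>Closedness of \<open>B2 m\<close> keeps q above 1, as
      \<open>base_interval m\<close> is open there.\<close>
    moreover have "q \<in> base_interval m" using q B2 by (auto simp: B2_def)
    ultimately show "q \<in> B2_derived m i"
      using B2 q islimpt_subset[OF _ U_subset_B2_derived[OF m]] by (cases i) auto
  qed
  then show ?thesis by (auto simp: B2_inf_def)
qed

theorem theorem1p2:
  fixes m :: nat
  assumes "m \<ge> 1"
  shows "compact (B2 m) \<and>
    closure (\<U> m) \<subseteq> B2_inf m \<and>
    \<V> m - {\<G> m} \<subseteq> B2_derived m 2 \<and>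
    is_minimum (B2_derived m 1) (q_f m) \<and> is_minimum (B2_derived m 2) (q_f m)"
  using compact_B2[OF assms] closure_U_subset_B2_inf[OF assms] V_subset_B2_derived[OF assms]
    q_f_in_B2_derived[OF assms] B2_derived_2_subset[of m] q_f_le_B2_derived[OF assms]
  unfolding is_minimum_def by blast

end
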